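(* Let $\mathfrak g$ be a (complex) simple Lie algebra with Killing form $(\cdot,\cdot)$, $\mathfrak h\subset\mathfrak g$ a Cartan subalgebra with corresponding Cartan subgroup $H$, and let $r$ be a classical dynamical $r$-matrix with spectral parameter associated with the pair $\mathfrak h\subset\mathfrak g$. Let $R:\mathfrak h^*\to\mathcal L(L\mathfrak g^*,L\mathfrak g)$ be the operator defined (for $q$ at which $r$ is defined) by $$(R_q\xi)(z)=\mathrm{p.v.}\,\frac1{2\pi i}\oint_C\big(r(q,w-z),\,\xi(w)\otimes1\big)\,dw,$$ where $0<|z|$ is small and $C$ is the positively oriented circle of radius $|z|$ centred at $0$. Then $R$ takes values in the space $\mathcal L(L\mathfrak g^*,L\mathfrak g)^H$ of $H$-equivariant linear maps, and satisfies the modified dynamical Yang-Baxter equation with $c=-\frac14$: for all $\xi,\eta\in L\mathfrak g^*$, $$[R\xi,R\eta]-R\big(I^{-1}[R\xi,I\eta]+I^{-1}[I\xi,R\eta]\big)+\mathcal X_{i^*\xi}(R\eta)-\mathcal X_{i^*\eta}(R\xi)+d(R\xi,\eta)=-\tfrac14[I\xi,I\eta].$$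
   Context: The Killing form is used to identify $\mathfrak g^*\cong\mathfrak g$ and $\mathfrak h^*\cong\mathfrak h$, and is extended to tensors by $(a\otimes b,c\otimes d)=(a,c)(b,d)$. The partial pairing is $(a\otimes b,\xi\otimes1)=(a,\xi)\,b\in\mathfrak g$. A classical dynamical $r$-matrix with spectral parameter associated with $\mathfrak h\subset\mathfrak g$ is a meromorphic function $r:\mathfrak h^*\times\mathbb C\to\mathfrak g\otimes\mathfrak g$ satisfying: (a) zero weight condition $[h\otimes1+1\otimes h,r(q,z)]=0$ for $h\in\mathfrak h$; (b) generalized unitarity $r^{12}(q,z)+r^{21}(q,-z)=0$; (c) residue condition $\mathrm{Res}_{z=0}r(q,z)=\Omega$, where $\Omega\in(S^2\mathfrak g)^{\mathfrak g}$ is the Casimir element of the Killing form; (d) the classical dynamical Yang-Baxter equation $$\mathrm{Alt}(d_{\mathfrak h}r)+[r^{12}(q,z_{1,2}),r^{13}(q,z_{1,3})]+[r^{12}(q,z_{1,2}),r^{23}(q,z_{2,3})]+[r^{13}(q,z_{1,3}),r^{23}(q,z_{2,3})]=0,$$ with $z_{i,j}=z_i-z_j$ and $\mathrm{Alt}(d_{\mathfrak h}r)=\sum_i\big(h_i^{(1)}\partial_ir^{23}(q,z_{2,3})+h_i^{(2)}\partial_ir^{31}(q,z_{3,1})+h_i^{(3)}\partial_ir^{12}(q,z_{1,2})\big)$, where $(h_i)$ is an orthonormal basis of $\mathfrak h$ and $\partial_i$ is the derivative in $q$ along the corresponding coordinate of $\mathfrak h^*\cong\mathfrak h$. $L\mathfrak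 g$ is the Lie algebra (pointwise bracket) of Laurent series $\sum_{n\ge-N}\xi_nz^n$ with coefficients in $\mathfrak g$ converging in some annulus $0<|z|<\epsilon$ (which may depend on the series). $L\mathfrak g^*$ (the restricted dual) is defined in the same way with coefficients in $\mathfrak g^*$, paired with $L\mathfrak g$ by $\langle\xi,X\rangle=\frac1{2\pi i}\oint\langle\xi(z),X(z)\rangle dz$ over a small circle around $0$. $I:L\mathfrak g^*\to L\mathfrak g$ is the isomorphism induced coefficientwise by the Killing form. $\mathfrak h\subset L\mathfrak g$ as constant series; $i:\mathfrak h\to L\mathfrak g$ is this inclusion and $i^*:L\mathfrak g^*\to\mathfrak h^*$ its transpose (the restriction to $\mathfrak h$ of the residue of $\xi$ at $z=0$). $H$ acts on $L\mathfrak g$ and $L\mathfrak g^*$ pointwise by the adjoint and coadjoint actions. In the definition of $R_q\xi$: choose $r_0>0$ such that $r(q,z)$ has no pole in $|z|<r_0$ other than $0$; then take $0<|z|<\frac12r_0$ (and $|z|$ in the annulus of convergence of $\xi$). $\mathrm{p.v.}$ is the principal value of the improper integral (singular at $w=z$). Here $R_q$ is the value of $R$ at $q$. For $a\in\mathfrak h^*$, $\mathcal X_a$ is the derivative with respect to $q$ along the constant vector field $a$ on $\mathfrak h^*$. For constant $\xi,\eta$, $d(R\xi,\eta)$ is the differential of the function $q\mapsto\langle\eta,R_q\xi\rangle$, regarded as an $\mathfrak h$-valued function of $q$, with $\mathfrak h\subset L\mathfrak g$. *)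

theory Defs
  imports "HOL-Complex_Analysis.Complex_Analysis"
begin

text \<open>
  A finite-dimensional complex Lie algebra is given by a bracket \<open>br\<close> on \<open>complex ^ 'n\<close>, that is,
  a basis \<open>e\<^sub>i = axis i 1\<close> of \<open>\<gg>\<close> is fixed.  Coordinates:
  \<^item> \<open>\<xi> \<in> \<gg>\<^sup>*\<close> is the vector of the values \<open>\<xi>(e\<^sub>i)\<close>;
  \<^item> \<open>T \<in> \<gg> \<otimes> \<gg>\<close> is the matrix with \<open>T = (\<Sum>i j. T $ i $ j e\<^sub>i \<otimes> e\<^sub>j)\<close>, and similarly for
    \<open>\<gg> \<otimes> \<gg> \<otimes> \<gg>\<close>;
  \<^item> an orthonormal basis \<open>hb\<close> of \<open>\<hh>\<close> is fixed and \<open>q \<in> \<hh>\<^sup>*\<close> is the vector of the values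
    \<open>q(hb k)\<close>; since \<open>hb\<close> is orthonormal, these are also the coordinates of \<open>q\<close> with respect to
    \<open>hb\<close> under the identification of \<open>\<hh>\<^sup>*\<close> and \<open>\<hh>\<close> by the Killing form;
  \<^item> an element of \<open>L\<gg>\<close> or \<open>L\<gg>\<^sup>*\<close> is a vector of formal Laurent series (\<open>fls\<close>), one for each
    coordinate, with nonempty annulus of convergence.
\<close>

section \<open>Lie algebras\<close>

definition lie_algebra :: "(complex^'n \<Rightarrow> complex^'n \<Rightarrow> complex^'n) \<Rightarrow> bool" where
  "lie_algebra br \<longleftrightarrow>
     (\<forall>x. Vector_Spaces.linear (*s) (*s) (br x)) \<and>
     (\<forall>y. Vector_Spaces.linear (*s) (*s) (\<lambda>x. br x y)) \<and>
     (\<forall>x. br x x = 0) \<and>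
     (\<forall>x y z. br x (br y z) + br y (br z x) + br z (br x y) = 0)"

definition lie_ideal :: "(complex^'n \<Rightarrow> complex^'n \<Rightarrow> complex^'n) \<Rightarrow> (complex^'n) set \<Rightarrow> bool" where
  "lie_ideal br I \<longleftrightarrow> vec.subspace I \<and> (\<forall>x. \<forall>y\<in>I. br x y \<in> I)"

definition simple_lie_algebra :: "(complex^'n \<Rightarrow> complex^'n \<Rightarrow> complex^'n) \<Rightarrow> bool" where
  "simple_lie_algebra br \<longleftrightarrow>
     lie_algebra br \<and> (\<exists>x y. br x y \<noteq> 0) \<and> (\<forall>I. lie_ideal br I \<longrightarrow> I = {0} \<or> I = UNIV)"

definition ad :: "(complex^'n \<Rightarrow> complex^'n \<Rightarrow> complex^'n) \<Rightarrow> complex^'n \<Rightarrow> complex^'n^'n" where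
  "ad br x = matrix (br x)"

definition killing :: "(complex^'n \<Rightarrow> complex^'n \<Rightarrow> complex^'n) \<Rightarrow> complex^'n \<Rightarrow> complex^'n \<Rightarrow> complex"
  where "killing br x y = trace (ad br x ** ad br y)"

text \<open>The matrix of the isomorphism from \<open>\<gg>\<close> to \<open>\<gg>\<^sup>*\<close> given by the (symmetric) Killing form.\<close>

definition killing_matrix :: "(complex^'n \<Rightarrow> complex^'n \<Rightarrow> complex^'n) \<Rightarrow> complex^'n^'n" where
  "killing_matrix br = (\<chi> i j. killing br (axis i 1) (axis j 1))"

text \<open>\<open>\<Omega> = (\<Sum>i. e\<^sub>i \<otimes> e\<^sup>i)\<close> for the dual basis \<open>e\<^sup>i\<close>, whose \<open>j\<close>-th coordinate is the \<open>(i, j)\<close>-entry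
  of the inverse Gram matrix.\<close>

definition casimir :: "(complex^'n \<Rightarrow> complex^'n \<Rightarrow> complex^'n) \<Rightarrow> complex^'n^'n" where
  "casimir br = matrix_inv (killing_matrix br)"

primrec lower_central ::
    "(complex^'n \<Rightarrow> complex^'n \<Rightarrow> complex^'n) \<Rightarrow> (complex^'n) set \<Rightarrow> nat \<Rightarrow> (complex^'n) set" where
  "lower_central br h 0 = h"
| "lower_central br h (Suc n) = vec.span {br x y |x y. x \<in> h \<and> y \<in> lower_central br h n}"

text \<open>A Cartan subalgebra is a nilpotent self-normalizing subalgebra.\<close>

definition cartan_subalgebra ::
    "(complex^'n \<Rightarrow> complex^'n \<Rightarrow> complex^'n) \<Rightarrow> (complex^'n) set \<Rightarrow> bool" where
  "cartan_subalgebra br h \<longleftrightarrow>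
     vec.subspace h \<and> (\<forall>x\<in>h. \<forall>y\<in>h. br x y \<in> h) \<and>
     (\<exists>n. lower_central br h n = {0}) \<and>
     {x. \<forall>y\<in>h. br x y \<in> h} = h"

definition orthonormal_basis ::
    "(complex^'n \<Rightarrow> complex^'n \<Rightarrow> complex^'n) \<Rightarrow> (complex^'n) set \<Rightarrow> ('l \<Rightarrow> complex^'n) \<Rightarrow> bool" where
  "orthonormal_basis br h hb \<longleftrightarrow>
     vec.span (range hb) = h \<and> (\<forall>k m. killing br (hb k) (hb m) = (if k = m then 1 else 0))"

definition matrix_exp :: "complex^'n^'n \<Rightarrow> complex^'n^'n" where
  "matrix_exp A = (\<Sum>m. (1 / fact m) *\<^sub>R (((**) A ^^ m) (mat 1)))"

text \<open>The image of the Cartan subgroup \<open>H\<close> under the adjoint representation: the connected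
  subgroup of \<open>GL(\<gg>)\<close> with Lie algebra \<open>ad(\<hh>)\<close>.  The (co)adjoint action of \<open>H\<close> factors through it.\<close>

inductive_set cartan_group ::
    "(complex^'n \<Rightarrow> complex^'n \<Rightarrow> complex^'n) \<Rightarrow> (complex^'n) set \<Rightarrow> (complex^'n^'n) set"
  for br and h where
  exp_in: "x \<in> h \<Longrightarrow> matrix_exp (ad br x) \<in> cartan_group br h"
| mult_in: "A \<in> cartan_group br h \<Longrightarrow> B \<in> cartan_group br h \<Longrightarrow> A ** B \<in> cartan_group br h"
| inv_in: "A \<in> cartan_group br h \<Longrightarrow> matrix_inv A \<in> cartan_group br h"

section \<open>Meromorphic functions on \<open>\<hh>\<^sup>* \<times> \<complex>\<close>\<close>

definition holomorphic_on2 ::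
    "((complex^'l::finite) \<times> complex \<Rightarrow> complex) \<Rightarrow> ((complex^'l::finite) \<times> complex) set \<Rightarrow> bool" where
  "holomorphic_on2 f S \<longleftrightarrow> open S \<and>
     (\<forall>p\<in>S. \<exists>D. (f has_derivative D) (at p) \<and> (\<forall>c v w. D (c *s v, c * w) = c * D (v, w)))"

text \<open>Locally a quotient of holomorphic functions, the denominator not vanishing identically on
  any nonempty open set.  The values at zeros of the denominator are unconstrained.\<close>

definition meromorphic2 :: "((complex^'l::finite) \<times> complex \<Rightarrow> complex) \<Rightarrow> bool" where
  "meromorphic2 f \<longleftrightarrow>
     (\<forall>p. \<exists>U u v. p \<in> U \<and> holomorphic_on2 u U \<and> holomorphic_on2 v U \<and>
        interior {x\<in>U. v x = 0} = {} \<and> (\<forall>x\<in>U. v x \<noteq> 0 \<longrightarrow> f x = u x / v x))"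

definition regular_at ::
    "(complex^'l \<Rightarrow> complex \<Rightarrow> complex^'n^'n) \<Rightarrow> complex^'l \<Rightarrow> complex \<Rightarrow> bool" where
  "regular_at r q z \<longleftrightarrow>
     (\<exists>U. (q, z) \<in> U \<and> (\<forall>i j. holomorphic_on2 (\<lambda>(q, z). r q z $ i $ j) U))"

text \<open>The points \<open>q\<close> at which \<open>r\<close> is defined as a function of small \<open>z \<noteq> 0\<close>.  The radius is
  required to work on a neighbourhood of \<open>q\<close>, because \<open>q\<close>-derivatives at fixed \<open>z\<close> are taken.\<close>

definition regular_points ::
    "(complex^'l \<Rightarrow> complex \<Rightarrow> complex^'n^'n) \<Rightarrow> (complex^'l) set" where
  "regular_points r =
     {q. \<exists>U r0. open U \<and> q \<in> U \<and> r0 > 0 \<and>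
           (\<forall>q'\<in>U. \<forall>z. 0 < norm z \<and> norm z < r0 \<longrightarrow> regular_at r q' z)}"

definition partial_q :: "'l::finite \<Rightarrow> (complex^'l \<Rightarrow> complex) \<Rightarrow> complex^'l \<Rightarrow> complex" where
  "partial_q k f q = deriv (\<lambda>t. f (q + axis k t)) 0"

section \<open>Dynamical r-matrices\<close>

text \<open>For \<open>A, B \<in> \<gg> \<otimes> \<gg>\<close>: the brackets \<open>[A\<^sup>1\<^sup>2, B\<^sup>1\<^sup>3]\<close>, \<open>[A\<^sup>1\<^sup>2, B\<^sup>2\<^sup>3]\<close>, \<open>[A\<^sup>1\<^sup>3, B\<^sup>2\<^sup>3]\<close> in
  \<open>\<gg> \<otimes> \<gg> \<otimes> \<gg>\<close>.\<close>

definition br_12_13 ::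
    "(complex^'n \<Rightarrow> complex^'n \<Rightarrow> complex^'n) \<Rightarrow> complex^'n^'n \<Rightarrow> complex^'n^'n \<Rightarrow> complex^'n^'n^'n" where
  "br_12_13 br A B =
     (\<chi> i j k. \<Sum>a\<in>UNIV. \<Sum>b\<in>UNIV. A $ a $ j * B $ b $ k * br (axis a 1) (axis b 1) $ i)"

definition br_12_23 ::
    "(complex^'n \<Rightarrow> complex^'n \<Rightarrow> complex^'n) \<Rightarrow> complex^'n^'n \<Rightarrow> complex^'n^'n \<Rightarrow> complex^'n^'n^'n" where
  "br_12_23 br A B =
     (\<chi> i j k. \<Sum>a\<in>UNIV. \<Sum>b\<in>UNIV. A $ i $ a * B $ b $ k * br (axis a 1) (axis b 1) $ j)"

definition br_13_23 ::
    "(complex^'n \<Rightarrow> complex^'n \<Rightarrow> complex^'n) \<Rightarrow> complex^'n^'n \<Rightarrow> complex^'n^'n \<Rightarrow> complex^'n^'n^'n" where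
  "br_13_23 br A B =
     (\<chi> i j k. \<Sum>a\<in>UNIV. \<Sum>b\<in>UNIV. A $ i $ a * B $ j $ b * br (axis a 1) (axis b 1) $ k)"

text \<open>\<open>Alt(d r)\<close> at \<open>q, z\<^sub>1, z\<^sub>2, z\<^sub>3\<close>; the first leg of \<open>r\<^sup>3\<^sup>1\<close> sits in position 3.\<close>

definition alt_d ::
    "('l::finite \<Rightarrow> complex^'n) \<Rightarrow> (complex^'l \<Rightarrow> complex \<Rightarrow> complex^'n^'n) \<Rightarrow>
     complex^'l \<Rightarrow> complex \<Rightarrow> complex \<Rightarrow> complex \<Rightarrow> complex^'n^'n^'n" where
  "alt_d hb r q z1 z2 z3 =
     (\<chi> i j k. \<Sum>m\<in>UNIV.
        hb m $ i * partial_q m (\<lambda>q. r q (z2 - z3) $ j $ k) q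
      + hb m $ j * partial_q m (\<lambda>q. r q (z3 - z1) $ k $ i) q
      + hb m $ k * partial_q m (\<lambda>q. r q (z1 - z2) $ i $ j) q)"

text \<open>Identities between meromorphic functions are required at all points where each of the
  functions involved is holomorphic.\<close>

definition dynamical_r_matrix ::
    "(complex^'n \<Rightarrow> complex^'n \<Rightarrow> complex^'n) \<Rightarrow> (complex^'n) set \<Rightarrow> ('l::finite \<Rightarrow> complex^'n) \<Rightarrow>
     (complex^'l \<Rightarrow> complex \<Rightarrow> complex^'n^'n) \<Rightarrow> bool" where
  "dynamical_r_matrix br h hb r \<longleftrightarrow>
     (\<forall>i j. meromorphic2 (\<lambda>(q, z). r q z $ i $ j)) \<and>
     (\<forall>x\<in>h. \<forall>q z. regular_at r q z \<longrightarrow>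
        ad br x ** r q z + r q z ** transpose (ad br x) = 0) \<and>
     (\<forall>q z. regular_at r q z \<and> regular_at r q (-z) \<longrightarrow> r q z + transpose (r q (-z)) = 0) \<and>
     (\<forall>q\<in>regular_points r. \<forall>i j. residue (\<lambda>z. r q z $ i $ j) 0 = casimir br $ i $ j) \<and>
     (\<forall>q z1 z2 z3. regular_at r q (z1 - z2) \<and> regular_at r q (z1 - z3) \<and>
                   regular_at r q (z2 - z3) \<and> regular_at r q (z3 - z1) \<longrightarrow>
        alt_d hb r q z1 z2 z3
        + br_12_13 br (r q (z1 - z2)) (r q (z1 - z3))
        + br_12_23 br (r q (z1 - z2)) (r q (z2 - z3))
        + br_13_23 br (r q (z1 - z3)) (r q (z2 - z3)) = 0)"

section \<open>The loop algebra \<open>L\<gg>\<close> and its restricted dual\<close>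

definition loop_space :: "(complex fls^'n) set" where
  "loop_space = {X. \<forall>i. fls_conv_radius (X $ i) > 0}"

text \<open>Coefficientwise extensions of a vector and of a linear map to Laurent series.\<close>

definition const_loop :: "complex^'n \<Rightarrow> complex fls^'n" where
  "const_loop x = (\<chi> i. fls_const (x $ i))"

definition loop_map :: "complex^'n^'n \<Rightarrow> complex fls^'n \<Rightarrow> complex fls^'n" where
  "loop_map A X = map_matrix fls_const A *v X"

definition loop_bracket ::
    "(complex^'n \<Rightarrow> complex^'n \<Rightarrow> complex^'n) \<Rightarrow> complex fls^'n \<Rightarrow> complex fls^'n \<Rightarrow> complex fls^'n" where
  "loop_bracket br X Y =
     (\<chi> k. \<Sum>i\<in>UNIV. \<Sum>j\<in>UNIV. fls_const (br (axis i 1) (axis j 1) $ k) * X $ i * Y $ j)"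

text \<open>\<^const>\<open>residue\<close> is by definition the normalized integral over small circles.\<close>

definition loop_pairing :: "complex fls^'n \<Rightarrow> complex fls^'n \<Rightarrow> complex" where
  "loop_pairing \<xi> X = residue (\<lambda>z. \<Sum>i\<in>UNIV. eval_fls (\<xi> $ i) z * eval_fls (X $ i) z) 0"

definition I_map :: "(complex^'n \<Rightarrow> complex^'n \<Rightarrow> complex^'n) \<Rightarrow> complex fls^'n \<Rightarrow> complex fls^'n" where
  "I_map br = loop_map (matrix_inv (killing_matrix br))"

definition I_inv :: "(complex^'n \<Rightarrow> complex^'n \<Rightarrow> complex^'n) \<Rightarrow> complex fls^'n \<Rightarrow> complex fls^'n" where
  "I_inv br = loop_map (killing_matrix br)"

text \<open>The transpose \<open>i\<^sup>*\<close> of the inclusion of \<open>\<hh>\<close> into \<open>L\<gg>\<close>.\<close>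

definition i_star :: "('l \<Rightarrow> complex^'n) \<Rightarrow> complex fls^'n \<Rightarrow> complex^'l" where
  "i_star hb \<xi> = (\<chi> k. loop_pairing \<xi> (const_loop (hb k)))"

text \<open>The \<open>H\<close>-equivariant linear maps from \<open>L\<gg>\<^sup>*\<close> to \<open>L\<gg>\<close>; \<open>A\<close> acts on \<open>\<gg>\<^sup>*\<close> by the transpose of
  its inverse.\<close>

definition equivariant_maps ::
    "(complex^'n \<Rightarrow> complex^'n \<Rightarrow> complex^'n) \<Rightarrow> (complex^'n) set \<Rightarrow> (complex fls^'n \<Rightarrow> complex fls^'n) set"
  where
  "equivariant_maps br h =
     {T. (\<forall>\<xi>\<in>loop_space. T \<xi> \<in> loop_space) \<and>
         (\<forall>\<xi>\<in>loop_space. \<forall>\<eta>\<in>loop_space. T (\<xi> + \<eta>) = T \<xi> + T \<eta>) \<and>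
         (\<forall>c. \<forall>\<xi>\<in>loop_space. T (fls_const c *s \<xi>) = fls_const c *s T \<xi>) \<and>
         (\<forall>A\<in>cartan_group br h. \<forall>\<xi>\<in>loop_space.
            T (loop_map (transpose (matrix_inv A)) \<xi>) = loop_map A (T \<xi>))}"

section \<open>The operator \<open>R\<close>\<close>

text \<open>The principal value of the integral of \<open>f\<close> over the circle about 0 through \<open>z\<close>, with the
  singularity at \<open>z\<close>: an arc symmetric about \<open>z\<close> is removed.\<close>

definition has_pv_integral :: "(complex \<Rightarrow> complex) \<Rightarrow> complex \<Rightarrow> complex \<Rightarrow> bool" where
  "has_pv_integral f z c \<longleftrightarrow>
     (\<exists>J. (\<forall>\<^sub>F \<epsilon> in at_right 0.
             (f has_contour_integral J \<epsilon>)
               (part_circlepath 0 (norm z) (Arg z + \<epsilon>) (Arg z + 2 * pi - \<epsilon>))) \<and>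
          (J \<longlongrightarrow> c) (at_right 0))"

text \<open>\<open>X\<close> is the Laurent series of \<open>z \<mapsto> p.v. (1 / 2\<pi>\<i>) \<integral> (r(q, w - z), \<xi>(w) \<otimes> 1) dw\<close>, for all small
  \<open>z \<noteq> 0\<close>.\<close>

definition is_R ::
    "(complex^'l \<Rightarrow> complex \<Rightarrow> complex^'n^'n) \<Rightarrow> complex^'l \<Rightarrow> complex fls^'n \<Rightarrow> complex fls^'n \<Rightarrow> bool" where
  "is_R r q \<xi> X \<longleftrightarrow> X \<in> loop_space \<and>
     (\<forall>\<^sub>F z in at 0. \<forall>j.
        has_pv_integral (\<lambda>w. \<Sum>i\<in>UNIV. r q (w - z) $ i $ j * eval_fls (\<xi> $ i) w) z
          (2 * pi * \<i> * eval_fls (X $ j) z))"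

definition R_op ::
    "(complex^'l \<Rightarrow> complex \<Rightarrow> complex^'n^'n) \<Rightarrow> complex^'l \<Rightarrow> complex fls^'n \<Rightarrow> complex fls^'n" where
  "R_op r q \<xi> = (THE X. is_R r q \<xi> X)"

text \<open>\<open>X\<close> is the derivative at \<open>q\<close> along \<open>a\<close> of the \<open>L\<gg>\<close>-valued function \<open>F\<close>, taken at each small
  fixed \<open>z \<noteq> 0\<close>.\<close>

definition is_X_deriv ::
    "complex^'l \<Rightarrow> (complex^'l \<Rightarrow> complex fls^'n) \<Rightarrow> complex^'l \<Rightarrow> complex fls^'n \<Rightarrow> bool" where
  "is_X_deriv a F q X \<longleftrightarrow> X \<in> loop_space \<and>
     (\<forall>\<^sub>F z in at 0. \<forall>i.
        ((\<lambda>t. eval_fls (F (q + t *s a) $ i) z) has_field_derivative eval_fls (X $ i) z) (at 0))"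

definition X_deriv ::
    "complex^'l \<Rightarrow> (complex^'l \<Rightarrow> complex fls^'n) \<Rightarrow> complex^'l \<Rightarrow> complex fls^'n" where
  "X_deriv a F q = (THE X. is_X_deriv a F q X)"

text \<open>The differential at \<open>q\<close> of a function on \<open>\<hh>\<^sup>*\<close>, as an element of \<open>(\<hh>\<^sup>*)\<^sup>* = \<hh>\<close>: the functional
  \<open>a \<mapsto> a(hb k)\<close> is \<open>hb k\<close>.\<close>

definition h_differential ::
    "('l::finite \<Rightarrow> complex^'n) \<Rightarrow> (complex^'l \<Rightarrow> complex) \<Rightarrow> complex^'l \<Rightarrow> complex^'n" where
  "h_differential hb f q = (\<Sum>k\<in>UNIV. partial_q k f q *s hb k)"

end

theory Submission
  imports Defs
begin

text \<open>
  Integrating the Yang-Baxter equation near the singularity shows that every Laurent coefficient of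
  \<open>r\<close> of negative order is \<open>\<gg>\<close>-invariant and, one order further, that those of order below \<open>-1\<close>
  commute with \<open>\<Omega>\<close> in one leg.  As the Killing form is nondegenerate and \<open>\<gg>\<close> has no centre, the
  pole is simple, with residue \<open>\<Omega>\<close>.

  Hence the principal value is the mean of the integrals over a slightly smaller and a slightly larger
  circle, which are \<open>R - I / 2\<close> and \<open>R + I / 2\<close>.  Now pair the Yang-Baxter equation at \<open>(z\<^sub>1, z\<^sub>2, z)\<close>
  with \<open>\<xi>(z\<^sub>1) \<otimes> \<eta>(z\<^sub>2)\<close> in the first two legs and integrate over \<open>|z\<^sub>2| < |z\<^sub>1| < |z|\<close>.  With
  \<open>Q = R - I / 2\<close> the terms become \<open>[Q \<xi>, Q \<eta>]\<close>, \<open>- Q I\<^sup>-\<^sup>1 [I \<xi>, Q \<eta>]\<close>, \<open>- Q I\<^sup>-\<^sup>1 [Q \<xi> + I \<xi>, I \<eta>]\<close> (the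
  only integral in which the inner evaluation point is encircled) and the three derivative terms, and
  substituting \<open>Q = R - I / 2\<close> leaves the constant \<open>- 1 / 4\<close>.
\<close>

text \<open>The residue condition fixes a single Laurent coefficient of \<open>r\<close> at
  \<open>z = 0\<close>; it does not bound the order of the singularity, while the principal value
  calls for a simple pole. The argument therefore works with the moments
  \<open>residue (u ^ p * r)\<close> and kills all of them with \<open>p \<ge> 1\<close> directly,
  never singling out a leading coefficient. A second obstacle is differentiation in
  \<open>q\<close>. Regularity means differentiability at each point of an open set, whereas
  differentiating under an integral asks for jointly continuous derivatives; Cauchy's formula
  supplies them. Since the polar part \<Omega> / z does not depend on \<open>q\<close>, the
  q-derivative of \<open>r\<close> extends holomorphically over \<open>z = 0\<close>. The three
  derivative terms thus receive no correction by I / 2, whichever circle is used, and the constant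
  arises from the bracket terms alone. The computation runs on circles that miss the evaluation
  point; the principal value enters only to identify \<open>R\<close> with such integrals.\<close>

no_notation fps_nth (infixl "$" 75)

section \<open>Lie algebras and the Killing form\<close>

lemma matrix_inv_cancel:
  assumes "invertible A"
  shows "A ** matrix_inv A = mat 1" "matrix_inv A ** A = mat 1"
  using someI_ex[OF assms[unfolded invertible_def]] unfolding matrix_inv_def by auto

locale complex_lie_algebra =
  fixes br :: "complex^'n \<Rightarrow> complex^'n \<Rightarrow> complex^'n"
  assumes lie: "lie_algebra br"
begin

abbreviation sc :: "'n \<Rightarrow> 'n \<Rightarrow> 'n \<Rightarrow> complex" where
  "sc a b k \<equiv> br (axis a 1) (axis b 1) $ k"

lemma ad_works: "ad br x *v y = br x y"
  using lie unfolding lie_algebra_def ad_def by (metis matrix_works)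

lemma bracket_left:
  "br (x + y) z = br x z + br y z" "br (c *s x) z = c *s br x z" "br 0 z = 0"
  "br (x - y) z = br x z - br y z" "br (- x) z = - br x z" "br (sum f A) z = (\<Sum>i\<in>A. br (f i) z)"
proof -
  interpret Vector_Spaces.linear "(*s)" "(*s)" "\<lambda>x. br x z"
    using lie unfolding lie_algebra_def by blast
  show "br (x + y) z = br x z + br y z" "br (c *s x) z = c *s br x z" "br 0 z = 0"
    "br (x - y) z = br x z - br y z" "br (- x) z = - br x z" "br (sum f A) z = (\<Sum>i\<in>A. br (f i) z)"
    by (rule add scale zero diff neg sum)+
qed

lemma bracket_right:
  "br z (x + y) = br z x + br z y" "br z (c *s x) = c *s br z x" "br z 0 = 0"
  "br z (x - y) = br z x - br z y" "br z (- x) = - br z x" "br z (sum f A) = (\<Sum>i\<in>A. br z (f i))"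
proof -
  interpret Vector_Spaces.linear "(*s)" "(*s)" "\<lambda>x. br z x"
    using lie unfolding lie_algebra_def by blast
  show "br z (x + y) = br z x + br z y" "br z (c *s x) = c *s br z x" "br z 0 = 0"
    "br z (x - y) = br z x - br z y" "br z (- x) = - br z x" "br z (sum f A) = (\<Sum>i\<in>A. br z (f i))"
    by (rule add scale zero diff neg sum)+
qed

lemma bracket_antisym: "br x y = - br y x"
proof -
  have "br (x + y) (x + y) = 0" "br x x = 0" "br y y = 0"
    using lie unfolding lie_algebra_def by auto
  then have "br x y + br y x = 0"
    by (simp add: bracket_left bracket_right add.commute)
  then show ?thesis by (simp add: eq_neg_iff_add_eq_0)
qed

lemma jacobi: "br x (br y z) + br y (br z x) + br z (br x y) = 0"
  using lie unfolding lie_algebra_def by blast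

lemma bracket_component:
  "br x y $ k = (\<Sum>a\<in>UNIV. \<Sum>b\<in>UNIV. sc a b k * x $ a * y $ b)"
proof -
  have "br x y = br (\<Sum>a\<in>UNIV. x $ a *s axis a 1) (\<Sum>b\<in>UNIV. y $ b *s axis b 1)"
    by (simp only: basis_expansion)
  also have "\<dots> = (\<Sum>a\<in>UNIV. \<Sum>b\<in>UNIV. x $ a *s (y $ b *s br (axis a 1) (axis b 1)))"
    unfolding bracket_left(6) bracket_left(2) bracket_right(6) bracket_right(2) vec.scale_sum_right
    by (subst sum.swap) (simp add: vec_eq_iff mult_ac)
  finally show ?thesis by (simp add: mult_ac)
qed

lemma ad_component: "ad br x $ k $ b = (\<Sum>a\<in>UNIV. sc a b k * x $ a)"
proof -
  have "ad br x $ k $ b = br x (axis b 1) $ k"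
    by (simp add: ad_def matrix_def)
  also have "\<dots> = (\<Sum>a\<in>UNIV. \<Sum>b'\<in>UNIV. if b' = b then sc a b k * x $ a else 0)"
    unfolding bracket_component[of x] by (intro sum.cong refl) (auto simp: axis_def)
  finally show ?thesis by simp
qed

lemma ad_bracket: "ad br (br x y) = ad br x ** ad br y - ad br y ** ad br x"
proof -
  have "ad br (br x y) *v z = (ad br x ** ad br y - ad br y ** ad br x) *v z" for z
  proof -
    have "br z (br x y) = - br (br x y) z" "br y (br z x) = - br y (br x z)"
      using bracket_antisym[of z "br x y"] bracket_antisym[of z x] by (simp_all add: bracket_right)
    then have "br (br x y) z = br x (br y z) - br y (br x z)"
      using jacobi[of x y z] by (simp add: eq_diff_eq)
    then show ?thesis
      by (simp add: matrix_vector_mult_diff_rdistrib ad_works flip: matrix_vector_mul_assoc)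
  qed
  then show ?thesis by (simp add: matrix_eq)
qed

lemma killing_sym: "killing br x y = killing br y x"
  unfolding killing_def by (rule trace_mul_sym)

text \<open>Cyclicity of the trace, once \<open>ad_bracket\<close> has turned both sides into traces
  of triple products.\<close>

lemma killing_invariant: "killing br (br x y) z = killing br x (br y z)"
proof -
  have diff: "(A - B) ** C = A ** C - B ** C" "C ** (A - B) = C ** A - C ** B" for A B C :: "complex^'n^'n"
    by (simp_all add: vec_eq_iff matrix_matrix_mult_def left_diff_distrib right_diff_distrib sum_subtractf)
  have "trace (ad br y ** ad br x ** ad br z) = trace (ad br x ** (ad br z ** ad br y))"
    by (metis matrix_mul_assoc trace_mul_sym)
  then show ?thesis
    unfolding killing_def ad_bracket diff by (simp add: trace_sub matrix_mul_assoc)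
qed

lemma killing_linear:
  "killing br (x + y) z = killing br x z + killing br y z"
  "killing br (c *s x) z = c * killing br x z" "killing br (sum f A) z = (\<Sum>i\<in>A. killing br (f i) z)"
proof -
  have ad: "ad br (x + y) = ad br x + ad br y" "ad br (c *s x) = (\<chi> i j. c * ad br x $ i $ j)" for x y c
    by (simp_all add: vec_eq_iff ad_component distrib_left distrib_right sum.distrib sum_distrib_left mult_ac)
  show add: "killing br (x + y) z = killing br x z + killing br y z" for x y
    unfolding killing_def ad 
    by (simp add: trace_def matrix_matrix_mult_def distrib_right sum.distrib)
  show sc: "killing br (c *s x) z = c * killing br x z" for c x
    unfolding killing_def ad
    by (simp add: trace_def matrix_matrix_mult_def sum_distrib_left mult_ac)
  show "killing br (sum f A) z = (\<Sum>i\<in>A. killing br (f i) z)"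
    using add sc[of 0 0] by (induction A rule: infinite_finite_induct) auto
qed

lemma killing_eq_matrix:
  "killing br x y = (\<Sum>i\<in>UNIV. x $ i * (killing_matrix br *v y) $ i)"
proof -
  have *: "killing br x y = (\<Sum>i\<in>UNIV. x $ i * killing br (axis i 1) y)" for x y
    by (subst basis_expansion[symmetric, of x]) (simp only: killing_linear)
  have "killing br (axis i 1) y = (killing_matrix br *v y) $ i" for i
    using *[of y "axis i 1"]
    by (simp add: killing_sym[of y] killing_sym[of "axis _ 1" "axis i 1"] matrix_vector_mult_def killing_matrix_def mult.commute)
  then show ?thesis using *[of x y] by simp
qed

lemma killing_matrix_sym: "transpose (killing_matrix br) = killing_matrix br"
  by (simp add: vec_eq_iff transpose_def killing_matrix_def) (metis killing_sym)

end

locale simple_lie_setup = complex_lie_algebra br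
  for br :: "complex^'n \<Rightarrow> complex^'n \<Rightarrow> complex^'n" +
  fixes h :: "(complex^'n) set" and hb :: "'l::finite \<Rightarrow> complex^'n"
  assumes simple: "simple_lie_algebra br"
    and onb: "orthonormal_basis br h hb"
begin

section \<open>Simplicity: nondegeneracy, trivial centre, and the Casimir element\<close>

abbreviation "\<Omega> \<equiv> casimir br"
abbreviation "KM \<equiv> killing_matrix br"

text \<open>The radical of the form is an ideal, hence zero or everything. The orthonormal basis
  excludes the latter: index types are nonempty, so \<open>hb undefined\<close> is a vector of
  square 1.\<close>

lemma killing_nondegenerate:
  assumes "\<And>y. killing br x y = 0" shows "x = 0"
proof -
  let ?N = "{x. \<forall>y. killing br x y = 0}"
  have "vec.subspace ?N"
    by (rule vec.subspaceI) (use killing_linear(2)[of 0 0] in \<open>auto simp: killing_linear\<close>)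
  moreover have "br x y \<in> ?N" if "y \<in> ?N" for x y
    using that bracket_antisym[of x y] killing_linear(2)[of "-1" "br y x"]
    by (simp add: killing_invariant)
  ultimately have "?N = {0} \<or> ?N = UNIV"
    using simple unfolding simple_lie_algebra_def lie_ideal_def by blast
  moreover have "hb undefined \<notin> ?N"
    using onb unfolding orthonormal_basis_def by (auto intro!: exI[of _ "hb undefined"])
  ultimately show ?thesis using assms by blast
qed

text \<open>The centre is an ideal, and simplicity includes a nonzero bracket. Testing against basis
  vectors suffices, and this is the form in which identities between components deliver the
  hypothesis.\<close>

lemma center_eq_0:
  assumes "\<And>b. br x (axis b 1) = 0" shows "x = 0"
proof -
  let ?Z = "{x. \<forall>y. br x y = 0}"
  have "vec.subspace ?Z"
    by (rule vec.subspaceI) (auto simp: bracket_left)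
  moreover have "br x y \<in> ?Z" if "y \<in> ?Z" for x y
    using that bracket_antisym[of x y] by (simp add: bracket_left)
  ultimately have "?Z = {0} \<or> ?Z = UNIV"
    using simple unfolding simple_lie_algebra_def lie_ideal_def by blast
  moreover have "?Z \<noteq> UNIV"
    using simple unfolding simple_lie_algebra_def by blast
  moreover have "x \<in> ?Z"
  proof -
    have "br x y = (\<Sum>b\<in>UNIV. y $ b *s br x (axis b 1))" for y
      by (subst basis_expansion[symmetric, of y]) (simp only: bracket_right)
    then show ?thesis using assms by simp
  qed
  ultimately show ?thesis by blast
qed

lemma invertible_KM: "invertible KM"
proof -
  have "x = 0" if "KM *v x = 0" for x
    by (rule killing_nondegenerate) (subst killing_sym, simp add: killing_eq_matrix that)
  then show ?thesis
    unfolding invertible_left_inverse matrix_left_invertible_ker by blast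
qed

lemma KM_casimir: "KM ** \<Omega> = mat 1" "\<Omega> ** KM = mat 1"
  using matrix_inv_cancel[OF invertible_KM] by (simp_all add: casimir_def)

lemma casimir_sym: "transpose \<Omega> = \<Omega>"
proof -
  have "transpose \<Omega> ** KM = mat 1"
    using arg_cong[OF KM_casimir(1), of transpose] by (simp add: matrix_transpose_mul killing_matrix_sym)
  then show ?thesis
    by (metis KM_casimir(1) matrix_mul_assoc matrix_mul_lid matrix_mul_rid)
qed

text \<open>In coordinates: \<open>(e\<^sub>b, [x, I y]) = - y([x, e\<^sub>b])\<close>.\<close>

lemma KM_bracket:
  "KM *v br x (\<Omega> *v y) = - (transpose (ad br x) *v y)"
proof -
  have "KM *v br x z = - (transpose (ad br x) *v (KM *v z))" for z
  proof -
    have "(KM *v br x z) $ b = - (transpose (ad br x) *v (KM *v z)) $ b" for b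
    proof -
      have eq: "killing br (axis b 1) u = (KM *v u) $ b" for u
        by (simp add: killing_eq_matrix axis_def if_distrib[of "\<lambda>x. x * _"] cong: if_cong)
      have "(KM *v br x z) $ b = killing br (br (axis b 1) x) z"
        by (simp add: eq[symmetric] killing_invariant)
      also have "\<dots> = - killing br (br x (axis b 1)) z"
        using bracket_antisym[of "axis b 1" x] killing_linear(2)[of "-1" "br x (axis b 1)"] by simp
      also have "\<dots> = - (transpose (ad br x) *v (KM *v z)) $ b"
        by (simp add: killing_eq_matrix matrix_vector_mult_def transpose_def ad_def matrix_def)
      finally show ?thesis .
    qed
    then show ?thesis by (simp add: vec_eq_iff)
  qed
  from this[of "\<Omega> *v y"] show ?thesis
    by (simp add: matrix_vector_mul_assoc KM_casimir)
qed

text \<open>\<Omega> is the inverse Gram matrix, so contracting with it loses nothing: lowering the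
  last index recovers \<open>f\<close>. The next two lemmas strip \<Omega> from tensor identities in
  this way.\<close>

lemma casimir_contract:
  "(\<Sum>k\<in>UNIV. (\<Sum>b\<in>UNIV. f b * \<Omega> $ b $ k) * KM $ k $ c) = f c"
proof -
  have "(\<Sum>k\<in>UNIV. (\<Sum>b\<in>UNIV. f b * \<Omega> $ b $ k) * KM $ k $ c)
      = (\<Sum>b\<in>UNIV. f b * (\<Omega> ** KM) $ b $ c)"
    by (simp add: sum_distrib_left sum_distrib_right matrix_matrix_mult_def mult.assoc) (rule sum.swap)
  then show ?thesis
    by (simp add: KM_casimir mat_def if_distrib[of "\<lambda>x. _ * x"] cong: if_cong)
qed

text \<open>The sum is linear in \<open>B\<close>, with coefficients \<open>F i j b\<close> equal to
  the components of [m, e_b \<otimes> 1 + 1 \<otimes> e_b]. Vanishing at \<Omega> forces every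
  coefficient to vanish, that is, \<open>m\<close> is invariant.\<close>

lemma invariant_of_casimir:
  assumes "br_12_13 br m \<Omega> + br_12_23 br m \<Omega> = 0"
  shows "br_12_13 br m B + br_12_23 br m B = 0"
proof -
  define F where "F i j b = (\<Sum>a\<in>UNIV. m $ a $ j * sc a b i) + (\<Sum>a\<in>UNIV. m $ i $ a * sc a b j)" for i j b
  have *: "(br_12_13 br m B + br_12_23 br m B) $ i $ j $ k = (\<Sum>b\<in>UNIV. F i j b * B $ b $ k)" for B i j k
    unfolding F_def br_12_13_def br_12_23_def
    by (simp add: sum_distrib_left sum_distrib_right distrib_left distrib_right sum.distrib mult_ac)
       (intro arg_cong2[where f="(+)"] sum.swap)
  have "F i j c = 0" for i j c
    using casimir_contract[of "F i j" c] *[of \<Omega> i j] assms by simp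
  then show ?thesis
    unfolding vec_eq_iff * by simp
qed

text \<open>Stripping \<Omega> shows that every column of \<open>m\<close>, read as an element of
  the Lie algebra, commutes with all basis vectors and so is central.\<close>

lemma br_12_13_casimir_eq_0:
  assumes "br_12_13 br m \<Omega> = 0" shows "m = 0"
proof -
  have "m $ a $ j = 0" for a j
  proof -
    have "(\<Sum>a\<in>UNIV. m $ a $ j * sc a b i) = 0" for b i
    proof -
      have "(\<Sum>b\<in>UNIV. (\<Sum>a\<in>UNIV. m $ a $ j * sc a b i) * \<Omega> $ b $ k) = br_12_13 br m \<Omega> $ i $ j $ k" for k
        unfolding br_12_13_def
        by (simp add: sum_distrib_left sum_distrib_right mult_ac) (rule sum.swap)
      with casimir_contract[of "\<lambda>b. \<Sum>a\<in>UNIV. m $ a $ j * sc a b i" b] assms show ?thesis by simp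
    qed
    moreover have "br (column j m) (axis b 1) = (\<Sum>a\<in>UNIV. m $ a $ j *s br (axis a 1) (axis b 1))" for b
      by (subst basis_expansion[symmetric, of "column j m"]) (simp only: bracket_left, simp add: column_def)
    ultimately have "br (column j m) (axis b 1) = 0" for b
      by (simp add: vec_eq_iff)
    then have "column j m = 0" by (rule center_eq_0)
    then show ?thesis by (simp add: vec_eq_iff column_def)
  qed
  then show ?thesis by (simp add: vec_eq_iff)
qed

end

section \<open>Integrals over circles\<close>

definition circ_int :: "real \<Rightarrow> (complex \<Rightarrow> complex) \<Rightarrow> complex" where
  "circ_int \<rho> f = contour_integral (circlepath 0 \<rho>) f / (2 * of_real pi * \<i>)"

abbreviation circ_pt :: "real \<Rightarrow> real \<Rightarrow> complex" where
  "circ_pt \<rho> t \<equiv> of_real \<rho> * exp (2 * of_real pi * \<i> * of_real t)"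

text \<open>With w = \<rho> exp(2 pi i t) the form dw / (2 pi i) becomes w dt. As an integral over
  the unit interval it is within reach of Fubini and the Leibniz rule.\<close>

lemma circ_int_eq: "circ_int \<rho> f = integral (cbox 0 1) (\<lambda>t. f (circ_pt \<rho> t) * circ_pt \<rho> t)"
proof -
  have "contour_integral (circlepath 0 \<rho>) f
      = integral {0..1} (\<lambda>t. (2 * of_real pi * \<i>) * (f (circ_pt \<rho> t) * circ_pt \<rho> t))"
    unfolding contour_integral_integral vector_derivative_circlepath by (simp add: circlepath mult_ac)
  then show ?thesis
    unfolding integral_mult_right by (simp add: circ_int_def)
qed

lemma norm_circ_pt: "\<rho> \<ge> 0 \<Longrightarrow> norm (circ_pt \<rho> t) = \<rho>"
  by (simp add: norm_mult)

lemma circ_pt_in_sphere: "\<rho> \<ge> 0 \<Longrightarrow> circ_pt \<rho> t \<in> sphere 0 \<rho>"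
  by (simp add: norm_mult)

lemma continuous_on_circ_integrand:
  assumes "\<rho> \<ge> 0" "continuous_on (U \<times> sphere 0 \<rho>) (\<lambda>(x, w). f x w)"
  shows "continuous_on (U \<times> T) (\<lambda>(x, t). f x (circ_pt \<rho> t) * circ_pt \<rho> t)"
proof -
  have "continuous_on (U \<times> T) (\<lambda>p. (\<lambda>(x, w). f x w) (fst p, circ_pt \<rho> (snd p)))"
    by (rule continuous_on_compose2[OF assms(2)])
       (use circ_pt_in_sphere[OF assms(1)] in \<open>auto intro!: continuous_intros\<close>)
  then show ?thesis
    unfolding split_beta by (auto intro!: continuous_intros)
qed

lemma circ_integrand_integrable:
  assumes "\<rho> \<ge> 0" "continuous_on (sphere 0 \<rho>) f"
  shows "(\<lambda>t. f (circ_pt \<rho> t) * circ_pt \<rho> t) integrable_on cbox 0 1"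
proof (rule integrable_continuous)
  have "continuous_on (cbox 0 1) (\<lambda>t. f (circ_pt \<rho> t))"
    by (rule continuous_on_compose2[OF assms(2)])
       (use circ_pt_in_sphere[OF assms(1)] in \<open>auto intro!: continuous_intros\<close>)
  then show "continuous_on (cbox 0 1) (\<lambda>t. f (circ_pt \<rho> t) * circ_pt \<rho> t)"
    by (intro continuous_intros)
qed

lemma circ_int_cong:
  assumes "\<rho> \<ge> 0" "\<And>w. norm w = \<rho> \<Longrightarrow> f w = g w"
  shows "circ_int \<rho> f = circ_int \<rho> g"
  unfolding circ_int_eq using assms norm_circ_pt by (intro integral_cong) metis

lemma circ_int_add:
  assumes "\<rho> \<ge> 0" "continuous_on (sphere 0 \<rho>) f" "continuous_on (sphere 0 \<rho>) g"
  shows "circ_int \<rho> (\<lambda>w. f w + g w) = circ_int \<rho> f + circ_int \<rho> g"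
  unfolding circ_int_eq distrib_right using assms by (intro integral_add circ_integrand_integrable)

lemma circ_int_mult_left: "circ_int \<rho> (\<lambda>w. c * f w) = c * circ_int \<rho> f"
  unfolding circ_int_eq integral_mult_right[symmetric] by (simp add: mult_ac)

lemma circ_int_mult_right: "circ_int \<rho> (\<lambda>w. f w * c) = circ_int \<rho> f * c"
  using circ_int_mult_left[of \<rho> c f] by (simp add: mult.commute)

lemma circ_int_0 [simp]: "circ_int \<rho> (\<lambda>w. 0) = 0"
  by (simp add: circ_int_eq)

lemma circ_int_minus: "circ_int \<rho> (\<lambda>w. - f w) = - circ_int \<rho> f"
  using circ_int_mult_left[of \<rho> "-1" f] by simp

lemma circ_int_sum:
  assumes "\<rho> \<ge> 0" "\<And>i. i \<in> A \<Longrightarrow> continuous_on (sphere 0 \<rho>) (f i)"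
  shows "circ_int \<rho> (\<lambda>w. \<Sum>i\<in>A. f i w) = (\<Sum>i\<in>A. circ_int \<rho> (f i))"
  using assms(2)
proof (induction A rule: infinite_finite_induct)
  case (insert x F)
  then show ?case
    by (simp add: circ_int_add[OF assms(1)] continuous_on_sum)
qed auto

lemma circ_int_swap:
  assumes "\<rho> \<ge> 0" "\<sigma> \<ge> 0" "continuous_on (sphere 0 \<rho> \<times> sphere 0 \<sigma>) (\<lambda>(u, v). f u v)"
  shows "circ_int \<rho> (\<lambda>u. circ_int \<sigma> (f u)) = circ_int \<sigma> (\<lambda>v. circ_int \<rho> (\<lambda>u. f u v))"
proof -
  define F where "F s t = circ_pt \<rho> s * (f (circ_pt \<rho> s) (circ_pt \<sigma> t) * circ_pt \<sigma> t)" for s t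
  have "continuous_on (cbox (0, 0) (1, 1)) (\<lambda>p. (\<lambda>(u, v). f u v) (circ_pt \<rho> (fst p), circ_pt \<sigma> (snd p)))"
    by (rule continuous_on_compose2[OF assms(3)])
       (use circ_pt_in_sphere assms(1,2) in \<open>auto intro!: continuous_intros simp: norm_mult\<close>)
  then have cont: "continuous_on (cbox (0, 0) (1, 1)) (\<lambda>(s, t). F s t)"
    unfolding F_def split_beta by (auto intro!: continuous_intros)
  have "circ_int \<sigma> (f (circ_pt \<rho> s)) * circ_pt \<rho> s = integral (cbox 0 1) (F s)" for s
    unfolding F_def integral_mult_right circ_int_eq[of \<sigma>] by (rule mult.commute)
  moreover have "circ_int \<rho> (\<lambda>u. f u (circ_pt \<sigma> t)) * circ_pt \<sigma> t = integral (cbox 0 1) (\<lambda>s. F s t)" for t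
  proof -
    have "F s t = circ_pt \<sigma> t * (f (circ_pt \<rho> s) (circ_pt \<sigma> t) * circ_pt \<rho> s)" for s
      unfolding F_def by (simp only: mult_ac)
    then show ?thesis
      unfolding circ_int_eq[of \<rho>] by (simp only: integral_mult_right) (rule mult.commute)
  qed
  ultimately have "circ_int \<rho> (\<lambda>u. circ_int \<sigma> (f u)) = integral (cbox 0 1) (\<lambda>s. integral (cbox 0 1) (F s))"
    "circ_int \<sigma> (\<lambda>v. circ_int \<rho> (\<lambda>u. f u v)) = integral (cbox 0 1) (\<lambda>t. integral (cbox 0 1) (\<lambda>s. F s t))"
    by (simp_all only: circ_int_eq[of \<rho> "\<lambda>u. circ_int \<sigma> (f u)"] circ_int_eq[of \<sigma> "\<lambda>v. circ_int \<rho> (\<lambda>u. f u v)"])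
  then show ?thesis
    using integral_swap_continuous[OF cont] by simp
qed

lemma continuous_on_circ_int:
  assumes "\<rho> \<ge> 0" "continuous_on (U \<times> sphere 0 \<rho>) (\<lambda>(x, w). f x w)"
  shows "continuous_on U (\<lambda>x. circ_int \<rho> (f x))"
  unfolding circ_int_eq
  by (rule integral_continuous_on_param) (rule continuous_on_circ_integrand[OF assms])

text \<open>The parameter is Euclidean because \<open>q\<close> has several complex coordinates. The
  Leibniz rule wants a derivative continuous as a bounded linear map; in finite dimension continuity
  in each direction is enough, hence the form of \<open>cont'\<close>.\<close>

lemma circ_int_has_derivative:
  fixes f :: "'a::euclidean_space \<Rightarrow> complex \<Rightarrow> complex"
  assumes "open U" "x0 \<in> U" "\<rho> \<ge> 0"
    and der: "\<And>x w. x \<in> U \<Longrightarrow> norm w = \<rho> \<Longrightarrow> ((\<lambda>x. f x w) has_derivative f' x w) (at x)"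
    and cont: "\<And>x. x \<in> U \<Longrightarrow> continuous_on (sphere 0 \<rho>) (f x)"
    and cont': "\<And>v. continuous_on (U \<times> sphere 0 \<rho>) (\<lambda>(x, w). f' x w v)"
  shows "((\<lambda>x. circ_int \<rho> (f x)) has_derivative (\<lambda>v. circ_int \<rho> (\<lambda>w. f' x0 w v))) (at x0)"
proof -
  obtain e where e: "e > 0" "ball x0 e \<subseteq> U"
    using assms(1,2) open_contains_ball by blast
  define D where "D x t = Blinfun (\<lambda>v. f' x (circ_pt \<rho> t) v * circ_pt \<rho> t)" for x t
  have D: "blinfun_apply (D x t) = (\<lambda>v. f' x (circ_pt \<rho> t) v * circ_pt \<rho> t)" if "x \<in> U" for x t
  proof -
    have "bounded_linear (f' x (circ_pt \<rho> t))"
      using der[OF that norm_circ_pt[OF assms(3)]] by (rule has_derivative_bounded_linear)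
    then show ?thesis
      unfolding D_def by (intro bounded_linear_Blinfun_apply bounded_linear_mult_const)
  qed
  have contD: "continuous_on (ball x0 e \<times> cbox 0 1) (\<lambda>(x, t). D x t)"
  proof (rule continuous_on_blinfun_componentwise)
    fix i :: 'a assume "i \<in> Basis"
    have "continuous_on (ball x0 e \<times> cbox 0 1) (\<lambda>(x, t). f' x (circ_pt \<rho> t) i * circ_pt \<rho> t)"
      by (intro continuous_on_circ_integrand[OF assms(3)] continuous_on_subset[OF cont']) (use e in auto)
    then show "continuous_on (ball x0 e \<times> cbox 0 1) (\<lambda>p. blinfun_apply (case p of (x, t) \<Rightarrow> D x t) i)"
      by (rule continuous_on_cong[THEN iffD1, rotated -1]) (use e in \<open>auto simp: D\<close>)
  qed
  have "((\<lambda>x. circ_int \<rho> (f x)) has_derivative integral (cbox 0 1) (D x0)) (at x0 within ball x0 e)"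
    unfolding circ_int_eq
  proof (rule leibniz_rule[OF _ _ contD])
    fix x t assume "x \<in> ball x0 e"
    then have x: "x \<in> U" using e by blast
    show "((\<lambda>x. f x (circ_pt \<rho> t) * circ_pt \<rho> t) has_derivative blinfun_apply (D x t)) (at x within ball x0 e)"
      unfolding D[OF x]
      by (rule has_derivative_mult_left, rule has_derivative_at_withinI, rule der[OF x norm_circ_pt[OF assms(3)]])
  next
    fix x assume "x \<in> ball x0 e"
    then show "(\<lambda>t. f x (circ_pt \<rho> t) * circ_pt \<rho> t) integrable_on cbox 0 1"
      using e by (intro circ_integrand_integrable[OF assms(3)] cont) auto
  qed (use e in auto)
  moreover have "blinfun_apply (integral (cbox 0 1) (D x0)) v = circ_int \<rho> (\<lambda>w. f' x0 w v)" for v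
  proof -
    have "continuous_on (cbox 0 1) (D x0)"
      using continuous_on_compose2[OF contD, of "cbox 0 1" "\<lambda>t. (x0, t)"] e(1)
      by (force intro!: continuous_intros)
    then have "D x0 integrable_on cbox 0 1" by (rule integrable_continuous)
    from integral_linear[OF this blinfun.bounded_linear_left[of v]]
    show ?thesis by (simp add: o_def circ_int_eq D[OF assms(2)])
  qed
  ultimately show ?thesis
    using e(1) at_within_open[of x0 "ball x0 e"] by (metis (no_types, lifting) centre_in_ball ext open_ball)
qed

lemma circ_int_has_field_derivative:
  assumes "open U" "z0 \<in> U" "\<rho> \<ge> 0"
    and der: "\<And>z w. z \<in> U \<Longrightarrow> norm w = \<rho> \<Longrightarrow> ((\<lambda>z. f z w) has_field_derivative f' z w) (at z)"
    and cont: "\<And>z. z \<in> U \<Longrightarrow> continuous_on (sphere 0 \<rho>) (f z)"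
    and cont': "continuous_on (U \<times> sphere 0 \<rho>) (\<lambda>(z, w). f' z w)"
  shows "((\<lambda>z. circ_int \<rho> (f z)) has_field_derivative circ_int \<rho> (f' z0)) (at z0)"
proof -
  have "((\<lambda>z. circ_int \<rho> (f z)) has_derivative (\<lambda>v. circ_int \<rho> (\<lambda>w. f' z0 w * v))) (at z0)"
  proof (rule circ_int_has_derivative[OF assms(1-3)])
    show "continuous_on (U \<times> sphere 0 \<rho>) (\<lambda>(x, w). f' x w * v)" for v
      using cont' unfolding split_beta by (intro continuous_intros)
  qed (use der cont in \<open>auto simp: has_field_derivative_def\<close>)
  then show ?thesis by (simp add: has_field_derivative_def circ_int_mult_right)
qed

lemma circ_int_residue:
  assumes "f holomorphic_on ball 0 R - {0}" "0 < \<rho>" "\<rho> < R"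
  shows "circ_int \<rho> f = residue f 0"
proof -
  have "(f has_contour_integral 2 * pi * \<i> * residue f 0) (circlepath 0 \<rho>)"
    by (rule base_residue[of "ball 0 R"]) (use assms in auto)
  then show ?thesis by (simp add: circ_int_def contour_integral_unique)
qed

lemma circ_int_residues:
  assumes "f holomorphic_on ball 0 R - P" "finite P" "P \<subseteq> ball 0 \<rho>" "0 < \<rho>" "\<rho> < R"
  shows "circ_int \<rho> f = (\<Sum>p\<in>P. residue f p)"
proof -
  have "contour_integral (circlepath 0 \<rho>) f
      = 2 * pi * \<i> * (\<Sum>p\<in>P. winding_number (circlepath 0 \<rho>) p * residue f p)"
  proof (rule Residue_theorem[of "ball 0 R"])
    show "path_image (circlepath 0 \<rho>) \<subseteq> ball 0 R - P"
      using assms(3-5) by (auto simp: path_image_circlepath_nonneg)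
    show "\<forall>z. z \<notin> ball 0 R \<longrightarrow> winding_number (circlepath 0 \<rho>) z = 0"
      using assms(4,5) by (auto intro!: winding_number_zero_outside[of _ "cball 0 \<rho>"])
  qed (use assms in auto)
  also have "(\<Sum>p\<in>P. winding_number (circlepath 0 \<rho>) p * residue f p) = (\<Sum>p\<in>P. residue f p)"
    using assms(3) by (intro sum.cong refl) (auto simp: winding_number_circlepath)
  finally show ?thesis by (simp add: circ_int_def)
qed

lemma circ_int_holomorphic:
  assumes "f holomorphic_on ball 0 R" "0 < \<rho>" "\<rho> < R"
  shows "circ_int \<rho> f = 0"
  using circ_int_residues[of f R "{}" \<rho>] assms by simp

text \<open>The bound |u| < \<sigma> puts the translated pole -u inside the circle, and |u| +
  \<sigma> < R keeps u + v inside the original domain.\<close>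

lemma circ_int_shift:
  assumes "f holomorphic_on ball 0 R - {0}" "norm u < \<sigma>" "norm u + \<sigma> < R"
  shows "circ_int \<sigma> (\<lambda>v. f (u + v)) = residue f 0"
proof -
  have "0 < \<sigma>" using assms(2) norm_ge_zero[of u] by linarith
  have "circ_int \<sigma> (\<lambda>v. f (u + v)) = residue (\<lambda>v. f (u + v)) (- u)"
  proof (subst circ_int_residues[of _ "R - norm u" "{- u}"])
    have "u + v \<in> ball 0 R - {0}" if "v \<in> ball 0 (R - norm u) - {- u}" for v
      using that norm_triangle_ineq[of u v] by (auto simp: add_eq_0_iff)
    then show "(\<lambda>v. f (u + v)) holomorphic_on ball 0 (R - norm u) - {- u}"
      by (intro holomorphic_on_compose_gen[OF _ assms(1), of "\<lambda>v. u + v", unfolded o_def] holomorphic_intros) auto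
  qed (use assms \<open>0 < \<sigma>\<close> in auto)
  also have "\<dots> = residue f 0"
    by (subst residue_shift_0) simp
  finally show ?thesis .
qed

text \<open>On a circle \<open>|w| < |z|\<close> the kernel \<open>1 / (w - z)\<close> expands as \<open>- (\<Sum>n. w\<^sup>n / z\<^sup>n\<^sup>+\<^sup>1)\<close>, so
  the vanishing moments leave only the residue there.\<close>

lemma simple_pole_representation:
  assumes holo: "f holomorphic_on ball 0 R - {0}"
    and mom: "\<And>p. p \<ge> 1 \<Longrightarrow> residue (\<lambda>w. w ^ p * f w) 0 = 0"
    and z: "0 < norm z" "norm z < \<rho>" "\<rho> < R"
  shows "f z = residue f 0 / z + circ_int \<rho> (\<lambda>w. f w / (w - z))"
proof -
  define \<epsilon> where "\<epsilon> = norm z / 2"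
  have "0 < \<rho>" using z by linarith
  have \<epsilon>: "0 < \<epsilon>" "\<epsilon> < norm z" using z by (auto simp: \<epsilon>_def)
  have [simp]: "w \<noteq> z" if "norm w = \<epsilon>" for w using that \<epsilon> by auto
  have cont: "continuous_on (sphere 0 \<epsilon>) f"
    by (rule continuous_on_subset[OF holomorphic_on_imp_continuous_on[OF holo]]) (use \<epsilon> z in auto)
  have cM: "continuous_on (sphere 0 \<epsilon>) (\<lambda>w. w ^ M * f w / (w - z))" for M
    by (intro continuous_intros cont) auto
  have cont': "continuous_on (sphere 0 \<epsilon>) (\<lambda>w. w ^ M * f w)" for M
    by (intro continuous_intros cont)
  define J where "J N = circ_int \<epsilon> (\<lambda>w. w ^ N * f w / (w - z))" for N
  have res: "circ_int \<epsilon> (\<lambda>w. w ^ N * f w) = (if N = 0 then residue f 0 else 0)" for N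
    by (subst circ_int_residue[of _ R]) (use \<epsilon> z mom in \<open>auto intro!: holomorphic_intros holo\<close>)
  \<comment> \<open>Pointwise, w^N / (w - z) = (w^(N+1) / (w - z) - w^N) / z; the integral of the
    last term is a moment of \<open>f\<close>, which survives only for N = 0.\<close>
  have J: "J N = (J (Suc N) - (if N = 0 then residue f 0 else 0)) / z" for N
  proof -
    have "J N = circ_int \<epsilon> (\<lambda>w. (1 / z) * (w ^ Suc N * f w / (w - z) + (- 1) * (w ^ N * f w)))"
      unfolding J_def using \<epsilon> z
      by (intro circ_int_cong) (auto simp: divide_simps right_diff_distrib left_diff_distrib)
    also have "\<dots> = (1 / z) * circ_int \<epsilon> (\<lambda>w. w ^ Suc N * f w / (w - z) + (- 1) * (w ^ N * f w))"
      by (rule circ_int_mult_left)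
    also have "circ_int \<epsilon> (\<lambda>w. w ^ Suc N * f w / (w - z) + (- 1) * (w ^ N * f w))
        = J (Suc N) + circ_int \<epsilon> (\<lambda>w. (- 1) * (w ^ N * f w))"
      unfolding J_def 
      by (rule circ_int_add[OF less_imp_le[OF \<epsilon>(1)] cM continuous_on_mult_left[OF cont']])
    also have "circ_int \<epsilon> (\<lambda>w. (- 1) * (w ^ N * f w)) = (- 1) * circ_int \<epsilon> (\<lambda>w. w ^ N * f w)"
      by (rule circ_int_mult_left)
    finally show ?thesis by (simp add: res)
  qed
  have J1: "J 1 = J (Suc N) / z ^ N" for N
  proof (induction N)
    case (Suc N)
    then show ?case using J[of "Suc N"] z by simp
  qed simp
  \<comment> \<open>On the small circle \<open>J (Suc N)\<close> is of order \<epsilon>^N with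
    \<epsilon> < |z|, so the quotient tends to 0. Being constantly \<open>J 1\<close>, it is
    0.\<close>
  have "(\<lambda>N. J (Suc N) / z ^ N) \<longlonglongrightarrow> 0"
  proof -
    obtain C where C: "\<And>w. w \<in> sphere 0 \<epsilon> \<Longrightarrow> norm (f w / (w - z)) \<le> C"
    proof -
      have "compact ((\<lambda>w. f w / (w - z)) ` sphere 0 \<epsilon>)"
        by (intro compact_continuous_image continuous_intros cont) auto
      then show ?thesis using that by (fastforce dest!: compact_imp_bounded simp: bounded_iff)
    qed
    have "norm (J N) \<le> C * \<epsilon> * \<epsilon> ^ N" for N
    proof -
      have "norm (J N) \<le> (C * \<epsilon> * \<epsilon> ^ N) * measure lborel (cbox 0 (1::real))"
        unfolding J_def circ_int_eq
      proof (rule integrable_bound[of "C * \<epsilon> * \<epsilon> ^ N"])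
        have "0 \<le> C" using C[of "of_real \<epsilon>"] \<epsilon> by (smt (verit, best) norm_ge_zero dist_0_norm mem_sphere norm_of_real)
        then show "0 \<le> C * \<epsilon> * \<epsilon> ^ N" using \<epsilon> by simp
        show "(\<lambda>t. circ_pt \<epsilon> t ^ N * f (circ_pt \<epsilon> t) / (circ_pt \<epsilon> t - z) * circ_pt \<epsilon> t) integrable_on cbox 0 1"
          by (rule circ_integrand_integrable) (use \<epsilon> in \<open>auto intro!: continuous_intros cont\<close>)
        fix t :: real
        have n: "norm (circ_pt \<epsilon> t) = \<epsilon>" using \<epsilon> by (simp add: norm_mult)
        have "norm (f (circ_pt \<epsilon> t) / (circ_pt \<epsilon> t - z)) * \<epsilon> ^ N * \<epsilon> \<le> C * \<epsilon> ^ N * \<epsilon>"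
          using \<epsilon> by (intro mult_right_mono C) (auto simp: norm_mult)
        then show "norm (circ_pt \<epsilon> t ^ N * f (circ_pt \<epsilon> t) / (circ_pt \<epsilon> t - z) * circ_pt \<epsilon> t) \<le> C * \<epsilon> * \<epsilon> ^ N"
          using n by (simp only: norm_mult norm_divide norm_power) (simp add: mult_ac)
      qed
      then show ?thesis by simp
    qed
    from divide_right_mono[OF this[of "Suc _"]]
    have b: "norm (J (Suc N) / z ^ N) \<le> C * \<epsilon> * \<epsilon> * (\<epsilon> / norm z) ^ N" for N
      by (simp add: norm_divide norm_power power_divide mult_ac)
    have "(\<lambda>N. C * \<epsilon> * \<epsilon> * (\<epsilon> / norm z) ^ N) \<longlonglongrightarrow> C * \<epsilon> * \<epsilon> * 0"
      by (intro tendsto_mult tendsto_const LIMSEQ_realpow_zero) (use \<epsilon> z in auto)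
    then have "(\<lambda>N. C * \<epsilon> * \<epsilon> * (\<epsilon> / norm z) ^ N) \<longlonglongrightarrow> 0" by simp
    then show ?thesis
      by (rule Lim_null_comparison[OF always_eventually[OF allI[OF b]]])
  qed
  then have "(\<lambda>N::nat. J 1) \<longlonglongrightarrow> 0" by (simp only: J1[symmetric])
  then have "J 1 = 0" by (simp add: LIMSEQ_const_iff)
  then have J0: "J 0 = - residue f 0 / z" using J[of 0] by simp
  \<comment> \<open>The outer circle encloses both singularities of \<open>g\<close>: the point z
    contributes f z, and 0 contributes J 0, which is minus the residue of \<open>f\<close> divided
    by z.\<close>
  define g where "g = (\<lambda>w. f w / (w - z))"
  have gh: "g holomorphic_on ball 0 R - {0, z}"
    unfolding g_def by (intro holomorphic_intros holomorphic_on_subset[OF holo]) auto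
  have "circ_int \<rho> g = (\<Sum>p\<in>{0, z}. residue g p)"
    by (rule circ_int_residues[OF gh]) (use z \<open>0 < \<rho>\<close> in auto)
  moreover have "residue g z = f z"
    unfolding g_def by (rule residue_simple[of "ball 0 R - {0}"]) (use z holo in auto)
  moreover have "residue g 0 = J 0"
  proof -
    have "circ_int \<epsilon> g = residue g 0"
      by (rule circ_int_residue[of _ "norm z"]) (use \<epsilon> z in \<open>auto intro!: holomorphic_on_subset[OF gh]\<close>)
    then show ?thesis by (simp add: J_def g_def)
  qed
  ultimately show ?thesis using z J0 by (auto simp: g_def)
qed

section \<open>Derivatives in the dynamical parameter\<close>

lemma Cauchy_derivative_circ_int:
  assumes "continuous_on (cball 0 \<tau>) f" "f holomorphic_on ball 0 \<tau>" "0 < \<tau>"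
  shows "(f has_field_derivative circ_int \<tau> (\<lambda>u. f u / u ^ 2)) (at 0)"
  using Cauchy_derivative_integral_circlepath(2)[OF assms(1,2), of 0] assms(3)
  by (simp add: circ_int_def)

text \<open>Osgood: by Cauchy's formula along the direction \<open>v\<close>, a derivative is an integral of the function
  itself, so continuity of the function gives continuity of the derivative.\<close>

lemma directional_derivative_continuous:
  fixes f :: "(complex^'l::finite) \<times> complex \<Rightarrow> complex"
  assumes "open S"
    and der: "\<And>p. p \<in> S \<Longrightarrow> (f has_derivative D p) (at p)"
    and lin: "\<And>p c a b. p \<in> S \<Longrightarrow> D p (c *s a, c * b) = c * D p (a, b)"
  shows "continuous_on S (\<lambda>p. D p (a, b))"
proof -
  define A where "A t = (t *s a, t * b)" for t :: complex
  have A: "bounded_linear A"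
    unfolding A_def by (intro linear_conv_bounded_linear[THEN iffD1] linearI)
       (simp_all add: vec_eq_iff algebra_simps)
  have "continuous (at p0) (\<lambda>p. D p (a, b))" if "p0 \<in> S" for p0
  proof -
    obtain e where e: "e > 0" "ball p0 e \<subseteq> S"
      using openE[OF assms(1) \<open>p0 \<in> S\<close>] by metis
    have "A 0 = 0" by (simp add: A_def zero_prod_def)
    have "isCont A 0" using bounded_linear.isCont[OF A, of 0 "\<lambda>x. x"] by simp
    then obtain d where d: "d > 0" "\<And>t. norm t < d \<Longrightarrow> norm (A t) < e / 2"
      using e(1) \<open>A 0 = 0\<close> unfolding continuous_at_eps_delta
      by (auto simp: dist_norm dest!: spec[of _ "e / 2"])
    define \<tau> where "\<tau> = d / 2"
    have \<tau>: "0 < \<tau>" "\<tau> < d" using d by (auto simp: \<tau>_def)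
    have mem: "p + A t \<in> S" if "p \<in> ball p0 (e / 2)" "norm t \<le> \<tau>" for p t
    proof -
      have "dist p0 (p + A t) \<le> dist p0 p + norm (A t)"
        using norm_triangle_ineq4[of "p0 - p" "A t"] by (simp add: dist_norm algebra_simps)
      then show ?thesis using that d(2)[of t] \<tau> e(2) by (intro subsetD[OF e(2)]) auto
    qed
    have eq: "D p (a, b) = circ_int \<tau> (\<lambda>u. f (p + A u) / u ^ 2)" if p: "p \<in> ball p0 (e / 2)" for p
    proof -
      have fd: "((\<lambda>t. f (p + A t)) has_field_derivative D (p + A t) (a, b)) (at t)" if "norm t \<le> \<tau>" for t
      proof -
        have "((\<lambda>t. p + A t) has_derivative A) (at t)"
          by (auto intro!: derivative_eq_intros bounded_linear_imp_has_derivative[OF A])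
        from has_derivative_compose[OF this der[OF mem[OF p that]]]
        have "((\<lambda>t. f (p + A t)) has_derivative (\<lambda>s. s * D (p + A t) (a, b))) (at t)"
          by (simp add: A_def[of "_ :: complex"] lin[OF mem[OF p that], unfolded A_def])
        moreover have "(\<lambda>s. s * D (p + A t) (a, b)) = (*) (D (p + A t) (a, b))"
          by (simp add: fun_eq_iff mult.commute)
        ultimately show ?thesis by (simp add: has_field_derivative_def)
      qed
      have "((\<lambda>t. f (p + A t)) has_field_derivative circ_int \<tau> (\<lambda>u. f (p + A u) / u ^ 2)) (at 0)"
      proof (rule Cauchy_derivative_circ_int[OF _ _ \<tau>(1)])
        show "continuous_on (cball 0 \<tau>) (\<lambda>t. f (p + A t))"
          by (rule continuous_at_imp_continuous_on) (use DERIV_isCont[OF fd] in auto)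
        show "(\<lambda>t. f (p + A t)) holomorphic_on ball 0 \<tau>"
          unfolding holomorphic_on_open[OF open_ball] using fd by (metis less_imp_le mem_ball_0)
      qed
      with fd[of 0] \<tau>(1) \<open>A 0 = 0\<close> show ?thesis by (auto dest: DERIV_unique)
    qed
    have "continuous_on (ball p0 (e / 2)) (\<lambda>p. circ_int \<tau> (\<lambda>u. f (p + A u) / u ^ 2))"
    proof (rule continuous_on_circ_int)
      have "continuous_on S f"
        by (rule continuous_at_imp_continuous_on) (use has_derivative_continuous[OF der] in auto)
      then have "continuous_on (ball p0 (e / 2) \<times> sphere 0 \<tau>) (\<lambda>x. f (fst x + A (snd x)))"
        by (rule continuous_on_compose2)
           (use mem in \<open>auto intro!: continuous_intros bounded_linear.continuous_on[OF A]\<close>)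
      then show "continuous_on (ball p0 (e / 2) \<times> sphere 0 \<tau>) (\<lambda>(p, u). f (p + A u) / u ^ 2)"
        unfolding split_beta using \<tau> by (auto intro!: continuous_intros)
    qed (use \<tau> in auto)
    then have "continuous_on (ball p0 (e / 2)) (\<lambda>p. D p (a, b))"
      by (rule continuous_on_cong[THEN iffD1, rotated -1]) (auto simp: eq)
    then show ?thesis
      using e(1) by (simp add: continuous_on_eq_continuous_at)
  qed
  then show ?thesis by (intro continuous_at_imp_continuous_on ballI)
qed

text \<open>Real differentiability plus complex homogeneity of the differential gives complex
  derivatives along lines, so the coordinatewise \<open>partial_q\<close> assemble to the whole
  differential.\<close>

lemma complex_linear_derivative:
  fixes f :: "complex^'l::finite \<Rightarrow> complex"
  assumes der: "(f has_derivative D) (at q)" and lin: "\<And>c a. D (c *s a) = c * D a"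
  shows has_field_derivative_along: "((\<lambda>t. f (q + t *s a)) has_field_derivative D a) (at 0)"
    and partial_q_eq: "partial_q k f q = D (axis k 1)"
    and derivative_eq_partials: "D a = (\<Sum>k\<in>UNIV. a $ k * partial_q k f q)"
proof -
  show *: "((\<lambda>t. f (q + t *s a)) has_field_derivative D a) (at 0)" for a
  proof -
    have "bounded_linear (\<lambda>t. t *s a)"
      by (intro linear_conv_bounded_linear[THEN iffD1] linearI) (simp_all add: vec_eq_iff algebra_simps)
    then have "((\<lambda>t. q + t *s a) has_derivative (\<lambda>t. t *s a)) (at 0)"
      by (auto intro!: derivative_eq_intros bounded_linear_imp_has_derivative)
    from has_derivative_compose[OF this, of f D] der
    have "((\<lambda>t. f (q + t *s a)) has_derivative (\<lambda>t. t * D a)) (at 0)"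
      by (simp add: lin)
    moreover have "(\<lambda>t. t * D a) = (*) (D a)"
      by (simp add: fun_eq_iff mult.commute)
    ultimately show ?thesis unfolding has_field_derivative_def by simp
  qed
  show p: "partial_q k f q = D (axis k 1)" for k
  proof -
    have "(\<lambda>t. f (q + axis k t)) = (\<lambda>t. f (q + t *s axis k 1))"
      by (intro ext arg_cong[where f=f]) (simp add: vec_eq_iff axis_def)
    then show ?thesis
      unfolding partial_q_def using DERIV_imp_deriv[OF *[of "axis k 1"]] by simp
  qed
  have "D a = D (\<Sum>k\<in>UNIV. a $ k *s axis k 1)"
    by (simp only: basis_expansion)
  also have "\<dots> = (\<Sum>k\<in>UNIV. D (a $ k *s axis k 1))"
    by (rule linear_sum[OF has_derivative_linear[OF der]])
  finally show "D a = (\<Sum>k\<in>UNIV. a $ k * partial_q k f q)"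
    by (simp add: lin p)
qed

text \<open>Taken from the joint differential in (q, z) because the circle integrals need continuity
  in both variables together.\<close>

definition q_deriv ::
    "(complex^'l::finite \<Rightarrow> complex \<Rightarrow> complex^'n^'n) \<Rightarrow> complex^'l \<Rightarrow> 'n \<Rightarrow> 'n \<Rightarrow> complex^'l \<Rightarrow> complex \<Rightarrow> complex"
  where "q_deriv r a i j q z = frechet_derivative (\<lambda>(q, z). r q z $ i $ j) (at (q, z)) (a, 0)"

lemma regular_at_derivative:
  fixes r :: "complex^'l::finite \<Rightarrow> complex \<Rightarrow> complex^'n^'n"
  assumes "regular_at r q z"
  defines "f \<equiv> \<lambda>i j (q, z). r q z $ i $ j"
  shows "(f i j has_derivative frechet_derivative (f i j) (at (q, z))) (at (q, z))"
    and "frechet_derivative (f i j) (at (q, z)) (c *s a, c * b) = c * frechet_derivative (f i j) (at (q, z)) (a, b)"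
proof -
  obtain D where D: "(f i j has_derivative D) (at (q, z))" "\<And>c v w. D (c *s v, c * w) = c * D (v, w)"
    using assms unfolding regular_at_def holomorphic_on2_def by (metis (no_types, lifting))
  moreover have "frechet_derivative (f i j) (at (q, z)) = D"
    using frechet_derivative_at[OF D(1)] by simp
  ultimately show "(f i j has_derivative frechet_derivative (f i j) (at (q, z))) (at (q, z))"
    "frechet_derivative (f i j) (at (q, z)) (c *s a, c * b) = c * frechet_derivative (f i j) (at (q, z)) (a, b)"
    by simp_all
qed

lemma open_regular_at:
  fixes r :: "complex^'l::finite \<Rightarrow> complex \<Rightarrow> complex^'n^'n"
  shows "open {(q, z). regular_at r q z}"
  unfolding open_subopen[of "{(q, z). regular_at r q z}"]
proof (clarify)
  fix q z assume "regular_at r q z"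
  then obtain U where U: "(q, z) \<in> U" "\<And>i j. holomorphic_on2 (\<lambda>(q, z). r q z $ i $ j) U"
    unfolding regular_at_def by blast
  then have "open U" unfolding holomorphic_on2_def by blast
  moreover have "U \<subseteq> {(q, z). regular_at r q z}"
    using U(2) unfolding regular_at_def by blast
  ultimately show "\<exists>T. open T \<and> (q, z) \<in> T \<and> T \<subseteq> {(q, z). regular_at r q z}"
    using U(1) by blast
qed

lemma continuous_on_regular:
  fixes r :: "complex^'l::finite \<Rightarrow> complex \<Rightarrow> complex^'n^'n"
  shows "continuous_on {(q, z). regular_at r q z} (\<lambda>(q, z). r q z $ i $ j)"
    and "continuous_on {(q, z). regular_at r q z} (\<lambda>(q, z). q_deriv r a i j q z)"
proof -
  show "continuous_on {(q, z). regular_at r q z} (\<lambda>(q, z). r q z $ i $ j)"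
    by (rule continuous_at_imp_continuous_on)
       (auto intro: has_derivative_continuous[OF regular_at_derivative(1)])
  have "continuous_on {(q, z). regular_at r q z}
     (\<lambda>p. frechet_derivative (\<lambda>(q, z). r q z $ i $ j) (at p) (a, 0))"
    by (rule directional_derivative_continuous[OF open_regular_at[of r], where f = "\<lambda>(q, z). r q z $ i $ j"])
       (auto intro: regular_at_derivative)
  then show "continuous_on {(q, z). regular_at r q z} (\<lambda>(q, z). q_deriv r a i j q z)"
    by (simp add: q_deriv_def split_beta)
qed

lemma
  fixes r :: "complex^'l::finite \<Rightarrow> complex \<Rightarrow> complex^'n^'n"
  assumes reg: "regular_at r q z"
  shows q_deriv_scale: "q_deriv r (c *s a) i j q z = c * q_deriv r a i j q z"
    and has_derivative_q_deriv: "((\<lambda>q. r q z $ i $ j) has_derivative (\<lambda>a. q_deriv r a i j q z)) (at q)"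
    and regular_at_field_differentiable: "(\<lambda>z. r q z $ i $ j) field_differentiable (at z)"
    and partial_q_eq_q_deriv: "partial_q k (\<lambda>q. r q z $ i $ j) q = q_deriv r (axis k 1) i j q z"
proof -
  define G where "G = frechet_derivative (\<lambda>(q, z). r q z $ i $ j) (at (q, z))"
  have D: "((\<lambda>(q, z). r q z $ i $ j) has_derivative G) (at (q, z))"
    "G (c *s a, c * b) = c * G (a, b)" for c a b
    unfolding G_def by (rule regular_at_derivative[OF reg])+
  have q_deriv: "q_deriv r a i j q z = G (a, 0)" for a
    by (simp add: q_deriv_def G_def)
  show lin: "q_deriv r (c *s a) i j q z = c * q_deriv r a i j q z" for c a
    unfolding q_deriv using D(2)[of c a 0] by simp
  have "((\<lambda>q. (q, z)) has_derivative (\<lambda>a. (a, 0))) (at q)"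
    by (auto intro!: derivative_eq_intros)
  from has_derivative_compose[OF this D(1)]
  show der: "((\<lambda>q. r q z $ i $ j) has_derivative (\<lambda>a. q_deriv r a i j q z)) (at q)"
    by (simp add: q_deriv)
  show "partial_q k (\<lambda>q. r q z $ i $ j) q = q_deriv r (axis k 1) i j q z"
    by (rule partial_q_eq[OF der lin])
  have "((\<lambda>z. (q, z)) has_derivative (\<lambda>b. (0, b))) (at z)"
    by (auto intro!: derivative_eq_intros)
  from has_derivative_compose[OF this D(1)]
  have "((\<lambda>z. r q z $ i $ j) has_derivative (\<lambda>b. G (0, b))) (at z)"
    by simp
  moreover have "G (0, b) = G (0, 1) * b" for b
    using D(2)[of b 0 1] unfolding vec.scale_zero_right mult_1_right by (simp only: mult.commute)
  then have "(\<lambda>b. G (0, b)) = (*) (G (0, 1))" by (rule ext)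
  ultimately have "((\<lambda>z. r q z $ i $ j) has_field_derivative G (0, 1)) (at z)"
    unfolding has_field_derivative_def by simp
  then show "(\<lambda>z. r q z $ i $ j) field_differentiable (at z)"
    unfolding field_differentiable_def by blast
qed

section \<open>Principal values\<close>

text \<open>The integrand is i/2 + cot((t - A) / 2) / 2, with a linear plus log-sine primitive. The
  log-sine takes equal values at the ends of an arc symmetric about A; this is how the divergence
  cancels.\<close>

lemma has_integral_cauchy_kernel_arc:
  assumes "0 < \<epsilon>" "\<epsilon> < pi"
  shows "((\<lambda>t. \<i> * cis t / (cis t - cis A)) has_integral \<i> * of_real (pi - \<epsilon>)) {A + \<epsilon>..A + 2 * pi - \<epsilon>}"
proof -
  define \<Phi> where "\<Phi> t = \<i> / 2 * of_real (t - A) + of_real (ln (sin ((t - A) / 2)))" for t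
  have "((\<lambda>t. \<i> * cis t / (cis t - cis A)) has_integral \<Phi> (A + 2 * pi - \<epsilon>) - \<Phi> (A + \<epsilon>))
      {A + \<epsilon>..A + 2 * pi - \<epsilon>}"
  proof (rule fundamental_theorem_of_calculus)
    fix t assume t: "t \<in> {A + \<epsilon>..A + 2 * pi - \<epsilon>}"
    define s where "s = (t - A) / 2"
    have "0 < s" "s < pi" using t assms by (auto simp: s_def field_simps)
    then have pos: "sin s > 0" by (rule sin_gt_zero)
    have "((\<lambda>t. ln (sin ((t - A) / 2))) has_real_derivative cos s / 2 / sin s) (at t)"
      using pos unfolding s_def by (auto intro!: derivative_eq_intros simp: field_simps)
    from has_vector_derivative_of_real[OF this]
    have "(\<Phi> has_vector_derivative (\<i> / 2 + of_real (cos s / 2 / sin s))) (at t)"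
      unfolding \<Phi>_def by (rule has_vector_derivative_add[rotated]) (auto intro!: derivative_eq_intros)
    moreover have "\<i> / 2 + of_real (cos s / 2 / sin s) = \<i> * cis t / (cis t - cis A)"
    proof -
      have cis_eq: "cis s = of_real (cos s) + \<i> * of_real (sin s)"
        by (simp add: complex_eq_iff)
      have t: "cis t = cis A * cis s * cis s"
        by (simp add: cis_mult s_def)
      have "cis t - cis A = cis A * cis s * (cis s - cis (- s))"
        by (simp add: t cis_mult right_diff_distrib)
      also have "cis s - cis (- s) = 2 * \<i> * of_real (sin s)"
        by (simp add: complex_eq_iff)
      finally have "\<i> * cis t / (cis t - cis A)
          = (cis A * cis s * \<i>) * cis s / ((cis A * cis s * \<i>) * (2 * of_real (sin s)))"
        by (simp add: t mult_ac)
      also have "\<dots> = cis s / (2 * of_real (sin s))"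
        by (rule mult_divide_mult_cancel_left) (simp add: cis_neq_zero)
      also have "\<dots> = \<i> / 2 + of_real (cos s / 2 / sin s)"
        using pos by (simp add: cis_eq add_divide_distrib)
      finally show ?thesis by simp
    qed
    ultimately show "(\<Phi> has_vector_derivative \<i> * cis t / (cis t - cis A)) (at t within {A + \<epsilon>..A + 2 * pi - \<epsilon>})"
      by (simp add: has_vector_derivative_at_within)
  qed (use assms in auto)
  moreover have "\<Phi> (A + 2 * pi - \<epsilon>) - \<Phi> (A + \<epsilon>) = \<i> * of_real (pi - \<epsilon>)"
  proof -
    have "sin ((A + 2 * pi - \<epsilon> - A) / 2) = sin (pi - \<epsilon> / 2)" by (simp add: field_simps)
    also have "\<dots> = sin (\<epsilon> / 2)" by simp
    finally show ?thesis by (simp add: \<Phi>_def field_simps)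
  qed
  ultimately show ?thesis by simp
qed

lemma tendsto_arc_integral:
  fixes f :: "real \<Rightarrow> complex"
  assumes "continuous_on UNIV f" "a < b"
  shows "((\<lambda>\<epsilon>. integral {a + \<epsilon>..b - \<epsilon>} f) \<longlongrightarrow> integral {a..b} f) (at_right 0)"
proof -
  have int: "f integrable_on {x..y}" for x y
    by (intro integrable_continuous_real continuous_on_subset[OF assms(1)]) auto
  define H where "H x = integral {a - 1..x} f" for x
  have H: "integral {x..y} f = H y - H x" if "a - 1 \<le> x" "x \<le> y" for x y
    using Henstock_Kurzweil_Integration.integral_combine[OF that int] by (simp add: H_def algebra_simps)
  have "continuous_on {a - 1..b + 1} H"
    unfolding H_def by (rule indefinite_integral_continuous_1[OF int])
  then have "isCont H a" "isCont H b"
    using assms(2) by (auto intro!: continuous_on_interior[of "{a - 1..b + 1}"] simp: interior_atLeastAtMost_real)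
  then have "((\<lambda>\<epsilon>. H (b - \<epsilon>) - H (a + \<epsilon>)) \<longlongrightarrow> H b - H a) (at_right 0)"
    by (intro tendsto_diff isCont_tendsto_compose[of _ H]) (auto intro!: tendsto_eq_intros)
  moreover have "\<forall>\<^sub>F \<epsilon> in at_right 0. H (b - \<epsilon>) - H (a + \<epsilon>) = integral {a + \<epsilon>..b - \<epsilon>} f"
    using eventually_at_right_less[of 0]  eventually_at_right_real[of 0 "(b - a) / 2"] assms(2)
    by (auto elim!: eventually_elim2 simp: H)
  ultimately show ?thesis
    using H[of a b] assms(2) by (auto elim!: Lim_transform_eventually)
qed

text \<open>The residue theorem for a full turn started at an arbitrary angle, since the arcs of the
  principal value are based at \<open>Arg z\<close>.\<close>

lemma circ_int_part_circlepath:
  assumes "f holomorphic_on ball 0 R - {0}" "0 < \<rho>" "\<rho> < R"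
  shows "integral {A..A + 2 * pi} (\<lambda>t. f (of_real \<rho> * cis t) * of_real \<rho> * \<i> * cis t) = 2 * of_real pi * \<i> * residue f 0"
proof -
  let ?\<gamma> = "part_circlepath 0 \<rho> A (A + 2 * pi)"
  have image: "path_image ?\<gamma> \<subseteq> sphere 0 \<rho>"
    using path_image_part_circlepath_subset'[of \<rho> 0 A "A + 2 * pi"] assms(2) by simp
  have zero_notin: "0 \<notin> path_image ?\<gamma>"
    using image assms(2) by auto
  have loop: "pathfinish ?\<gamma> = pathstart ?\<gamma>"
    by (simp add: ring_distribs exp_add mult.commute[of \<i>] exp_two_pi_i[unfolded mult.assoc])
  have int: "contour_integral ?\<gamma> g = integral {A..A + 2 * pi} (\<lambda>t. g (of_real \<rho> * cis t) * of_real \<rho> * \<i> * cis t)"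
    if "continuous_on (sphere 0 \<rho>) g" for g :: "complex \<Rightarrow> complex"
  proof -
    have "(g has_contour_integral contour_integral ?\<gamma> g) ?\<gamma>"
      by (intro has_contour_integral_integral contour_integrable_continuous_part_circlepath
          continuous_on_subset[OF that image])
    then have "((\<lambda>t. g (0 + \<rho> * cis t) * \<rho> * \<i> * cis t) has_integral contour_integral ?\<gamma> g) {A..A + 2 * pi}"
      by (subst (asm) has_contour_integral_part_circlepath_iff) simp_all
    then show ?thesis by (simp add: integral_unique)
  qed
  have "winding_number ?\<gamma> 0 = 1 / (2 * of_real pi * \<i>) * contour_integral ?\<gamma> (\<lambda>w. 1 / (w - 0))"
    by (subst winding_number_valid_path) (use zero_notin in simp_all)
  also have "contour_integral ?\<gamma> (\<lambda>w. 1 / (w - 0)) = integral {A..A + 2 * pi} (\<lambda>t. \<i>)"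
    using assms(2) by (subst int) (auto intro!: continuous_intros simp: cis_neq_zero)
  finally have wn: "winding_number ?\<gamma> 0 = 1"
    by (simp add: scaleR_conv_of_real)
  have "contour_integral ?\<gamma> f = 2 * pi * \<i> * (\<Sum>p\<in>{0}. winding_number ?\<gamma> p * residue f p)"
  proof (rule Residue_theorem[of "ball 0 R"])
    show "path_image ?\<gamma> \<subseteq> ball 0 R - {0}" using image assms by auto
    show "\<forall>z. z \<notin> ball 0 R \<longrightarrow> winding_number ?\<gamma> z = 0"
      using image assms(3) loop by (auto intro!: winding_number_zero_outside[of _ "cball 0 \<rho>"])
  qed (use assms loop in auto)
  moreover have "continuous_on (sphere 0 \<rho>) f"
    by (rule continuous_on_subset[OF holomorphic_on_imp_continuous_on[OF assms(1)]]) (use assms in auto)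
  ultimately show ?thesis using wn by (simp add: int)
qed

text \<open>A Sokhotski-Plemelj formula. Write g(w) = g(z) + (w - z) g1(w): by symmetry of the arc
  the constant contributes half a residue, and g1 is regular at z and integrates to its residue at
  0. Nothing is asked of \<open>F\<close> at z, where the integrand is singular.\<close>

lemma has_pv_integral_cauchy_kernel:
  assumes g: "g holomorphic_on ball 0 R - {0}" and z: "0 < norm z" "norm z < R"
    and F: "\<And>w. norm w = norm z \<Longrightarrow> w \<noteq> z \<Longrightarrow> F w = g w / (w - z)"
  shows "has_pv_integral F z (2 * of_real pi * \<i> * (residue (\<lambda>w. g w / (w - z)) 0 + g z / 2))"
proof -
  define \<rho> where "\<rho> = norm z"
  have \<rho>: "0 < \<rho>" "\<rho> < R" using z by (auto simp: \<rho>_def)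
  define A where "A = Arg z"
  have zA: "z = of_real \<rho> * cis A"
    using z by (simp add: A_def \<rho>_def cis_Arg sgn_eq)
  define g1 where "g1 = (\<lambda>w. if w = z then deriv g z else (g w - g z) / (w - z))"
  have g1: "g1 holomorphic_on ball 0 R - {0}"
    unfolding g1_def by (rule pole_lemma_open[OF g]) auto
  define k where "k t = g1 (\<rho> * cis t) * \<rho> * \<i> * cis t" for t :: real
  have contk: "continuous_on UNIV k"
    unfolding k_def
    by (intro continuous_intros continuous_on_compose2[OF holomorphic_on_imp_continuous_on[OF g1]])
       (use \<rho> in \<open>auto simp: norm_mult cis_neq_zero\<close>)
  define J where "J \<epsilon> = g z * (\<i> * of_real (pi - \<epsilon>)) + integral {A + \<epsilon>..A + 2 * pi - \<epsilon>} k" for \<epsilon>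
  have J: "(F has_contour_integral J \<epsilon>) (part_circlepath 0 (norm z) (Arg z + \<epsilon>) (Arg z + 2 * pi - \<epsilon>))"
    if "0 < \<epsilon>" "\<epsilon> < pi" for \<epsilon>
  proof -
    have "((\<lambda>t. g z * (\<i> * cis t / (cis t - cis A)) + k t) has_integral J \<epsilon>) {A + \<epsilon>..A + 2 * pi - \<epsilon>}"
      unfolding J_def using that
      by (intro has_integral_add has_integral_mult_right has_integral_cauchy_kernel_arc
          integrable_integral integrable_continuous_real continuous_on_subset[OF contk]) auto
    then have "((\<lambda>t. F (0 + \<rho> * cis t) * \<rho> * \<i> * cis t) has_integral J \<epsilon>) {A + \<epsilon>..A + 2 * pi - \<epsilon>}"
    proof (rule has_integral_eq[rotated])
      fix t assume t: "t \<in> {A + \<epsilon>..A + 2 * pi - \<epsilon>}"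
      have ne: "cis t \<noteq> cis A"
      proof
        assume "cis t = cis A"
        then have "cis (t - A) = 1" by (simp add: cis_divide[symmetric])
        then have "cos (t - A) = 1" by (metis cis.simps(1) one_complex.simps(1))
        then obtain n :: int where n: "t - A = of_int n * 2 * pi"
          by (auto simp: cos_one_2pi_int)
        have "0 < t - A" "t - A < 1 * (2 * pi)" using t that by auto
        then have "0 < of_int n * (2 * pi)" "of_int n * (2 * pi) < 1 * (2 * pi)"
          using n by auto
        then have "0 < n" "n < 1"
          unfolding mult_less_cancel_right zero_less_mult_iff by auto
        then show False by simp
      qed
      then have "of_real \<rho> * cis t \<noteq> z" using \<rho> by (simp add: zA)
      moreover have "norm (of_real \<rho> * cis t) = norm z" using \<rho> by (simp add: norm_mult \<rho>_def)
      moreover have "\<rho> * cis t - z = \<rho> * (cis t - cis A)" by (simp add: zA right_diff_distrib)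
      moreover have "p * (\<i> * cis t / d) + (q - p) / (\<rho> * d) * \<rho> * \<i> * cis t = q / (\<rho> * d) * \<rho> * \<i> * cis t"
        if "d \<noteq> 0" for p q d :: complex
        using that \<rho> by (simp add: divide_simps) (simp add: algebra_simps)
      ultimately show "g z * (\<i> * cis t / (cis t - cis A)) + k t = F (0 + \<rho> * cis t) * \<rho> * \<i> * cis t"
        using ne by (simp add: F k_def g1_def)
    qed
    then show ?thesis
      using that by (subst has_contour_integral_part_circlepath_iff) (auto simp: A_def \<rho>_def)
  qed
  have "(J \<longlongrightarrow> g z * (\<i> * of_real (pi - 0)) + integral {A..A + 2 * pi} k) (at_right 0)"
    unfolding J_def by (intro tendsto_intros tendsto_arc_integral contk) auto
  also have "integral {A..A + 2 * pi} k = 2 * of_real pi * \<i> * residue g1 0"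
    unfolding k_def by (rule circ_int_part_circlepath[OF g1 \<rho>])
  \<comment> \<open>The two functions differ by g(z) / (w - z), which is holomorphic near 0 and adds
    no residue there.\<close>
  also have "residue g1 0 = residue (\<lambda>w. g w / (w - z)) 0"
  proof -
    define e where "e = norm z / 2"
    have e: "0 < e" "e < norm z" using z by (auto simp: e_def)
    have *: "circ_int e (\<lambda>w. g z / (w - z)) = 0"
      by (rule circ_int_holomorphic[of _ "norm z"]) (use e in \<open>auto intro!: holomorphic_intros\<close>)
    have gz: "(\<lambda>w. g w / (w - z)) holomorphic_on ball 0 (norm z) - {0}"
      by (intro holomorphic_intros holomorphic_on_subset[OF g]) (use z in auto)
    have "residue (\<lambda>w. g w / (w - z)) 0 = circ_int e (\<lambda>w. g w / (w - z))"
      by (rule circ_int_residue[OF gz e, symmetric])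
    also have "\<dots> = circ_int e (\<lambda>w. g1 w + g z / (w - z))"
      using e by (intro circ_int_cong) (auto simp: g1_def diff_divide_distrib)
    also have "\<dots> = circ_int e g1 + circ_int e (\<lambda>w. g z / (w - z))"
    proof (rule circ_int_add)
      show "continuous_on (sphere 0 e) g1"
        by (rule continuous_on_subset[OF holomorphic_on_imp_continuous_on[OF g1]]) (use e z in auto)
      show "continuous_on (sphere 0 e) (\<lambda>w. g z / (w - z))"
        using e by (intro continuous_intros) auto
    qed (use e in auto)
    also have "circ_int e g1 = residue g1 0"
      by (rule circ_int_residue[OF g1]) (use e z in auto)
    finally show ?thesis using * by simp
  qed
  finally have "(J \<longlongrightarrow> 2 * of_real pi * \<i> * (residue (\<lambda>w. g w / (w - z)) 0 + g z / 2)) (at_right 0)"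
    by (simp add: algebra_simps)
  moreover have "\<forall>\<^sub>F \<epsilon> in at_right 0.
      (F has_contour_integral J \<epsilon>) (part_circlepath 0 (norm z) (Arg z + \<epsilon>) (Arg z + 2 * pi - \<epsilon>))"
    using eventually_at_right_real[OF pi_gt_zero] by eventually_elim (auto intro: J)
  ultimately show ?thesis unfolding has_pv_integral_def by blast
qed

section \<open>The Yang-Baxter equation integrated over a torus\<close>

definition torus_int :: "real \<Rightarrow> real \<Rightarrow> (complex \<Rightarrow> complex \<Rightarrow> complex) \<Rightarrow> complex" where
  "torus_int \<rho> \<sigma> F = circ_int \<rho> (\<lambda>u. circ_int \<sigma> (F u))"

locale torus =
  fixes \<rho> \<sigma> :: real
  assumes radii: "0 < \<rho>" "0 < \<sigma>"
begin

abbreviation "cont_torus F \<equiv> continuous_on (sphere 0 \<rho> \<times> sphere 0 \<sigma>) (\<lambda>(u, v). F u v)"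

lemma cont_torus_slice:
  assumes "cont_torus F" "norm u = \<rho>" shows "continuous_on (sphere 0 \<sigma>) (F u)"
  using continuous_on_compose2[OF assms(1), of "sphere 0 \<sigma>" "\<lambda>v. (u, v)"] assms(2)
  by (force intro!: continuous_intros)

lemma cont_torus_circ_int:
  assumes "cont_torus F" shows "continuous_on (sphere 0 \<rho>) (\<lambda>u. circ_int \<sigma> (F u))"
  using assms radii by (intro continuous_on_circ_int) auto

lemma torus_int_cong:
  assumes "\<And>u v. norm u = \<rho> \<Longrightarrow> norm v = \<sigma> \<Longrightarrow> F u v = G u v"
  shows "torus_int \<rho> \<sigma> F = torus_int \<rho> \<sigma> G"
  unfolding torus_int_def using assms radii by (intro circ_int_cong) auto

lemma torus_int_add:
  assumes "cont_torus F" "cont_torus G"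
  shows "torus_int \<rho> \<sigma> (\<lambda>u v. F u v + G u v) = torus_int \<rho> \<sigma> F + torus_int \<rho> \<sigma> G"
proof -
  have "torus_int \<rho> \<sigma> (\<lambda>u v. F u v + G u v) = circ_int \<rho> (\<lambda>u. circ_int \<sigma> (F u) + circ_int \<sigma> (G u))"
    unfolding torus_int_def
    using radii cont_torus_slice[OF assms(1)] cont_torus_slice[OF assms(2)]
    by (intro circ_int_cong circ_int_add) auto
  then show ?thesis
    unfolding torus_int_def using radii cont_torus_circ_int[OF assms(1)] cont_torus_circ_int[OF assms(2)]
    by (simp add: circ_int_add)
qed

lemma torus_int_mult_left: "torus_int \<rho> \<sigma> (\<lambda>u v. c * F u v) = c * torus_int \<rho> \<sigma> F"
  by (simp add: torus_int_def circ_int_mult_left)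

lemma torus_int_0: "torus_int \<rho> \<sigma> (\<lambda>u v. 0) = 0"
  by (simp add: torus_int_def)

lemma torus_int_sum:
  assumes "\<And>i. i \<in> A \<Longrightarrow> cont_torus (F i)"
  shows "torus_int \<rho> \<sigma> (\<lambda>u v. \<Sum>i\<in>A. F i u v) = (\<Sum>i\<in>A. torus_int \<rho> \<sigma> (F i))"
  using assms
proof (induction A rule: infinite_finite_induct)
  case (insert x A)
  moreover have "cont_torus (\<lambda>u v. \<Sum>i\<in>A. F i u v)"
    using continuous_on_sum[of A, OF insert.prems[unfolded split_beta]] by (simp add: split_beta)
  ultimately show ?case by (simp add: torus_int_add)
qed (simp_all add: torus_int_0)

lemma torus_int_swap:
  assumes "cont_torus F"
  shows "torus_int \<rho> \<sigma> F = circ_int \<sigma> (\<lambda>v. circ_int \<rho> (\<lambda>u. F u v))"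
  unfolding torus_int_def using radii assms by (intro circ_int_swap) auto

lemma torus_int_product:
  "torus_int \<rho> \<sigma> (\<lambda>u v. f u * g v) = circ_int \<rho> f * circ_int \<sigma> g"
  by (simp add: torus_int_def circ_int_mult_left circ_int_mult_right)

text \<open>The dynamical Yang-Baxter equation integrated against the weight \<open>\<alpha>(u) \<beta>(v)\<close>; the functions
  \<open>f12\<close>, \<open>f13\<close>, \<open>f23\<close> stand for the components of \<open>r\<^sup>1\<^sup>2\<close>, \<open>r\<^sup>1\<^sup>3\<close>, \<open>r\<^sup>2\<^sup>3\<close> and \<open>d1\<close>, \<open>d2\<close>, \<open>d3\<close> for those of
  the derivatives, as functions on the torus.\<close>

lemma torus_int_yang_baxter:
  fixes c :: "'n::finite \<Rightarrow> 'n \<Rightarrow> 'n \<Rightarrow> complex" and H :: "'l::finite \<Rightarrow> 'n \<Rightarrow> complex"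
  assumes \<alpha>: "continuous_on (sphere 0 \<rho>) \<alpha>" and \<beta>: "continuous_on (sphere 0 \<sigma>) \<beta>"
    and d: "\<And>m i j. cont_torus (d1 m i j)" "\<And>m i j. cont_torus (d2 m i j)" "\<And>m i j. cont_torus (d3 m i j)"
    and f: "\<And>i j. cont_torus (f12 i j)" "\<And>i j. cont_torus (f13 i j)" "\<And>i j. cont_torus (f23 i j)"
    and yb: "\<And>u v. norm u = \<rho> \<Longrightarrow> norm v = \<sigma> \<Longrightarrow>
      (\<Sum>m\<in>UNIV. H m i * d1 m j k u v + H m j * d2 m i k u v + H m k * d3 m i j u v)
      + (\<Sum>a\<in>UNIV. \<Sum>b\<in>UNIV. f12 a j u v * f13 b k u v * c a b i)
      + (\<Sum>a\<in>UNIV. \<Sum>b\<in>UNIV. f12 i a u v * f23 b k u v * c a b j)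
      + (\<Sum>a\<in>UNIV. \<Sum>b\<in>UNIV. f13 i a u v * f23 j b u v * c a b k) = 0"
  defines "J \<equiv> \<lambda>F. torus_int \<rho> \<sigma> (\<lambda>u v. \<alpha> u * \<beta> v * F u v)"
  shows "(\<Sum>m\<in>UNIV. H m i * J (d1 m j k) + H m j * J (d2 m i k) + H m k * J (d3 m i j))
      + (\<Sum>a\<in>UNIV. \<Sum>b\<in>UNIV. c a b i * J (\<lambda>u v. f12 a j u v * f13 b k u v))
      + (\<Sum>a\<in>UNIV. \<Sum>b\<in>UNIV. c a b j * J (\<lambda>u v. f12 i a u v * f23 b k u v))
      + (\<Sum>a\<in>UNIV. \<Sum>b\<in>UNIV. c a b k * J (\<lambda>u v. f13 i a u v * f23 j b u v)) = 0"
proof -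
  have ab: "cont_torus (\<lambda>u v. \<alpha> u * \<beta> v)"
    unfolding split_beta
    by (intro continuous_intros continuous_on_compose2[OF \<alpha>] continuous_on_compose2[OF \<beta>]) auto
  have mult: "cont_torus (\<lambda>u v. F u v * G u v)" if "cont_torus F" "cont_torus G" for F G :: "complex \<Rightarrow> complex \<Rightarrow> complex"
    using continuous_on_mult[OF that[unfolded split_beta]] by (simp add: split_beta)
  have plus: "cont_torus (\<lambda>u v. F u v + G u v)" if "cont_torus F" "cont_torus G" for F G :: "complex \<Rightarrow> complex \<Rightarrow> complex"
    using continuous_on_add[OF that[unfolded split_beta]] by (simp add: split_beta)
  have sum: "cont_torus (\<lambda>u v. \<Sum>i\<in>A. F i u v)" if "\<And>i. cont_torus (F i)" for F :: "'i \<Rightarrow> complex \<Rightarrow> complex \<Rightarrow> complex" and A :: "'i set"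
    using continuous_on_sum[of A, OF that[unfolded split_beta]] by (simp add: split_beta)
  have const: "cont_torus (\<lambda>u v. x)" for x
    unfolding split_beta by (intro continuous_intros)
  have Jadd: "J (\<lambda>u v. F u v + G u v) = J F + J G" if "cont_torus F" "cont_torus G" for F G :: "complex \<Rightarrow> complex \<Rightarrow> complex"
    unfolding J_def distrib_left by (rule torus_int_add) (intro mult ab that)+
  have Jsum: "J (\<lambda>u v. \<Sum>i\<in>A. F i u v) = (\<Sum>i\<in>A. J (F i))" if "\<And>i. cont_torus (F i)" for F :: "'i \<Rightarrow> complex \<Rightarrow> complex \<Rightarrow> complex" and A :: "'i set"
    unfolding J_def sum_distrib_left by (rule torus_int_sum) (intro mult ab that)
  have Jmult': "J (\<lambda>u v. F u v * x) = x * J F" for x F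
  proof -
    have "(\<lambda>u v. \<alpha> u * \<beta> v * (F u v * x)) = (\<lambda>u v. x * (\<alpha> u * \<beta> v * F u v))"
      by (simp add: fun_eq_iff mult_ac)
    then show ?thesis by (simp only: J_def torus_int_mult_left)
  qed
  have Jmult: "J (\<lambda>u v. x * F u v) = x * J F" for x F
    using Jmult'[of F x] by (simp only: mult.commute[of x])
  have "J (\<lambda>u v. (\<Sum>m\<in>UNIV. H m i * d1 m j k u v + H m j * d2 m i k u v + H m k * d3 m i j u v)
      + (\<Sum>a\<in>UNIV. \<Sum>b\<in>UNIV. f12 a j u v * f13 b k u v * c a b i)
      + (\<Sum>a\<in>UNIV. \<Sum>b\<in>UNIV. f12 i a u v * f23 b k u v * c a b j)
      + (\<Sum>a\<in>UNIV. \<Sum>b\<in>UNIV. f13 i a u v * f23 j b u v * c a b k)) = 0"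
    unfolding J_def by (rule trans[OF torus_int_cong torus_int_0]) (simp add: yb)
  then show ?thesis
    by (simp only: Jadd Jsum Jmult Jmult' plus mult sum const d f)
qed

end

locale dynamical_setup = simple_lie_setup br h hb
  for br :: "complex^'n \<Rightarrow> complex^'n \<Rightarrow> complex^'n" and h and hb :: "'l::finite \<Rightarrow> complex^'n" +
  fixes r :: "complex^'l \<Rightarrow> complex \<Rightarrow> complex^'n^'n"
  assumes rmat: "dynamical_r_matrix br h hb r"
begin

text \<open>One radius valid on a whole neighbourhood, so that \<open>q\<close> may vary while the
  circles of integration stay fixed.\<close>

definition regular_on :: "(complex^'l) set \<Rightarrow> real \<Rightarrow> bool" where
  "regular_on U R \<longleftrightarrow> open U \<and> R > 0 \<and>
     (\<forall>q\<in>U. \<forall>z. 0 < norm z \<and> norm z < R \<longrightarrow> regular_at r q z)"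

abbreviation "dr m i j q z \<equiv> q_deriv r (axis m 1) i j q z"

lemma regular_pointsE:
  assumes "q \<in> regular_points r"
  obtains U R where "regular_on U R" "q \<in> U"
  using assms unfolding regular_points_def regular_on_def by blast

lemma regular_on_subset_points: "regular_on U R \<Longrightarrow> q \<in> U \<Longrightarrow> q \<in> regular_points r"
  unfolding regular_points_def regular_on_def by blast

lemma residue_r:
  "q \<in> regular_points r \<Longrightarrow> residue (\<lambda>z. r q z $ i $ j) 0 = \<Omega> $ i $ j"
  using rmat unfolding dynamical_r_matrix_def by blast

context
  fixes U R assumes U: "regular_on U R"
begin

lemma R_pos: "R > 0" and open_U: "open U"
  using U by (auto simp: regular_on_def)

lemma regular: "q \<in> U \<Longrightarrow> 0 < norm z \<Longrightarrow> norm z < R \<Longrightarrow> regular_at r q z"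
  using U by (auto simp: regular_on_def)

lemma holomorphic_r: "q \<in> U \<Longrightarrow> (\<lambda>z. r q z $ i $ j) holomorphic_on ball 0 R - {0}"
  unfolding holomorphic_on_def
  by (intro ballI, rule field_differentiable_at_within, rule regular_at_field_differentiable, rule regular) auto

lemma
  assumes "continuous_on S f" "continuous_on S g"
    and "\<And>x. x \<in> S \<Longrightarrow> f x \<in> U \<and> 0 < norm (g x) \<and> norm (g x) < R"
  shows continuous_on_r: "continuous_on S (\<lambda>x. r (f x) (g x) $ i $ j)"
    and continuous_on_q_deriv: "continuous_on S (\<lambda>x. q_deriv r a i j (f x) (g x))"
proof -
  have "continuous_on S (\<lambda>x. (\<lambda>(q, z). r q z $ i $ j) (f x, g x))"
    by (rule continuous_on_compose2[OF continuous_on_regular(1)])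
       (use assms regular in \<open>auto intro!: continuous_intros\<close>)
  then show "continuous_on S (\<lambda>x. r (f x) (g x) $ i $ j)" by simp
  have "continuous_on S (\<lambda>x. (\<lambda>(q, z). q_deriv r a i j q z) (f x, g x))"
    by (rule continuous_on_compose2[OF continuous_on_regular(2)])
       (use assms regular in \<open>auto intro!: continuous_intros\<close>)
  then show "continuous_on S (\<lambda>x. q_deriv r a i j (f x) (g x))" by simp
qed

lemma unitarity:
  assumes "q \<in> U" "0 < norm z" "norm z < R"
  shows "r q z $ i $ j = - r q (- z) $ j $ i"
proof -
  have "r q z + transpose (r q (- z)) = 0"
    using rmat regular[of q z] regular[of q "- z"] assms unfolding dynamical_r_matrix_def by auto
  then have "(r q z + transpose (r q (- z))) $ i $ j = 0" by simp
  then show ?thesis by (simp add: transpose_def eq_neg_iff_add_eq_0)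
qed

lemma q_deriv_unitarity:
  assumes "q \<in> U" "0 < norm z" "norm z < R"
  shows "q_deriv r a i j q z = - q_deriv r a j i q (- z)"
proof -
  have "((\<lambda>q. - r q (- z) $ j $ i) has_derivative (\<lambda>a. - q_deriv r a j i q (- z))) (at q)"
    by (intro has_derivative_minus has_derivative_q_deriv regular) (use assms in auto)
  then have "((\<lambda>q. r q z $ i $ j) has_derivative (\<lambda>a. - q_deriv r a j i q (- z))) (at q)"
    by (rule has_derivative_transform_within_open[OF _ open_U assms(1)]) (use assms in \<open>simp add: unitarity[of _ z i j]\<close>)
  moreover have "((\<lambda>q. r q z $ i $ j) has_derivative (\<lambda>a. q_deriv r a i j q z)) (at q)"
    by (intro has_derivative_q_deriv regular) (use assms in auto)
  ultimately have "(\<lambda>a. q_deriv r a i j q z) = (\<lambda>a. - q_deriv r a j i q (- z))"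
    by (rule has_derivative_unique[rotated])
  then show ?thesis by (rule fun_cong)
qed

text \<open>Unitarity rewrites the derivative of the 31 component in terms of z1 - z3. Only the
  three differences z1 - z2, z1 - z3, z2 - z3 remain, so the poles can be located from them.\<close>

lemma yang_baxter:
  assumes q: "q \<in> U"
    and z: "0 < norm (z1 - z2)" "norm (z1 - z2) < R" "0 < norm (z1 - z3)" "norm (z1 - z3) < R"
      "0 < norm (z2 - z3)" "norm (z2 - z3) < R"
  shows "(\<Sum>m\<in>UNIV. hb m $ i * dr m j k q (z2 - z3) + hb m $ j * (- dr m i k q (z1 - z3))
            + hb m $ k * dr m i j q (z1 - z2))
      + (\<Sum>a\<in>UNIV. \<Sum>b\<in>UNIV. r q (z1 - z2) $ a $ j * r q (z1 - z3) $ b $ k * sc a b i)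
      + (\<Sum>a\<in>UNIV. \<Sum>b\<in>UNIV. r q (z1 - z2) $ i $ a * r q (z2 - z3) $ b $ k * sc a b j)
      + (\<Sum>a\<in>UNIV. \<Sum>b\<in>UNIV. r q (z1 - z3) $ i $ a * r q (z2 - z3) $ j $ b * sc a b k) = 0"
proof -
  note reg = regular[OF q z(1,2)] regular[OF q z(3,4)] regular[OF q z(5,6)]
  have reg': "regular_at r q (z3 - z1)"
    using z by (intro regular q) (auto simp: norm_minus_commute)
  have "(alt_d hb r q z1 z2 z3
        + br_12_13 br (r q (z1 - z2)) (r q (z1 - z3))
        + br_12_23 br (r q (z1 - z2)) (r q (z2 - z3))
        + br_13_23 br (r q (z1 - z3)) (r q (z2 - z3))) $ i $ j $ k = 0"
    using rmat reg reg' unfolding dynamical_r_matrix_def by simp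
  moreover have "dr m k i q (z3 - z1) = - dr m i k q (z1 - z3)" for m
    using q_deriv_unitarity[OF q, of "z1 - z3" "axis m 1" i k] z by simp
  ultimately show ?thesis
    by (simp add: alt_d_def br_12_13_def br_12_23_def br_13_23_def
        partial_q_eq_q_deriv[OF reg(1)] partial_q_eq_q_deriv[OF reg(3)] partial_q_eq_q_deriv[OF reg'])
qed

end

end

section \<open>The order of the pole\<close>

lemma circ_int_cauchy_kernel:
  assumes f: "continuous_on (sphere 0 \<rho>) f" and \<rho>: "0 < \<rho>"
  shows "(\<lambda>z. circ_int \<rho> (\<lambda>w. f w / (w - z))) holomorphic_on ball 0 \<rho>"
proof -
  have "((\<lambda>z. circ_int \<rho> (\<lambda>w. f w / (w - z))) has_field_derivative
      circ_int \<rho> (\<lambda>w. f w / (w - z) ^ 2)) (at z)" if z: "z \<in> ball 0 \<rho>" for z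
  proof (rule circ_int_has_field_derivative[OF open_ball z])
    show "((\<lambda>z. f w / (w - z)) has_field_derivative f w / (w - z) ^ 2) (at z)"
      if "z \<in> ball 0 \<rho>" "norm w = \<rho>" for z w
      using that by (auto intro!: derivative_eq_intros simp: power2_eq_square)
    show "continuous_on (sphere 0 \<rho>) (\<lambda>w. f w / (w - z))" if "z \<in> ball 0 \<rho>" for z
      using that by (intro continuous_intros f) auto
    have "continuous_on (ball 0 \<rho> \<times> sphere 0 \<rho>) (\<lambda>x. f (snd x))"
      by (rule continuous_on_compose2[OF f]) (auto intro!: continuous_intros)
    then show "continuous_on (ball 0 \<rho> \<times> sphere 0 \<rho>) (\<lambda>(z, w). f w / (w - z) ^ 2)"
      unfolding split_beta by (rule continuous_on_divide) (auto intro!: continuous_intros)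
  qed (use \<rho> in auto)
  then show ?thesis
    unfolding holomorphic_on_open[OF open_ball] by blast
qed

section \<open>Laurent coefficients of \<open>r\<close> at \<open>z = 0\<close>\<close>

context dynamical_setup
begin

text \<open>The coefficient of u^(-p-1) in the Laurent expansion, so index 0 is \<Omega> and the
  indices from 1 on are the unwanted part. Residues make sense whatever the order of the
  singularity.\<close>

definition moment :: "nat \<Rightarrow> complex^'l \<Rightarrow> complex^'n^'n" where
  "moment p q = (\<chi> i j. residue (\<lambda>u. u ^ p * r q u $ i $ j) 0)"

context
  fixes U R assumes U: "regular_on U R"
begin

text \<open>The pole u = -v lies outside the circle because \<rho> < |v|.\<close>

lemma circ_int_r_shift:
  assumes "q \<in> U" "0 < \<rho>" "\<rho> < norm v" "\<rho> + norm v < R"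
  shows "circ_int \<rho> (\<lambda>u. u ^ p * r q (u + v) $ i $ j) = 0"
proof (rule circ_int_holomorphic)
  have "(\<lambda>u. r q (u + v) $ i $ j) holomorphic_on ball 0 (min (norm v) (R - norm v))"
  proof (intro holomorphic_on_compose_gen[OF _ holomorphic_r[OF U assms(1)], of "\<lambda>u. u + v", unfolded o_def])
    show "(\<lambda>u. u + v) ` ball 0 (min (norm v) (R - norm v)) \<subseteq> ball 0 R - {0}"
    proof clarify
      fix u :: complex assume u: "u \<in> ball 0 (min (norm v) (R - norm v))"
      then have "norm (u + v) < R" using norm_triangle_ineq[of u v] by auto
      moreover have "u + v \<noteq> 0" using u by (auto simp: eq_neg_iff_add_eq_0[symmetric])
      ultimately show "u + v \<in> ball 0 R - {0}" by simp
    qed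
  qed (intro holomorphic_intros)
  then show "(\<lambda>u. u ^ p * r q (u + v) $ i $ j) holomorphic_on ball 0 (min (norm v) (R - norm v))"
    by (intro holomorphic_intros)
qed (use assms in auto)

lemma norm_add_range:
  fixes u v :: complex
  assumes "norm u = \<rho>" "\<rho> < norm v" "\<rho> + norm v < R"
  shows "0 < norm (u + v) \<and> norm (u + v) < R"
  using assms norm_triangle_ineq[of u v] norm_diff_ineq[of v u] by (auto simp: add.commute)

text \<open>Differentiates the vanishing of the preceding integral in \<open>q\<close>. Holomorphy
  of the q-derivative in z has not been established at this stage, so the integral is not treated by
  its poles.\<close>

lemma circ_int_q_deriv_shift:
  assumes q: "q \<in> U" and v: "0 < \<rho>" "\<rho> < norm v" "\<rho> + norm v < R"
  shows "circ_int \<rho> (\<lambda>u. u ^ p * q_deriv r a i j q (u + v)) = 0"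
proof -
  note range = norm_add_range[OF _ v(2,3)]
  have "((\<lambda>q. circ_int \<rho> (\<lambda>u. u ^ p * r q (u + v) $ i $ j)) has_derivative
      (\<lambda>a. circ_int \<rho> (\<lambda>u. u ^ p * q_deriv r a i j q (u + v)))) (at q)"
  proof (rule circ_int_has_derivative[OF open_U[OF U] q])
    show "((\<lambda>q. u ^ p * r q (u + v) $ i $ j) has_derivative (\<lambda>a. u ^ p * q_deriv r a i j q (u + v))) (at q)"
      if "q \<in> U" "norm u = \<rho>" for q u
      using that range by (intro has_derivative_mult_right has_derivative_q_deriv regular[OF U]) auto
    show "continuous_on (sphere 0 \<rho>) (\<lambda>u. u ^ p * r q (u + v) $ i $ j)" if "q \<in> U" for q
      using that range by (intro continuous_on_mult continuous_on_r[OF U] continuous_intros) auto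
    show "continuous_on (U \<times> sphere 0 \<rho>) (\<lambda>(q, u). u ^ p * q_deriv r a i j q (u + v))" for a
      unfolding split_beta using range
      by (intro continuous_on_mult continuous_on_q_deriv[OF U] continuous_intros) auto
  qed (use v in auto)
  then have "((\<lambda>q. 0) has_derivative (\<lambda>a. circ_int \<rho> (\<lambda>u. u ^ p * q_deriv r a i j q (u + v)))) (at q)"
    by (rule has_derivative_transform_within_open[OF _ open_U[OF U] q]) (use circ_int_r_shift v in auto)
  from has_derivative_unique[OF this has_derivative_const] show ?thesis by metis
qed

text \<open>The Yang-Baxter equation at \<open>(z\<^sub>1, z\<^sub>2, z\<^sub>3) = (u + v, v, 0)\<close> is integrated against
  \<open>u\<^sup>p v\<^sup>e\<close> over \<open>|u| < |v|\<close>.  All terms which are holomorphic in \<open>u\<close> or in \<open>v\<close> drop out.\<close>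

lemma yang_baxter_moments:
  assumes q: "q \<in> U"
  shows "br_12_13 br (moment p q) \<Omega> + br_12_23 br (moment p q) \<Omega> = 0" (is ?first)
    and "br_12_13 br (moment p q) (moment 1 q) - br_12_13 br (moment (Suc p) q) \<Omega>
      + br_12_23 br (moment p q) (moment 1 q) = 0" (is ?second)
proof -
  define \<rho> \<sigma> where "\<rho> = R / 4" and "\<sigma> = R / 2"
  note R = R_pos[OF U]
  have rs: "0 < \<rho>" "\<rho> < \<sigma>" "\<rho> + \<sigma> < R" "0 < \<sigma>" "\<rho> < R" "\<sigma> < R" using R by (auto simp: \<rho>_def \<sigma>_def)
  interpret torus \<rho> \<sigma> by unfold_locales (use rs in auto)
  have range: "0 < norm (u + v) \<and> norm (u + v) < R" if "norm u = \<rho>" "norm v = \<sigma>" for u v :: complex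
    using norm_add_range[OF that(1), of v] that rs by auto
  have rescirc: "circ_int \<tau> (\<lambda>u. u ^ p * r q u $ i $ j) = moment p q $ i $ j" if "0 < \<tau>" "\<tau> < R" for \<tau> p i j
    unfolding moment_def using circ_int_residue[of "\<lambda>u. u ^ p * r q u $ i $ j" R \<tau>] that
    by (simp add: holomorphic_intros holomorphic_r[OF U q])
  have moment0: "moment 0 q = \<Omega>"
    by (simp add: vec_eq_iff moment_def residue_r regular_on_subset_points[OF U q])
  have pow: "circ_int \<tau> (\<lambda>u. u ^ p) = 0" if "0 < \<tau>" for \<tau> p
    using that by (intro circ_int_holomorphic[of _ "\<tau> + 1"]) (auto intro!: holomorphic_intros)
  \<comment> \<open>Here |u| < \<sigma>, so the circle of v surrounds the pole v = -u. For e = 1,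
    writing v = (u + v) - u produces the moments 1 and 0.\<close>
  have shift: "circ_int \<sigma> (\<lambda>v. v ^ e * r q (u + v) $ b $ k)
      = (if e = 0 then \<Omega> $ b $ k else moment 1 q $ b $ k - u * \<Omega> $ b $ k)"
    if u: "norm u = \<rho>" and e: "e < 2" for u b k and e :: nat
  proof -
    have s: "circ_int \<sigma> (\<lambda>v. (u + v) ^ e * r q (u + v) $ b $ k) = moment e q $ b $ k" for e
      using circ_int_shift[of "\<lambda>w. w ^ e * r q w $ b $ k" R u \<sigma>] u rs
      by (simp add: moment_def holomorphic_intros holomorphic_r[OF U q])
    show ?thesis
    proof (cases "e = 0")
      case True
      then show ?thesis using s[of 0] moment0 by simp
    next
      case False
      then have [simp]: "e = 1" using e by simp
      have "circ_int \<sigma> (\<lambda>v. v ^ e * r q (u + v) $ b $ k)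
          = circ_int \<sigma> (\<lambda>v. (u + v) ^ 1 * r q (u + v) $ b $ k + (- u) * ((u + v) ^ 0 * r q (u + v) $ b $ k))"
        using rs by (intro circ_int_cong) (auto simp: algebra_simps)
      also have "\<dots> = moment 1 q $ b $ k + (- u) * moment 0 q $ b $ k"
        unfolding s[symmetric] circ_int_mult_left[symmetric] using rs range u
        by (intro circ_int_add continuous_on_mult continuous_on_r[OF U] continuous_intros) (auto simp: q)
      finally show ?thesis by (simp add: moment0)
    qed
  qed
  \<comment> \<open>The exponent \<open>e\<close> of v selects the identity: 0 for the first, 1 for
    the second.\<close>
  have main: "(\<Sum>a\<in>UNIV. \<Sum>b\<in>UNIV. sc a b i * (if e = 0 then moment p q $ a $ j * \<Omega> $ b $ k
          else moment p q $ a $ j * moment 1 q $ b $ k - moment (Suc p) q $ a $ j * \<Omega> $ b $ k))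
      + (\<Sum>a\<in>UNIV. \<Sum>b\<in>UNIV. sc a b j * (moment p q $ i $ a * moment e q $ b $ k)) = 0"
    if e: "e < 2" for e i j k
  proof -
    define J where "J F = torus_int \<rho> \<sigma> (\<lambda>u v. u ^ p * v ^ e * F u v)" for F
    define f12 f13 f23 where "f12 i j u v = r q u $ i $ j" and "f13 i j u v = r q (u + v) $ i $ j"
      and "f23 i j u v = r q v $ i $ j" for i j u and v :: complex
    define d1 d2 d3 where "d1 m i j u v = dr m i j q v" and "d2 m i j u v = - dr m i j q (u + v)"
      and "d3 m i j u v = dr m i j q u" for m i j u and v :: complex
    have c: "cont_torus (f12 i j)" "cont_torus (f13 i j)" "cont_torus (f23 i j)"
      "cont_torus (d1 m i j)" "cont_torus (d2 m i j)" "cont_torus (d3 m i j)" for i j m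
      unfolding f12_def f13_def f23_def d1_def d2_def d3_def split_beta using rs range
      by (intro continuous_on_r[OF U] continuous_on_q_deriv[OF U] continuous_intros; force simp: q)+
    have yb: "(\<Sum>m\<in>UNIV. hb m $ i * J (d1 m j k) + hb m $ j * J (d2 m i k) + hb m $ k * J (d3 m i j))
      + (\<Sum>a\<in>UNIV. \<Sum>b\<in>UNIV. sc a b i * J (\<lambda>u v. f12 a j u v * f13 b k u v))
      + (\<Sum>a\<in>UNIV. \<Sum>b\<in>UNIV. sc a b j * J (\<lambda>u v. f12 i a u v * f23 b k u v))
      + (\<Sum>a\<in>UNIV. \<Sum>b\<in>UNIV. sc a b k * J (\<lambda>u v. f13 i a u v * f23 j b u v)) = 0"
      unfolding J_def
      apply (rule torus_int_yang_baxter[OF _ _ c(4-6) c(1-3)])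
      subgoal by (intro continuous_intros)
      subgoal by (intro continuous_intros)
      subgoal premises uv for u v
        unfolding f12_def f13_def f23_def d1_def d2_def d3_def
        using yang_baxter[OF U q, of "u + v" v 0 i j k] range[OF uv] rs uv by simp
      done
    have swap: "J F = 0" if "cont_torus F" "\<And>v. norm v = \<sigma> \<Longrightarrow> circ_int \<rho> (\<lambda>u. u ^ p * v ^ e * F u v) = 0" for F
    proof -
      have "continuous_on (sphere 0 \<rho> \<times> sphere 0 \<sigma>) (\<lambda>x. fst x ^ p * snd x ^ e * F (fst x) (snd x))"
        by (intro continuous_on_mult continuous_intros that(1)[unfolded split_beta])
      then have "J F = circ_int \<sigma> (\<lambda>v. circ_int \<rho> (\<lambda>u. u ^ p * v ^ e * F u v))"
        unfolding J_def by (intro torus_int_swap) (simp add: split_beta)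
      also have "\<dots> = circ_int \<sigma> (\<lambda>v. 0)"
        using rs that(2) by (intro circ_int_cong) auto
      finally show ?thesis by simp
    qed
    \<comment> \<open>\<open>d1\<close> is free of u and \<open>d3\<close> of v, so in each case one
      circle integral is that of a nonnegative power and vanishes.\<close>
    have "J (d1 m j k) = 0" for m
      unfolding J_def d1_def using torus_int_product[of "\<lambda>u. u ^ p" "\<lambda>v. v ^ e * dr m j k q v"] pow rs
      by (simp add: mult_ac)
    moreover have "J (d3 m i j) = 0" for m
      unfolding J_def d3_def using torus_int_product[of "\<lambda>u. u ^ p * dr m i j q u" "\<lambda>v. v ^ e"] pow rs
      by (simp add: mult_ac)
    moreover have "J (d2 m i k) = 0" for m
    proof (rule swap[OF c(5)])
      fix v :: complex assume v: "norm v = \<sigma>"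
      have "circ_int \<rho> (\<lambda>u. u ^ p * v ^ e * d2 m i k u v)
          = circ_int \<rho> (\<lambda>u. - (v ^ e) * (u ^ p * dr m i k q (u + v)))"
        unfolding d2_def using rs by (intro circ_int_cong) auto
      then show "circ_int \<rho> (\<lambda>u. u ^ p * v ^ e * d2 m i k u v) = 0"
        unfolding circ_int_mult_left using circ_int_q_deriv_shift[OF q, of \<rho> v] v rs by simp
    qed
    moreover have "J (\<lambda>u v. f13 i a u v * f23 j b u v) = 0" for a b
    proof (rule swap)
      show "cont_torus (\<lambda>u v. f13 i a u v * f23 j b u v)"
        unfolding split_beta by (intro continuous_on_mult c(2,3)[unfolded split_beta])
      fix v :: complex assume v: "norm v = \<sigma>"
      \<comment> \<open>\<open>f23\<close> ignores its first spectral argument; the 0 below only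
        fills the slot.\<close>
      have "circ_int \<rho> (\<lambda>u. u ^ p * v ^ e * (f13 i a u v * f23 j b u v))
          = circ_int \<rho> (\<lambda>u. (v ^ e * f23 j b 0 v) * (u ^ p * r q (u + v) $ i $ a))"
        unfolding f13_def f23_def using rs by (intro circ_int_cong) auto
      then show "circ_int \<rho> (\<lambda>u. u ^ p * v ^ e * (f13 i a u v * f23 j b u v)) = 0"
        unfolding circ_int_mult_left using circ_int_r_shift[OF q, of \<rho> v] v rs by simp
    qed
    moreover have "J (\<lambda>u v. f12 i a u v * f23 b k u v) = moment p q $ i $ a * moment e q $ b $ k" for a b
      unfolding J_def f12_def f23_def
      using torus_int_product[of "\<lambda>u. u ^ p * r q u $ i $ a" "\<lambda>v. v ^ e * r q v $ b $ k"] rescirc rs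
      by (simp add: mult_ac)
    moreover have "J (\<lambda>u v. f12 a j u v * f13 b k u v) = (if e = 0 then moment p q $ a $ j * \<Omega> $ b $ k
          else moment p q $ a $ j * moment 1 q $ b $ k - moment (Suc p) q $ a $ j * \<Omega> $ b $ k)" for a b
    proof -
      \<comment> \<open>For e = 1 the inner integral carries a factor u, which raises the outer
        moment from \<open>p\<close> to \<open>Suc p\<close>. This is how one moment gets tied to
        the next.\<close>
      have "J (\<lambda>u v. f12 a j u v * f13 b k u v)
          = circ_int \<rho> (\<lambda>u. u ^ p * r q u $ a $ j * circ_int \<sigma> (\<lambda>v. v ^ e * r q (u + v) $ b $ k))"
        unfolding J_def torus_int_def f12_def f13_def circ_int_mult_left[symmetric]
        by (simp add: mult_ac)
      also have "\<dots> = circ_int \<rho> (\<lambda>u. u ^ p * r q u $ a $ j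
          * (if e = 0 then \<Omega> $ b $ k else moment 1 q $ b $ k - u * \<Omega> $ b $ k))"
        using rs shift[OF _ e] by (intro circ_int_cong) auto
      also have "\<dots> = (if e = 0 then moment p q $ a $ j * \<Omega> $ b $ k
          else moment p q $ a $ j * moment 1 q $ b $ k - moment (Suc p) q $ a $ j * \<Omega> $ b $ k)"
      proof (cases "e = 0")
        case True
        then show ?thesis using rescirc[of \<rho> p a j] rs by (simp add: circ_int_mult_right)
      next
        case False
        have cu: "continuous_on (sphere 0 \<rho>) (\<lambda>u. u ^ p * r q u $ a $ j)" for p
          using rs by (intro continuous_on_mult continuous_on_r[OF U] continuous_intros) (auto simp: q)
        have "circ_int \<rho> (\<lambda>u. u ^ p * r q u $ a $ j * (moment 1 q $ b $ k - u * \<Omega> $ b $ k))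
            = circ_int \<rho> (\<lambda>u. (u ^ p * r q u $ a $ j) * moment 1 q $ b $ k
                + (u ^ Suc p * r q u $ a $ j) * (- \<Omega> $ b $ k))"
          using rs by (intro circ_int_cong) (auto simp: algebra_simps)
        also have "\<dots> = circ_int \<rho> (\<lambda>u. u ^ p * r q u $ a $ j) * moment 1 q $ b $ k
            + circ_int \<rho> (\<lambda>u. u ^ Suc p * r q u $ a $ j) * (- \<Omega> $ b $ k)"
          unfolding circ_int_mult_right[symmetric]
          by (rule circ_int_add) (use rs in \<open>auto intro!: continuous_on_mult cu continuous_intros simp del: power_Suc\<close>)
        finally show ?thesis using False rescirc[of \<rho> _ a j] rs by (simp del: power_Suc)
      qed
      finally show ?thesis .
    qed
    ultimately show ?thesis using yb by simp
  qed
  show ?first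
    unfolding vec_eq_iff using main[of 0] moment0
    by (simp add: br_12_13_def br_12_23_def mult_ac)
  show ?second
    unfolding vec_eq_iff using main[of 1] 
    by (simp add: br_12_13_def br_12_23_def mult_ac right_diff_distrib sum_subtractf)
qed

text \<open>Invariance of \<open>moment p\<close>, tested on \<open>moment 1\<close>, cancels all of
  the second identity except the commutator of \<open>moment (Suc p)\<close> with \<Omega>. The
  argument is uniform in \<open>p\<close>, without induction.\<close>

lemma moment_Suc_eq_0:
  assumes q: "q \<in> U" shows "moment (Suc p) q = 0"
proof (rule br_12_13_casimir_eq_0)
  have "br_12_13 br (moment p q) (moment 1 q) + br_12_23 br (moment p q) (moment 1 q) = 0"
    by (rule invariant_of_casimir[OF yang_baxter_moments(1)[OF q]])
  moreover have "br_12_13 br (moment p q) (moment 1 q) + br_12_23 br (moment p q) (moment 1 q)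
      = br_12_13 br (moment (Suc p) q) \<Omega>"
    using yang_baxter_moments(2)[OF q, of p] by (simp add: algebra_simps)
  ultimately show "br_12_13 br (moment (Suc p) q) \<Omega> = 0" by simp
qed

text \<open>What remains of \<open>r\<close> after removing \<Omega> / z, written as a Cauchy
  integral over a fixed circle away from the pole: holomorphy in z is then immediate, and
  \<open>q\<close> can be varied under the integral.\<close>

definition regular_part :: "complex^'l \<Rightarrow> 'n \<Rightarrow> 'n \<Rightarrow> complex \<Rightarrow> complex" where
  "regular_part q i j z = circ_int (R / 2) (\<lambda>w. r q w $ i $ j / (w - z))"

lemma holomorphic_regular_part:
  assumes "q \<in> U" shows "regular_part q i j holomorphic_on ball 0 (R / 2)"
  unfolding regular_part_def using assms R_pos[OF U]
  by (intro circ_int_cauchy_kernel continuous_on_r[OF U] continuous_intros) auto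

lemma r_simple_pole:
  assumes q: "q \<in> U" and z: "0 < norm z" "norm z < R / 2"
  shows "r q z $ i $ j = \<Omega> $ i $ j / z + regular_part q i j z"
proof -
  have "residue (\<lambda>w. w ^ p * r q w $ i $ j) 0 = 0" if "p \<ge> 1" for p
    using moment_Suc_eq_0[OF q, of "p - 1"] that by (simp add: moment_def vec_eq_iff)
  from simple_pole_representation[OF holomorphic_r[OF U q] this z]
  show ?thesis
    using residue_r[OF regular_on_subset_points[OF U q]] R_pos[OF U] by (simp add: regular_part_def)
qed

definition q_deriv_part :: "complex^'l \<Rightarrow> complex^'l \<Rightarrow> 'n \<Rightarrow> 'n \<Rightarrow> complex \<Rightarrow> complex" where
  "q_deriv_part q a i j z = circ_int (R / 2) (\<lambda>w. q_deriv r a i j q w / (w - z))"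

lemma holomorphic_q_deriv_part:
  assumes "q \<in> U" shows "q_deriv_part q a i j holomorphic_on ball 0 (R / 2)"
  unfolding q_deriv_part_def using assms R_pos[OF U]
  by (intro circ_int_cauchy_kernel continuous_on_q_deriv[OF U] continuous_intros) auto

text \<open>The polar part \<Omega> / z is independent of \<open>q\<close>, so differentiation in
  \<open>q\<close> removes the pole and leaves a function holomorphic across 0.\<close>

lemma q_deriv_eq_part:
  assumes q: "q \<in> U" and z: "0 < norm z" "norm z < R / 2"
  shows "q_deriv r a i j q z = q_deriv_part q a i j z"
proof -
  have R: "0 < R / 2" "R / 2 < R" using R_pos[OF U] by auto
  have ne: "w \<noteq> z" if "norm w = R / 2" for w using that z by auto
  have "((\<lambda>q. circ_int (R / 2) (\<lambda>w. r q w $ i $ j / (w - z))) has_derivative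
      (\<lambda>a. circ_int (R / 2) (\<lambda>w. q_deriv r a i j q w / (w - z)))) (at q)"
  proof (rule circ_int_has_derivative[OF open_U[OF U] q])
    show "((\<lambda>q. r q w $ i $ j / (w - z)) has_derivative (\<lambda>a. q_deriv r a i j q w / (w - z))) (at q)"
      if "q \<in> U" "norm w = R / 2" for q w
      unfolding divide_inverse using that R
      by (intro has_derivative_mult_left has_derivative_q_deriv regular[OF U]) auto
    show "continuous_on (sphere 0 (R / 2)) (\<lambda>w. r q w $ i $ j / (w - z))" if "q \<in> U" for q
      using that R ne by (intro continuous_on_divide continuous_on_r[OF U] continuous_intros) auto
    show "continuous_on (U \<times> sphere 0 (R / 2)) (\<lambda>(q, w). q_deriv r a i j q w / (w - z))" for a
      unfolding split_beta using R ne
      by (intro continuous_on_divide continuous_on_q_deriv[OF U] continuous_intros) auto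
  qed (use R in auto)
  then have "((\<lambda>q. \<Omega> $ i $ j / z + regular_part q i j z) has_derivative (\<lambda>a. q_deriv_part q a i j z)) (at q)"
    unfolding regular_part_def q_deriv_part_def by (auto intro!: derivative_eq_intros)
  then have "((\<lambda>q. r q z $ i $ j) has_derivative (\<lambda>a. q_deriv_part q a i j z)) (at q)"
    by (rule has_derivative_transform_within_open[OF _ open_U[OF U] q]) (simp add: r_simple_pole[OF _ z])
  moreover have "((\<lambda>q. r q z $ i $ j) has_derivative (\<lambda>a. q_deriv r a i j q z)) (at q)"
    by (intro has_derivative_q_deriv regular[OF U]) (use q z R in auto)
  ultimately have "(\<lambda>a. q_deriv r a i j q z) = (\<lambda>a. q_deriv_part q a i j z)"
    by (rule has_derivative_unique[rotated])
  then show ?thesis by (rule fun_cong)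
qed

end
end

section \<open>Loops\<close>

definition loop_eval :: "complex fls^'n \<Rightarrow> complex \<Rightarrow> complex^'n" where
  "loop_eval X z = (\<chi> i. eval_fls (X $ i) z)"

text \<open>The inequality is strict so that evaluation is valid on the closed punctured disc of
  radius \<delta>, boundary circle included. A common radius for all coordinates lets one bound
  serve every operation.\<close>

definition loop_radius :: "complex fls^'n \<Rightarrow> real \<Rightarrow> bool" where
  "loop_radius X \<delta> \<longleftrightarrow> 0 < \<delta> \<and> (\<forall>i. ereal \<delta> < fls_conv_radius (X $ i))"

lemma loop_eval_nth [simp]: "loop_eval X z $ i = eval_fls (X $ i) z"
  by (simp add: loop_eval_def)

lemma loop_radius_mono: "loop_radius X \<delta> \<Longrightarrow> 0 < \<delta>' \<Longrightarrow> \<delta>' \<le> \<delta> \<Longrightarrow> loop_radius X \<delta>'"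
  unfolding loop_radius_def by (meson ereal_less_eq(3) le_less_trans)

lemma loop_radius_imp_loop_space: "loop_radius X \<delta> \<Longrightarrow> X \<in> loop_space"
  unfolding loop_radius_def loop_space_def by (auto intro: less_trans[of 0 "ereal \<delta>"])

lemma loop_radius_eventually:
  assumes "X \<in> loop_space" shows "\<forall>\<^sub>F \<delta> in at_right 0. loop_radius X \<delta>"
proof -
  have "\<forall>\<^sub>F \<delta> in at_right 0. ereal \<delta> < fls_conv_radius (X $ i)" for i
  proof -
    have "0 < fls_conv_radius (X $ i)" using assms by (auto simp: loop_space_def)
    then obtain e where e: "0 < ereal e" "ereal e < fls_conv_radius (X $ i)"
      using ereal_dense2 by blast
    then have "\<forall>\<^sub>F \<delta> in at_right 0. \<delta> \<in> {0<..<e}" by (intro eventually_at_right_real) auto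
    then show ?thesis
      by eventually_elim (rule less_trans[OF _ e(2)], simp)
  qed
  then have "\<forall>\<^sub>F \<delta> in at_right 0. \<forall>i\<in>UNIV. ereal \<delta> < fls_conv_radius (X $ i)"
    by (intro eventually_ball_finite) auto
  moreover have "\<forall>\<^sub>F \<delta> in at_right (0::real). 0 < \<delta>"
    by (rule eventually_at_right_less)
  ultimately show ?thesis
    by eventually_elim (simp add: loop_radius_def)
qed

lemma loop_spaceE:
  assumes "X \<in> loop_space" "B > 0"
  obtains \<delta> where "loop_radius X \<delta>" "\<delta> \<le> B"
proof -
  have "\<forall>\<^sub>F \<delta> in at_right 0. loop_radius X \<delta> \<and> \<delta> \<in> {0<..<B}"
    using loop_radius_eventually[OF assms(1)] eventually_at_right_real[OF assms(2)] by (rule eventually_conj)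
  then show ?thesis
    using that eventually_happens[of _ "at_right (0::real)"] by force
qed

context
  fixes X :: "complex fls^'n" and \<delta> assumes X: "loop_radius X \<delta>"
begin

lemma radius_pos: "0 < \<delta>"
  using X by (simp add: loop_radius_def)

lemma conv_radius: "norm (z :: complex) \<le> \<delta> \<Longrightarrow> ereal (norm z) < fls_conv_radius (X $ i)"
  using X unfolding loop_radius_def by (meson ereal_less_eq(3) le_less_trans)

lemma holomorphic_loop: "eval_fls (X $ i) holomorphic_on ball 0 \<delta> - {0}"
  by (rule holomorphic_on_eval_fls) (use conv_radius in \<open>auto simp: in_eball_iff less_imp_le\<close>)

lemma continuous_on_loop:
  "continuous_on S f \<Longrightarrow> (\<And>x. x \<in> S \<Longrightarrow> f x \<in> ball 0 \<delta> - {0}) \<Longrightarrow> continuous_on S (\<lambda>x. eval_fls (X $ i) (f x))"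
  by (rule continuous_on_compose2[OF holomorphic_on_imp_continuous_on[OF holomorphic_loop]]) auto

end

context
  fixes X Y :: "complex fls^'n" and \<delta> assumes X: "loop_radius X \<delta>" and Y: "loop_radius Y \<delta>"
begin

lemma loop_radius_add: "loop_radius (X + Y) \<delta>" and loop_radius_diff: "loop_radius (X - Y) \<delta>"
proof -
  have "ereal \<delta> < fls_conv_radius (X $ i + Y $ i)" "ereal \<delta> < fls_conv_radius (X $ i - Y $ i)" for i
    using X Y fls_conv_radius_add[of "X $ i" "Y $ i"] fls_conv_radius_diff[of "X $ i" "Y $ i"]
    unfolding loop_radius_def by (auto simp: min_def intro: less_le_trans split: if_splits)
  then show "loop_radius (X + Y) \<delta>" "loop_radius (X - Y) \<delta>"
    using X unfolding loop_radius_def by auto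
qed

lemma
  assumes "z \<noteq> 0" "norm z \<le> \<delta>"
  shows loop_eval_add: "loop_eval (X + Y) z = loop_eval X z + loop_eval Y z"
    and loop_eval_diff: "loop_eval (X - Y) z = loop_eval X z - loop_eval Y z"
  using assms conv_radius[OF X assms(2)] conv_radius[OF Y assms(2)]
  by (simp_all add: vec_eq_iff eval_fls_add eval_fls_diff)

end

lemma fls_conv_radius_sum:
  fixes f :: "'a \<Rightarrow> complex fls"
  assumes "\<And>i. i \<in> A \<Longrightarrow> ereal a < fls_conv_radius (f i)"
  shows "ereal a < fls_conv_radius (\<Sum>i\<in>A. f i)"
  using assms
proof (induction A rule: infinite_finite_induct)
  case (insert x A)
  then have "ereal a < min (fls_conv_radius (f x)) (fls_conv_radius (\<Sum>i\<in>A. f i))" by simp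
  also note fls_conv_radius_add
  finally show ?case using insert.hyps by simp
qed auto

lemma eval_fls_sum:
  fixes f :: "'a \<Rightarrow> complex fls"
  assumes "\<And>i. i \<in> A \<Longrightarrow> ereal (norm z) < fls_conv_radius (f i)" "z \<noteq> 0"
  shows "eval_fls (\<Sum>i\<in>A. f i) z = (\<Sum>i\<in>A. eval_fls (f i) z)"
  using assms(1)
proof (induction A rule: infinite_finite_induct)
  case (insert x A)
  then show ?case
    using fls_conv_radius_sum[of A "norm z" f] assms(2) by (simp add: eval_fls_add)
qed auto

lemma fls_conv_radius_mult_less:
  "ereal a < fls_conv_radius F \<Longrightarrow> ereal a < fls_conv_radius G \<Longrightarrow> ereal a < fls_conv_radius (F * G)"
  using fls_conv_radius_mult[of F G] by (auto simp: min_def intro: less_le_trans split: if_splits)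

lemma fls_conv_radius_cmult:
  "ereal a < fls_conv_radius F \<Longrightarrow> ereal a < fls_conv_radius (fls_const c * F)"
  by (simp add: fls_conv_radius_mult_less)

lemma loop_radius_map: "loop_radius X \<delta> \<Longrightarrow> loop_radius (loop_map A X) \<delta>"
  unfolding loop_radius_def loop_map_def matrix_vector_mult_def map_matrix_def
  by (auto intro!: fls_conv_radius_sum fls_conv_radius_cmult)

lemma loop_eval_map:
  assumes X: "loop_radius X \<delta>" and z: "z \<noteq> 0" "norm z \<le> \<delta>"
  shows "loop_eval (loop_map A X) z = A *v loop_eval X z"
  using z conv_radius[OF X z(2)]
  by (simp add: vec_eq_iff loop_map_def matrix_vector_mult_def map_matrix_def
      eval_fls_sum eval_fls_mult fls_conv_radius_cmult)

context complex_lie_algebra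
begin

lemma loop_radius_bracket:
  assumes "loop_radius X \<delta>" "loop_radius Y \<delta>" shows "loop_radius (loop_bracket br X Y) \<delta>"
  using assms unfolding loop_radius_def loop_bracket_def
  by (auto intro!: fls_conv_radius_sum fls_conv_radius_mult_less)

lemma loop_eval_bracket:
  assumes X: "loop_radius X \<delta>" and Y: "loop_radius Y \<delta>" and z: "z \<noteq> 0" "norm z \<le> \<delta>"
  shows "loop_eval (loop_bracket br X Y) z = br (loop_eval X z) (loop_eval Y z)"
proof -
  have "loop_eval (loop_bracket br X Y) z $ k = br (loop_eval X z) (loop_eval Y z) $ k" for k
    unfolding bracket_component[of "loop_eval X z"] loop_bracket_def using z conv_radius[OF X z(2)] conv_radius[OF Y z(2)]
    by (simp add: eval_fls_sum eval_fls_mult fls_conv_radius_sum fls_conv_radius_mult_less)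
  then show ?thesis by (simp add: vec_eq_iff)
qed

end

lemma loop_radius_scale: "loop_radius X \<delta> \<Longrightarrow> loop_radius (fls_const c *s X) \<delta>"
  by (simp add: loop_radius_def fls_conv_radius_cmult)

lemma loop_eval_scale:
  "loop_radius X \<delta> \<Longrightarrow> z \<noteq> 0 \<Longrightarrow> norm z \<le> \<delta> \<Longrightarrow> loop_eval (fls_const c *s X) z = c *s loop_eval X z"
  using conv_radius[of X \<delta> z] by (auto simp: vec_eq_iff eval_fls_mult)

lemma loop_radius_const: "0 < \<delta> \<Longrightarrow> loop_radius (const_loop x) \<delta>"
  and loop_eval_const [simp]: "loop_eval (const_loop x) z = x"
  by (simp_all add: loop_radius_def const_loop_def vec_eq_iff)

text \<open>Uniqueness of Laurent expansions reduces every identity between loops to pointwise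
  equality at small z.\<close>

lemma loop_eqI:
  assumes "X \<in> loop_space" "Y \<in> loop_space" "\<forall>\<^sub>F z in at 0. loop_eval X z = loop_eval Y z"
  shows "X = Y"
proof -
  have "X $ i = Y $ i" for i
  proof (rule has_laurent_expansion_unique)
    show "eval_fls (X $ i) has_laurent_expansion X $ i"
      using assms(1) by (intro eval_fls_has_laurent_expansion) (simp add: loop_space_def)
    show "eval_fls (X $ i) has_laurent_expansion Y $ i"
      unfolding has_laurent_expansion_def using assms(2,3)
      by (auto simp: loop_space_def elim!: eventually_mono) (metis loop_eval_nth)
  qed
  then show ?thesis by (simp add: vec_eq_iff)
qed

lemma eventually_small_nonzero:
  fixes \<delta> :: real
  assumes "0 < \<delta>" shows "\<forall>\<^sub>F z in at (0::complex). 0 < norm z \<and> norm z < \<delta>"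
  using assms unfolding eventually_at by (intro exI[of _ \<delta>]) auto

lemma loop_eqI':
  assumes "loop_radius X \<delta>" "loop_radius Y \<delta>"
    and "\<And>z. 0 < norm z \<Longrightarrow> norm z < \<delta> \<Longrightarrow> loop_eval X z = loop_eval Y z"
  shows "X = Y"
  using loop_radius_imp_loop_space[OF assms(1)] loop_radius_imp_loop_space[OF assms(2)]
    eventually_mono[OF eventually_small_nonzero[OF radius_pos[OF assms(1)]]] assms(3)
  by (intro loop_eqI) auto

lemma loop_pairing_circ_int:
  assumes X: "loop_radius X \<delta>" and Y: "loop_radius Y \<delta>" and \<rho>: "0 < \<rho>" "\<rho> < \<delta>"
  shows "loop_pairing X Y = circ_int \<rho> (\<lambda>z. \<Sum>i\<in>UNIV. eval_fls (X $ i) z * eval_fls (Y $ i) z)"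
  unfolding loop_pairing_def
  by (rule circ_int_residue[symmetric, OF _ \<rho>])
     (intro holomorphic_on_sum holomorphic_on_mult holomorphic_loop X Y)

text \<open>Taylor series read as Laurent series without polar part. Shrinking \<delta> to \<delta>'
  buys the strict inequality in \<open>loop_radius\<close>.\<close>

lemma holomorphic_loop_extend:
  assumes "\<And>i. f i holomorphic_on ball 0 \<delta>" "0 < \<delta>'" "\<delta>' < \<delta>"
  obtains X :: "complex fls^'n" where "loop_radius X \<delta>'" "\<And>z i. norm z \<le> \<delta>' \<Longrightarrow> eval_fls (X $ i) z = f i z"
proof -
  define X :: "complex fls^'n" where "X = (\<chi> i. fps_to_fls (fps_expansion (f i) 0))"
  have exp: "f i has_fps_expansion fps_expansion (f i) 0" for i
    by (rule has_fps_expansion_fps_expansion[OF _ _ assms(1)]) (use assms in auto)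
  have "ereal \<delta> \<le> fps_conv_radius (fps_expansion (f i) 0)" for i
    by (rule holomorphic_on_imp_fps_conv_radius_ge[OF exp]) (use assms(1) in simp)
  then have conv: "ereal \<delta>' < fps_conv_radius (fps_expansion (f i) 0)" for i
    using assms(3) by (meson ereal_less(2) less_ereal.simps(1) less_le_trans)
  have "loop_radius X \<delta>'"
    using conv assms(2) by (simp add: loop_radius_def X_def)
  moreover have "eval_fls (X $ i) z = f i z" if "norm z \<le> \<delta>'" for z i
  proof -
    have "eval_fps (fps_expansion (f i) 0) z = f i z"
      by (rule has_fps_expansion_imp_eval_fps_eq[OF exp _ assms(1)]) (use that assms in auto)
    moreover have "ereal (norm z) < fps_conv_radius (fps_expansion (f i) 0)"
      using conv[of i] that by (meson ereal_less_eq(3) le_less_trans)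
    ultimately show ?thesis by (simp add: X_def eval_fps_to_fls)
  qed
  ultimately show ?thesis using that by blast
qed

lemma has_pv_integral_unique:
  assumes "has_pv_integral f z c" "has_pv_integral f z c'" shows "c = c'"
proof -
  obtain J J' where J: "\<forall>\<^sub>F \<epsilon> in at_right 0.
        (f has_contour_integral J \<epsilon>) (part_circlepath 0 (norm z) (Arg z + \<epsilon>) (Arg z + 2 * pi - \<epsilon>))"
      "(J \<longlongrightarrow> c) (at_right 0)" "\<forall>\<^sub>F \<epsilon> in at_right 0.
        (f has_contour_integral J' \<epsilon>) (part_circlepath 0 (norm z) (Arg z + \<epsilon>) (Arg z + 2 * pi - \<epsilon>))"
      "(J' \<longlongrightarrow> c') (at_right 0)"
    using assms unfolding has_pv_integral_def by blast
  have "\<forall>\<^sub>F \<epsilon> in at_right 0. J \<epsilon> = J' \<epsilon>"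
    using J(1,3) by eventually_elim (metis contour_integral_unique)
  then have "(J' \<longlongrightarrow> c) (at_right 0)" by (rule Lim_transform_eventually[OF J(2)])
  then show ?thesis using J(4) tendsto_unique trivial_limit_at_right_real by blast
qed

lemma has_pv_integral_add:
  assumes "has_pv_integral f z c" "has_pv_integral g z d"
  shows "has_pv_integral (\<lambda>w. f w + g w) z (c + d)"
proof -
  obtain J J' where J: "\<forall>\<^sub>F \<epsilon> in at_right 0.
        (f has_contour_integral J \<epsilon>) (part_circlepath 0 (norm z) (Arg z + \<epsilon>) (Arg z + 2 * pi - \<epsilon>))"
      "(J \<longlongrightarrow> c) (at_right 0)" "\<forall>\<^sub>F \<epsilon> in at_right 0.
        (g has_contour_integral J' \<epsilon>) (part_circlepath 0 (norm z) (Arg z + \<epsilon>) (Arg z + 2 * pi - \<epsilon>))"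
      "(J' \<longlongrightarrow> d) (at_right 0)"
    using assms unfolding has_pv_integral_def by blast
  have "\<forall>\<^sub>F \<epsilon> in at_right 0. ((\<lambda>w. f w + g w) has_contour_integral J \<epsilon> + J' \<epsilon>)
      (part_circlepath 0 (norm z) (Arg z + \<epsilon>) (Arg z + 2 * pi - \<epsilon>))"
    using J(1,3) by eventually_elim (rule has_contour_integral_add)
  then show ?thesis
    unfolding has_pv_integral_def using tendsto_add[OF J(2,4)] by (intro exI[of _ "\<lambda>\<epsilon>. J \<epsilon> + J' \<epsilon>"]) simp
qed

lemma has_pv_integral_sum:
  assumes "finite A" "\<And>i. i \<in> A \<Longrightarrow> has_pv_integral (f i) z (c i)"
  shows "has_pv_integral (\<lambda>w. \<Sum>i\<in>A. f i w) z (\<Sum>i\<in>A. c i)"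
  using assms
proof (induction A)
  case empty
  show ?case unfolding has_pv_integral_def by (auto intro!: exI[of _ "\<lambda>_. 0"] always_eventually has_contour_integral_0)
next
  case (insert x A)
  then show ?case by (simp add: has_pv_integral_add)
qed

section \<open>The operator R\<close>

text \<open>For |z| < \<rho> = |w| the difference w - z is nonzero and shorter than 2 \<rho>; this
  explains the radius in the hypothesis.\<close>

lemma holomorphic_circ_int_translate:
  assumes f: "f holomorphic_on ball 0 (2 * \<rho>) - {0}" and g: "continuous_on (sphere 0 \<rho>) g" and \<rho>: "0 < \<rho>"
  shows "(\<lambda>z. circ_int \<rho> (\<lambda>w. f (w - z) * g w)) holomorphic_on ball 0 \<rho>"
proof -
  have mem: "w - z \<in> ball 0 (2 * \<rho>) - {0}" if "z \<in> ball 0 \<rho>" "norm w = \<rho>" for w z :: complex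
    using norm_triangle_ineq4[of w z] that by auto
  have "open (ball 0 (2 * \<rho>) - {0 :: complex})" by auto
  note df = holomorphic_derivI[OF f this, where T = UNIV]
  have contf: "continuous_on (ball 0 (2 * \<rho>) - {0}) f" "continuous_on (ball 0 (2 * \<rho>) - {0}) (deriv f)"
    using f by (auto intro!: holomorphic_on_imp_continuous_on holomorphic_deriv)
  have "((\<lambda>z. circ_int \<rho> (\<lambda>w. f (w - z) * g w)) has_field_derivative
      circ_int \<rho> (\<lambda>w. - deriv f (w - z) * g w)) (at z)" if z: "z \<in> ball 0 \<rho>" for z
  proof (rule circ_int_has_field_derivative[OF open_ball z])
    show "((\<lambda>z. f (w - z) * g w) has_field_derivative - deriv f (w - z) * g w) (at z)"
      if "z \<in> ball 0 \<rho>" "norm w = \<rho>" for z w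
    proof -
      have "((\<lambda>z. f (w - z)) has_field_derivative deriv f (w - z) * (0 - 1)) (at z)"
        by (rule DERIV_chain2[where g = "\<lambda>z. w - z", OF df[OF mem[OF that]]]) (intro derivative_intros)
      from DERIV_cmult_right[OF this, of "g w"] show ?thesis by simp
    qed
    show "continuous_on (sphere 0 \<rho>) (\<lambda>w. f (w - z) * g w)" if "z \<in> ball 0 \<rho>" for z
      using mem[OF that] by (intro continuous_on_mult g continuous_on_compose2[OF contf(1)] continuous_intros) auto
    have "continuous_on (ball 0 \<rho> \<times> sphere 0 \<rho>) (\<lambda>x. g (snd x))"
      by (rule continuous_on_compose2[OF g]) (auto intro!: continuous_intros)
    moreover have "continuous_on (ball 0 \<rho> \<times> sphere 0 \<rho>) (\<lambda>x. deriv f (snd x - fst x))"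
      by (rule continuous_on_compose2[OF contf(2)]) (use mem in \<open>auto intro!: continuous_intros\<close>)
    ultimately show "continuous_on (ball 0 \<rho> \<times> sphere 0 \<rho>) (\<lambda>(z, w). - deriv f (w - z) * g w)"
      unfolding split_beta by (intro continuous_on_mult continuous_on_minus)
  qed (use \<rho> in auto)
  then show ?thesis
    unfolding holomorphic_on_open[OF open_ball] by blast
qed

text \<open>Principal values are unique, so two candidates agree at all small z and hence as series;
  this makes the description in \<open>R_op\<close> definite.\<close>

lemma is_R_unique:
  fixes r :: "complex^'l::finite \<Rightarrow> complex \<Rightarrow> complex^'n^'n"
  assumes "is_R r q \<xi> X" "is_R r q \<xi> Y" shows "X = Y"
proof (rule loop_eqI)
  show "X \<in> loop_space" "Y \<in> loop_space" using assms by (auto simp: is_R_def)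
  have "\<forall>\<^sub>F z in at 0. (\<forall>j. has_pv_integral (\<lambda>w. \<Sum>i\<in>UNIV. r q (w - z) $ i $ j * eval_fls (\<xi> $ i) w) z
          (2 * pi * \<i> * eval_fls (X $ j) z)) \<and>
      (\<forall>j. has_pv_integral (\<lambda>w. \<Sum>i\<in>UNIV. r q (w - z) $ i $ j * eval_fls (\<xi> $ i) w) z
          (2 * pi * \<i> * eval_fls (Y $ j) z))"
    using assms by (auto simp: is_R_def intro: eventually_conj)
  then show "\<forall>\<^sub>F z in at 0. loop_eval X z = loop_eval Y z"
  proof eventually_elim
    case (elim z)
    then have "2 * pi * \<i> * eval_fls (X $ j) z = 2 * pi * \<i> * eval_fls (Y $ j) z" for j
      by (blast intro: has_pv_integral_unique)
    then show ?case by (simp add: vec_eq_iff)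
  qed
qed

section \<open>The jump of the kernel integral across the circle through z\<close>

context dynamical_setup
begin

text \<open>\<open>R\<close> pairs with the first leg of \<open>r\<close>, so the residue acts
  through the transpose of \<Omega>; symmetry of \<Omega> identifies this with the map
  \<open>I\<close>.\<close>

lemma casimir_mult_component: "(\<Omega> *v x) $ j = (\<Sum>i\<in>UNIV. \<Omega> $ i $ j * x $ i)"
proof -
  have "\<Omega> $ j $ i = \<Omega> $ i $ j" for i
    using arg_cong[OF casimir_sym, of "\<lambda>A. A $ i $ j"] by (simp add: transpose_def)
  then show ?thesis by (simp add: matrix_vector_mult_def)
qed

text \<open>The integrand of \<open>R\<close> over a circle that need not pass through z. For small
  radii the value depends only on the side of the circle on which z lies.\<close>

definition R_kernel :: "complex^'l \<Rightarrow> complex fls^'n \<Rightarrow> real \<Rightarrow> complex \<Rightarrow> complex^'n" where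
  "R_kernel q \<xi> \<rho> z = (\<chi> j. circ_int \<rho> (\<lambda>w. \<Sum>i\<in>UNIV. r q (w - z) $ i $ j * eval_fls (\<xi> $ i) w))"

context
  fixes U R assumes U: "regular_on U R"
begin

text \<open>A single component of the integrand of \<open>R\<close>, as a function with poles at \<open>0\<close> and \<open>z\<close>.\<close>

context
  fixes q :: "complex^'l" and x :: "complex \<Rightarrow> complex" and z :: complex and i j :: 'n and d :: real
  assumes q: "q \<in> U" and x: "x holomorphic_on ball 0 d - {0}" and d: "d \<le> R / 4"
    and z: "0 < norm z" "norm z < d"
begin

text \<open>The integrand times w - z, continued across w = z. The bound d \<le> R / 4 keeps |w - z|
  below R / 2, where the simple pole decomposition holds.\<close>

definition kernel_numerator :: "complex \<Rightarrow> complex" where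
  "kernel_numerator w = x w * (\<Omega> $ i $ j + (w - z) * regular_part R q i j (w - z))"

lemma kernel_numerator_at [simp]: "kernel_numerator z = \<Omega> $ i $ j * x z"
  by (simp add: kernel_numerator_def)

lemma kernel_small: "norm w < d \<Longrightarrow> norm (w - z) < R / 2"
  using norm_triangle_ineq4[of w z] z d by simp

lemma holomorphic_kernel_numerator: "kernel_numerator holomorphic_on ball 0 d - {0}"
proof -
  have "(\<lambda>w. regular_part R q i j (w - z)) holomorphic_on ball 0 d - {0}"
    by (rule holomorphic_on_compose_gen[OF _ holomorphic_regular_part[OF U q], of "\<lambda>w. w - z", unfolded o_def])
       (use kernel_small in \<open>auto intro!: holomorphic_intros\<close>)
  then show ?thesis
    unfolding kernel_numerator_def by (intro holomorphic_intros x)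
qed

lemma kernel_eq:
  assumes "w \<noteq> z" "norm w < d" shows "r q (w - z) $ i $ j * x w = kernel_numerator w / (w - z)"
proof -
  have "(\<Omega> $ i $ j + (w - z) * c) / (w - z) = \<Omega> $ i $ j / (w - z) + c" for c
    using assms(1) by (simp add: add_divide_distrib)
  then show ?thesis
    using r_simple_pole[OF U q, of "w - z" i j] kernel_small[OF assms(2)] assms(1)
    by (simp only: kernel_numerator_def times_divide_eq_right[symmetric]) simp
qed

lemma kernel_has_pv_integral:
  "has_pv_integral (\<lambda>w. r q (w - z) $ i $ j * x w) z
     (2 * pi * \<i> * (residue (\<lambda>w. r q (w - z) $ i $ j * x w) 0 + \<Omega> $ i $ j * x z / 2))"
proof -
  have "residue (\<lambda>w. r q (w - z) $ i $ j * x w) 0 = residue (\<lambda>w. kernel_numerator w / (w - z)) 0"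
    by (rule residue_cong[OF eventually_mono[OF eventually_small_nonzero[OF z(1)]]])
       (auto intro!: kernel_eq less_trans[OF _ z(2)])
  then show ?thesis
    using has_pv_integral_cauchy_kernel[OF holomorphic_kernel_numerator z kernel_eq] z kernel_numerator_at by (simp add: mult_ac)
qed

lemma kernel_inner_circle:
  assumes "0 < \<rho>" "\<rho> < norm z"
  shows "circ_int \<rho> (\<lambda>w. r q (w - z) $ i $ j * x w) = residue (\<lambda>w. r q (w - z) $ i $ j * x w) 0"
proof (rule circ_int_residue[OF _ assms])
  have "(\<lambda>w. kernel_numerator w / (w - z)) holomorphic_on ball 0 (norm z) - {0}"
    by (intro holomorphic_intros holomorphic_on_subset[OF holomorphic_kernel_numerator]) (use z in auto)
  then show "(\<lambda>w. r q (w - z) $ i $ j * x w) holomorphic_on ball 0 (norm z) - {0}"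
    by (rule holomorphic_transform) (auto intro!: kernel_eq[symmetric] less_trans[OF _ z(2)])
qed

text \<open>Compared with the inner circle one more pole is enclosed, at w = z, and its residue is
  the numerator there.\<close>

lemma kernel_outer_circle:
  assumes "norm z < \<rho>" "\<rho> < d"
  shows "circ_int \<rho> (\<lambda>w. r q (w - z) $ i $ j * x w)
    = residue (\<lambda>w. r q (w - z) $ i $ j * x w) 0 + \<Omega> $ i $ j * x z"
proof -
  let ?G = "\<lambda>w. r q (w - z) $ i $ j * x w"
  have "(\<lambda>w. kernel_numerator w / (w - z)) holomorphic_on ball 0 d - {0, z}"
    by (intro holomorphic_intros holomorphic_on_subset[OF holomorphic_kernel_numerator]) auto
  then have "?G holomorphic_on ball 0 d - {0, z}"
    by (rule holomorphic_transform) (use kernel_eq in auto)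
  from circ_int_residues[OF this, of \<rho>] have "circ_int \<rho> ?G = residue ?G 0 + residue ?G z"
    using z assms order.strict_trans1[OF norm_ge_zero assms(1)] by auto
  also have "residue ?G z = residue (\<lambda>w. kernel_numerator w / (w - z)) z"
  proof (rule residue_cong[OF _ refl])
    show "\<forall>\<^sub>F w in at z. ?G w = kernel_numerator w / (w - z)"
      unfolding eventually_at
    proof (intro exI[of _ "d - norm z"] conjI ballI impI)
      fix w assume "w \<noteq> z \<and> dist w z < d - norm z"
      then show "?G w = kernel_numerator w / (w - z)"
        using norm_triangle_ineq2[of w z] by (intro kernel_eq) (auto simp: dist_norm)
    qed (use z in auto)
  qed
  also have "\<dots> = kernel_numerator z"
    by (rule residue_simple[of "ball 0 d - {0}"]) (use holomorphic_kernel_numerator z in auto)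
  finally show ?thesis using kernel_numerator_at by simp
qed

end

lemma R_kernel_summand_continuous:
  assumes q: "q \<in> U" and \<xi>: "loop_radius \<xi> d" "d \<le> R / 4"
    and z: "0 < \<rho>" "\<rho> < d" "norm z < d" "norm z \<noteq> \<rho>"
  shows "continuous_on (sphere 0 \<rho>) (\<lambda>w. r q (w - z) $ i $ j * eval_fls (\<xi> $ i) w)"
proof -
  have "0 < norm (w - z) \<and> norm (w - z) < R" if "norm w = \<rho>" for w
    using norm_triangle_ineq4[of w z] that z \<xi>(2) R_pos[OF U] by auto
  then show ?thesis
    using z q by (intro continuous_on_mult continuous_on_r[OF U] continuous_on_loop[OF \<xi>(1)] continuous_intros) auto
qed

lemma R_kernel_component:
  assumes q: "q \<in> U" and \<xi>: "loop_radius \<xi> d" "d \<le> R / 4"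
    and z: "0 < \<rho>" "\<rho> < d" "norm z < d" "norm z \<noteq> \<rho>"
  shows "R_kernel q \<xi> \<rho> z $ j = (\<Sum>i\<in>UNIV. circ_int \<rho> (\<lambda>w. r q (w - z) $ i $ j * eval_fls (\<xi> $ i) w))"
  unfolding R_kernel_def using z R_kernel_summand_continuous[OF assms]
  by (simp add: circ_int_sum)

text \<open>Inner circle, principal value and outer circle share the residue at w = 0. They add 0,
  1/2 and 1 times the residue at w = z, which after summation over the first leg is I \<xi> at
  z.\<close>

lemma
  assumes q: "q \<in> U" and \<xi>: "loop_radius \<xi> d" "d \<le> R / 4"
    and \<rho>: "0 < norm z" "norm z < \<rho>" "\<rho> < d"
  shows R_kernel_inner: "0 < \<rho>' \<Longrightarrow> \<rho>' < norm z \<Longrightarrow>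
      R_kernel q \<xi> \<rho>' z = R_kernel q \<xi> \<rho> z - \<Omega> *v loop_eval \<xi> z"
    and R_kernel_pv: "has_pv_integral (\<lambda>w. \<Sum>i\<in>UNIV. r q (w - z) $ i $ j * eval_fls (\<xi> $ i) w) z
      (2 * pi * \<i> * (R_kernel q \<xi> \<rho> z $ j - (\<Omega> *v loop_eval \<xi> z) $ j / 2))"
proof -
  have z: "norm z < d" "0 < \<rho>" using \<rho> by linarith+
  note h = holomorphic_loop[OF \<xi>(1)]
  let ?res = "\<lambda>i j. residue (\<lambda>w. r q (w - z) $ i $ j * eval_fls (\<xi> $ i) w) 0"
  have outer: "R_kernel q \<xi> \<rho> z $ j = (\<Sum>i\<in>UNIV. ?res i j) + (\<Omega> *v loop_eval \<xi> z) $ j" for j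
    using \<rho> z by (subst R_kernel_component[OF q \<xi>])
      (auto simp: kernel_outer_circle[OF q h \<xi>(2) \<rho>(1) z(1) \<rho>(2,3)] sum.distrib casimir_mult_component)
  have "R_kernel q \<xi> \<rho>' z $ j = (\<Sum>i\<in>UNIV. ?res i j)" if "0 < \<rho>'" "\<rho>' < norm z" for j \<rho>'
    using that z by (subst R_kernel_component[OF q \<xi>])
      (auto simp: kernel_inner_circle[OF q h \<xi>(2) \<rho>(1) z(1) that])
  with outer show "R_kernel q \<xi> \<rho>' z = R_kernel q \<xi> \<rho> z - \<Omega> *v loop_eval \<xi> z"
    if "0 < \<rho>'" "\<rho>' < norm z" using that by (simp add: vec_eq_iff)
  have "has_pv_integral (\<lambda>w. \<Sum>i\<in>UNIV. r q (w - z) $ i $ j * eval_fls (\<xi> $ i) w) z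
      (\<Sum>i\<in>UNIV. 2 * pi * \<i> * (?res i j + \<Omega> $ i $ j * eval_fls (\<xi> $ i) z / 2))"
    by (intro has_pv_integral_sum kernel_has_pv_integral[OF q h \<xi>(2) \<rho>(1) z(1)]) auto
  also have "(\<Sum>i\<in>UNIV. 2 * pi * \<i> * (?res i j + \<Omega> $ i $ j * eval_fls (\<xi> $ i) z / 2))
      = 2 * pi * \<i> * (R_kernel q \<xi> \<rho> z $ j - (\<Omega> *v loop_eval \<xi> z) $ j / 2)"
    by (simp add: outer casimir_mult_component sum.distrib flip: sum_distrib_left sum_divide_distrib)
  finally show "has_pv_integral (\<lambda>w. \<Sum>i\<in>UNIV. r q (w - z) $ i $ j * eval_fls (\<xi> $ i) w) z
      (2 * pi * \<i> * (R_kernel q \<xi> \<rho> z $ j - (\<Omega> *v loop_eval \<xi> z) $ j / 2))" .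
qed

lemma holomorphic_R_kernel:
  assumes q: "q \<in> U" and \<xi>: "loop_radius \<xi> d" "d \<le> R / 4" and \<rho>: "0 < \<rho>" "\<rho> < d"
  shows "(\<lambda>z. R_kernel q \<xi> \<rho> z $ j) holomorphic_on ball 0 \<rho>"
proof (rule holomorphic_transform)
  show "(\<lambda>z. \<Sum>i\<in>UNIV. circ_int \<rho> (\<lambda>w. r q (w - z) $ i $ j * eval_fls (\<xi> $ i) w)) holomorphic_on ball 0 \<rho>"
    by (intro holomorphic_on_sum holomorphic_circ_int_translate continuous_on_loop[OF \<xi>(1)] \<rho> continuous_intros
        holomorphic_on_subset[OF holomorphic_r[OF U q]]) (use \<rho> \<xi>(2) in auto)
qed (use \<rho> \<xi> q in \<open>auto simp: R_kernel_component[OF q \<xi>]\<close>)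

context
  fixes q :: "complex^'l" and \<xi> :: "complex fls^'n" and d :: real
  assumes q: "q \<in> U" and \<xi>: "loop_radius \<xi> d" "d \<le> R / 4"
begin

text \<open>Each \<sigma> yields a series satisfying \<open>is_R\<close>. By uniqueness all of them
  are \<open>R_op r q \<xi>\<close>, so the formula holds for every \<sigma> at once.\<close>

lemma R_op_exists:
  assumes "0 < \<rho>" "\<rho> < d"
  shows "is_R r q \<xi> (R_op r q \<xi>) \<and> loop_radius (R_op r q \<xi>) \<rho> \<and>
    (\<forall>z. 0 < norm z \<and> norm z \<le> \<rho> \<longrightarrow> 
      (\<forall>\<sigma>. \<rho> < \<sigma> \<and> \<sigma> < d \<longrightarrow> loop_eval (R_op r q \<xi>) z = R_kernel q \<xi> \<sigma> z - (1 / 2) *s (\<Omega> *v loop_eval \<xi> z)))"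
proof -
  have step: "\<exists>X. is_R r q \<xi> X \<and> loop_radius X \<rho> \<and> (\<forall>z. 0 < norm z \<and> norm z \<le> \<rho> \<longrightarrow> 
      loop_eval X z = R_kernel q \<xi> \<sigma> z - (1 / 2) *s (\<Omega> *v loop_eval \<xi> z))"
    if \<sigma>: "\<rho> < \<sigma>" "\<sigma> < d" for \<sigma>
  proof -
    have "0 < \<sigma>" using \<sigma> assms by simp
    obtain E :: "complex fls^'n" where E: "loop_radius E \<rho>" "\<And>z j. norm z \<le> \<rho> \<Longrightarrow> eval_fls (E $ j) z = R_kernel q \<xi> \<sigma> z $ j"
      using holomorphic_loop_extend[of "\<lambda>j z. R_kernel q \<xi> \<sigma> z $ j" \<sigma> \<rho>]
        holomorphic_R_kernel[OF q \<xi> \<open>0 < \<sigma>\<close> \<sigma>(2)] assms(1) \<sigma>(1) by metis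
    \<comment> \<open>The kernel over the larger circle is holomorphic in z throughout its interior;
      subtracting half the jump gives the principal value.\<close>
    define X where "X = E - fls_const (1 / 2) *s loop_map \<Omega> \<xi>"
    note \<xi>\<rho> = loop_radius_mono[OF \<xi>(1) assms(1) less_imp_le[OF assms(2)]]
    note rad = loop_radius_scale[OF loop_radius_map[OF \<xi>\<rho>]]
    have X: "loop_radius X \<rho>"
      unfolding X_def by (rule loop_radius_diff[OF E(1) rad])
    have eval: "loop_eval X z = R_kernel q \<xi> \<sigma> z - (1 / 2) *s (\<Omega> *v loop_eval \<xi> z)" if "0 < norm z" "norm z \<le> \<rho>" for z
    proof -
      have "loop_eval E z = R_kernel q \<xi> \<sigma> z" using E(2)[OF that(2)] by (simp add: vec_eq_iff)
      then show ?thesis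
        unfolding X_def using that
        by (simp add: loop_eval_diff[OF E(1) rad] loop_eval_scale[OF loop_radius_map[OF \<xi>\<rho>]] loop_eval_map[OF \<xi>\<rho>])
    qed
    have "is_R r q \<xi> X"
      unfolding is_R_def
    proof (intro conjI loop_radius_imp_loop_space[OF X] eventually_mono[OF eventually_small_nonzero[OF assms(1)]] allI)
      fix z :: complex and j assume z: "0 < norm z \<and> norm z < \<rho>"
      have "eval_fls (X $ j) z = R_kernel q \<xi> \<sigma> z $ j - (\<Omega> *v loop_eval \<xi> z) $ j / 2"
        using arg_cong[OF eval[of z], of "\<lambda>v. v $ j"] z by simp
      then show "has_pv_integral (\<lambda>w. \<Sum>i\<in>UNIV. r q (w - z) $ i $ j * eval_fls (\<xi> $ i) w) z
          (2 * pi * \<i> * eval_fls (X $ j) z)"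
        using R_kernel_pv[OF q \<xi>, of z \<sigma> j] z \<sigma> by simp
    qed
    then show ?thesis using X eval by blast
  qed
  have R_op: "R_op r q \<xi> = X" if "is_R r q \<xi> X" for X
    unfolding R_op_def using is_R_unique that by (intro the_equality) auto
  obtain \<sigma> where "\<rho> < \<sigma>" "\<sigma> < d" using assms(2) dense by blast
  with step R_op show ?thesis by metis
qed

lemma is_R_R_op: "is_R r q \<xi> (R_op r q \<xi>)"
  using R_op_exists[of "d / 2"] radius_pos[OF \<xi>(1)] by simp

lemma loop_radius_R_op: "0 < \<rho> \<Longrightarrow> \<rho> < d \<Longrightarrow> loop_radius (R_op r q \<xi>) \<rho>"
  using R_op_exists by blast

lemma R_kernel_outside:
  assumes "0 < norm z" "norm z < \<rho>" "\<rho> < d"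
  shows "R_kernel q \<xi> \<rho> z = loop_eval (R_op r q \<xi>) z + (1 / 2) *s (\<Omega> *v loop_eval \<xi> z)"
  using R_op_exists[of "norm z"] assms by (auto simp: algebra_simps)

lemma R_kernel_inside:
  assumes "0 < \<rho>" "\<rho> < norm z" "norm z < d"
  shows "R_kernel q \<xi> \<rho> z = loop_eval (R_op r q \<xi>) z - (1 / 2) *s (\<Omega> *v loop_eval \<xi> z)"
proof -
  obtain \<sigma> where \<sigma>: "norm z < \<sigma>" "\<sigma> < d" using assms(3) dense by blast
  have z: "0 < norm z" using assms by linarith
  show ?thesis
    using R_kernel_inner[OF q \<xi> z \<sigma> assms(1,2)] R_kernel_outside[OF z \<sigma>]
    by (simp add: vec_eq_iff field_simps)
qed

end

end

end

section \<open>The derivatives of R\<close>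

lemma is_X_deriv_unique:
  assumes "is_X_deriv a F q X" "is_X_deriv a F q Y" shows "X = Y"
proof (rule loop_eqI)
  show "X \<in> loop_space" "Y \<in> loop_space" using assms by (auto simp: is_X_deriv_def)
  have "\<forall>\<^sub>F z in at 0.
      (\<forall>i. ((\<lambda>t. eval_fls (F (q + t *s a) $ i) z) has_field_derivative eval_fls (X $ i) z) (at 0)) \<and>
      (\<forall>i. ((\<lambda>t. eval_fls (F (q + t *s a) $ i) z) has_field_derivative eval_fls (Y $ i) z) (at 0))"
    using assms by (auto simp: is_X_deriv_def intro: eventually_conj)
  then show "\<forall>\<^sub>F z in at 0. loop_eval X z = loop_eval Y z"
    by eventually_elim (auto simp: vec_eq_iff intro: DERIV_unique)
qed

context dynamical_setup
begin

definition D_kernel :: "complex^'l \<Rightarrow> complex fls^'n \<Rightarrow> real \<Rightarrow> complex^'l \<Rightarrow> complex \<Rightarrow> complex^'n" where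
  "D_kernel q \<xi> \<rho> a z = (\<chi> j. circ_int \<rho> (\<lambda>w. \<Sum>i\<in>UNIV. q_deriv r a i j q (w - z) * eval_fls (\<xi> $ i) w))"

context
  fixes U R and \<xi> :: "complex fls^'n" and d :: real
  assumes U: "regular_on U R" and \<xi>: "loop_radius \<xi> d" "d \<le> R / 4"
begin

lemma kernel_range:
  fixes w z :: complex
  assumes "norm w = \<rho>" "\<rho> < d" "norm z < d" "norm z \<noteq> \<rho>"
  shows "0 < norm (w - z) \<and> norm (w - z) < R"
  using norm_triangle_ineq4[of w z] assms \<xi>(2) R_pos[OF U] by auto

lemma continuous_on_D_kernel_integrand:
  assumes \<rho>: "0 < \<rho>" "\<rho> < d" and S: "\<And>z. z \<in> S \<Longrightarrow> norm z < d \<and> norm z \<noteq> \<rho>"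
  shows "continuous_on ((U \<times> S) \<times> sphere 0 \<rho>)
    (\<lambda>(p, w). \<Sum>i\<in>UNIV. q_deriv r a i j (fst p) (w - snd p) * eval_fls (\<xi> $ i) w)"
proof -
  have "0 < norm (w - z) \<and> norm (w - z) < R" if "norm w = \<rho>" "z \<in> S" for w z
    using kernel_range[OF that(1) \<rho>(2)] S[OF that(2)] by blast
  then show ?thesis
    unfolding split_beta using \<rho>
    by (intro continuous_on_sum continuous_on_mult continuous_on_q_deriv[OF U] continuous_on_loop[OF \<xi>(1)] continuous_intros)
       auto
qed

lemma continuous_on_D_kernel:
  assumes "0 < \<rho>" "\<rho> < d" "\<And>z. z \<in> S \<Longrightarrow> norm z < d \<and> norm z \<noteq> \<rho>"
  shows "continuous_on (U \<times> S) (\<lambda>(q, z). D_kernel q \<xi> \<rho> a z $ j)"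
  using continuous_on_circ_int[OF less_imp_le[OF assms(1)] continuous_on_D_kernel_integrand[OF assms]]
  by (simp add: D_kernel_def split_beta)

lemma R_kernel_has_derivative:
  assumes q: "q \<in> U" and \<rho>: "0 < \<rho>" "\<rho> < d" and z: "norm z < d" "norm z \<noteq> \<rho>"
  shows "((\<lambda>q. R_kernel q \<xi> \<rho> z $ j) has_derivative (\<lambda>a. D_kernel q \<xi> \<rho> a z $ j)) (at q)"
  unfolding R_kernel_def D_kernel_def vec_lambda_beta
proof (rule circ_int_has_derivative[OF open_U[OF U] q])
  have range: "0 < norm (w - z) \<and> norm (w - z) < R" if "norm w = \<rho>" for w
    using kernel_range[OF that \<rho>(2) z] by blast
  show "((\<lambda>q. \<Sum>i\<in>UNIV. r q (w - z) $ i $ j * eval_fls (\<xi> $ i) w) has_derivative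
      (\<lambda>a. \<Sum>i\<in>UNIV. q_deriv r a i j q (w - z) * eval_fls (\<xi> $ i) w)) (at q)"
    if "q \<in> U" "norm w = \<rho>" for q w
    using that range
    by (intro has_derivative_sum has_derivative_mult_left has_derivative_q_deriv regular[OF U]) auto
  show "continuous_on (sphere 0 \<rho>) (\<lambda>w. \<Sum>i\<in>UNIV. r q (w - z) $ i $ j * eval_fls (\<xi> $ i) w)" if "q \<in> U" for q
    using z \<rho> by (intro continuous_on_sum R_kernel_summand_continuous[OF U that \<xi>]) auto
  show "continuous_on (U \<times> sphere 0 \<rho>) (\<lambda>(q, w). \<Sum>i\<in>UNIV. q_deriv r a i j q (w - z) * eval_fls (\<xi> $ i) w)" for a
    unfolding split_beta
    by (intro continuous_on_sum continuous_on_mult continuous_on_q_deriv[OF U] continuous_on_loop[OF \<xi>(1)] continuous_intros)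
       (use \<rho> z range in \<open>auto simp del: zero_less_norm_iff\<close>)
qed (use \<rho> in auto)

lemma D_kernel_component:
  assumes q: "q \<in> U" and \<rho>: "0 < \<rho>" "\<rho> < d" and z: "norm z < d" "norm z \<noteq> \<rho>"
  shows "D_kernel q \<xi> \<rho> a z $ j = (\<Sum>i\<in>UNIV. circ_int \<rho> (\<lambda>w. q_deriv r a i j q (w - z) * eval_fls (\<xi> $ i) w))"
proof -
  have "0 < norm (w - z) \<and> norm (w - z) < R" if "norm w = \<rho>" for w
    using kernel_range[OF that \<rho>(2) z] by blast
  then show ?thesis
    unfolding D_kernel_def vec_lambda_beta using \<rho> q
    by (intro circ_int_sum continuous_on_mult continuous_on_q_deriv[OF U]
        continuous_on_loop[OF \<xi>(1)] continuous_intros) auto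
qed

lemma D_kernel_scale:
  assumes q: "q \<in> U" and \<rho>: "0 < \<rho>" "\<rho> < d" and z: "norm z < d" "norm z \<noteq> \<rho>"
  shows "D_kernel q \<xi> \<rho> (c *s a) z $ j = c * D_kernel q \<xi> \<rho> a z $ j"
proof -
  have "0 < norm (w - z) \<and> norm (w - z) < R" if "norm w = \<rho>" for w
    using kernel_range[OF that \<rho>(2) z] by blast
  then show ?thesis
    unfolding D_kernel_def vec_lambda_beta circ_int_mult_left[symmetric] using \<rho> q
    by (intro circ_int_cong) (auto simp: q_deriv_scale[OF regular[OF U]] sum_distrib_left mult.assoc)
qed

lemma D_kernel_eq_sum:
  assumes q: "q \<in> U" and \<rho>: "0 < \<rho>" "\<rho> < d" and z: "norm z < d" "norm z \<noteq> \<rho>"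
  shows "D_kernel q \<xi> \<rho> a z $ j = (\<Sum>m\<in>UNIV. a $ m * D_kernel q \<xi> \<rho> (axis m 1) z $ j)"
proof -
  note D = R_kernel_has_derivative[OF assms] D_kernel_scale[OF assms]
  have "partial_q m (\<lambda>q. R_kernel q \<xi> \<rho> z $ j) q = D_kernel q \<xi> \<rho> (axis m 1) z $ j" for m
    by (rule partial_q_eq[OF D])
  with derivative_eq_partials[OF D, of a j] show ?thesis by (simp only:)
qed

text \<open>The half-jump separating \<open>R\<close> from the outer kernel is independent of
  \<open>q\<close>, so both have the same derivative.\<close>

lemma R_op_has_derivative:
  assumes q: "q \<in> U" and \<rho>: "0 < norm z" "norm z < \<rho>" "\<rho> < d"
  shows "((\<lambda>q. eval_fls (R_op r q \<xi> $ j) z) has_derivative (\<lambda>a. D_kernel q \<xi> \<rho> a z $ j)) (at q)"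
proof -
  have "((\<lambda>q. R_kernel q \<xi> \<rho> z $ j - (\<Omega> *v loop_eval \<xi> z) $ j / 2) has_derivative (\<lambda>a. D_kernel q \<xi> \<rho> a z $ j)) (at q)"
    using R_kernel_has_derivative[OF q, of \<rho> z j] \<rho> by (auto intro!: derivative_eq_intros)
  then show ?thesis
  proof (rule has_derivative_transform_within_open[OF _ open_U[OF U] q])
    fix q assume "q \<in> U"
    from arg_cong[OF R_kernel_outside[OF U this \<xi> \<rho>], of "\<lambda>v. v $ j"]
    show "R_kernel q \<xi> \<rho> z $ j - (\<Omega> *v loop_eval \<xi> z) $ j / 2 = eval_fls (R_op r q \<xi> $ j) z"
      by simp
  qed
qed

text \<open>The two kernels of \<open>R\<close> differ by I \<xi>, a constant in \<open>q\<close>;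
  hence the differentiated kernel does not jump.\<close>

lemma D_kernel_inner:
  assumes q: "q \<in> U" and \<rho>: "0 < norm z" "norm z < \<rho>" "\<rho> < d" and \<rho>': "0 < \<rho>'" "\<rho>' < norm z"
  shows "D_kernel q \<xi> \<rho>' a z = D_kernel q \<xi> \<rho> a z"
proof -
  have "(\<lambda>a. D_kernel q \<xi> \<rho>' a z $ j) = (\<lambda>a. D_kernel q \<xi> \<rho> a z $ j)" for j
  proof (rule has_derivative_unique)
    have "((\<lambda>q. R_kernel q \<xi> \<rho> z $ j - (\<Omega> *v loop_eval \<xi> z) $ j) has_derivative (\<lambda>a. D_kernel q \<xi> \<rho> a z $ j)) (at q)"
      using R_kernel_has_derivative[OF q, of \<rho> z j] \<rho> by (auto intro!: derivative_eq_intros)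
    then show "((\<lambda>q. R_kernel q \<xi> \<rho>' z $ j) has_derivative (\<lambda>a. D_kernel q \<xi> \<rho> a z $ j)) (at q)"
      by (rule has_derivative_transform_within_open[OF _ open_U[OF U] q])
         (simp add: R_kernel_inner[OF U _ \<xi> \<rho> \<rho>'])
    show "((\<lambda>q. R_kernel q \<xi> \<rho>' z $ j) has_derivative (\<lambda>a. D_kernel q \<xi> \<rho>' a z $ j)) (at q)"
      using \<rho> \<rho>' by (intro R_kernel_has_derivative q) auto
  qed
  then show ?thesis by (simp add: vec_eq_iff) metis
qed

text \<open>Holomorphy of \<open>q_deriv\<close> in z is read off from \<open>q_deriv_part\<close>,
  with which it agrees for 0 < |z| < R / 2; the bound d \<le> R / 4 makes 2 \<rho> fit into that
  range.\<close>

lemma holomorphic_D_kernel: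
  assumes q: "q \<in> U" and \<rho>: "0 < \<rho>" "\<rho> < d"
  shows "(\<lambda>z. D_kernel q \<xi> \<rho> a z $ j) holomorphic_on ball 0 \<rho>"
proof (rule holomorphic_transform)
  have "q_deriv r a i j q holomorphic_on ball 0 (R / 2) - {0}" for i
    by (rule holomorphic_transform[OF holomorphic_on_subset[OF holomorphic_q_deriv_part[OF U q]]])
       (auto simp: q_deriv_eq_part[OF U q])
  then have hol: "q_deriv r a i j q holomorphic_on ball 0 (2 * \<rho>) - {0}" for i
    by (rule holomorphic_on_subset) (use \<rho> \<xi>(2) in auto)
  show "(\<lambda>z. \<Sum>i\<in>UNIV. circ_int \<rho> (\<lambda>w. q_deriv r a i j q (w - z) * eval_fls (\<xi> $ i) w)) holomorphic_on ball 0 \<rho>"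
    by (intro holomorphic_on_sum holomorphic_circ_int_translate[OF hol] continuous_on_loop[OF \<xi>(1)] \<rho> continuous_intros)
       (use \<rho> in auto)
qed (use q \<rho> in \<open>auto simp: D_kernel_component\<close>)

lemma X_deriv_exists:
  fixes a :: "complex^'l"
  assumes q: "q \<in> U" and \<rho>: "0 < \<rho>" "\<rho> < d"
  defines "X \<equiv> X_deriv a (\<lambda>q. R_op r q \<xi>) q"
  shows "is_X_deriv a (\<lambda>q. R_op r q \<xi>) q X \<and> loop_radius X \<rho> \<and>
    (\<forall>z. 0 < norm z \<and> norm z \<le> \<rho> \<longrightarrow> (\<forall>\<sigma>. \<rho> < \<sigma> \<and> \<sigma> < d \<longrightarrow> loop_eval X z = D_kernel q \<xi> \<sigma> a z))"
proof -
  have step: "\<exists>X. is_X_deriv a (\<lambda>q. R_op r q \<xi>) q X \<and> loop_radius X \<rho> \<and>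
      (\<forall>z. 0 < norm z \<and> norm z \<le> \<rho> \<longrightarrow> loop_eval X z = D_kernel q \<xi> \<sigma> a z)"
    if \<sigma>: "\<rho> < \<sigma>" "\<sigma> < d" for \<sigma>
  proof -
    have "0 < \<sigma>" using \<sigma> \<rho> by simp
    obtain X :: "complex fls^'n" where X: "loop_radius X \<rho>" "\<And>z j. norm z \<le> \<rho> \<Longrightarrow> eval_fls (X $ j) z = D_kernel q \<xi> \<sigma> a z $ j"
      using holomorphic_loop_extend[of "\<lambda>j z. D_kernel q \<xi> \<sigma> a z $ j" \<sigma> \<rho>]
        holomorphic_D_kernel[OF q \<open>0 < \<sigma>\<close> \<sigma>(2)] \<rho>(1) \<sigma>(1) by metis
    have "is_X_deriv a (\<lambda>q. R_op r q \<xi>) q X"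
      unfolding is_X_deriv_def
    proof (intro conjI loop_radius_imp_loop_space[OF X(1)] eventually_mono[OF eventually_small_nonzero[OF \<rho>(1)]] allI)
      fix z :: complex and j assume z: "0 < norm z \<and> norm z < \<rho>"
      have "((\<lambda>t. eval_fls (R_op r (q + t *s a) \<xi> $ j) z) has_field_derivative D_kernel q \<xi> \<sigma> a z $ j) (at 0)"
        using z \<sigma> \<open>0 < \<sigma>\<close>
        by (intro has_field_derivative_along[OF R_op_has_derivative[OF q]] D_kernel_scale q) auto
      then show "((\<lambda>t. eval_fls (R_op r (q + t *s a) \<xi> $ j) z) has_field_derivative eval_fls (X $ j) z) (at 0)"
        using X(2)[of z j] z by simp
    qed
    then show ?thesis using X by (auto simp: vec_eq_iff)
  qed
  have uniq: "X = Y" if "is_X_deriv a (\<lambda>q. R_op r q \<xi>) q Y" for Y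
    unfolding X_def X_deriv_def using is_X_deriv_unique that by (intro the_equality) auto
  obtain \<sigma> where "\<rho> < \<sigma>" "\<sigma> < d" using \<rho>(2) dense by blast
  with step uniq show ?thesis by metis
qed

context
  fixes q :: "complex^'l" and a :: "complex^'l" assumes q: "q \<in> U"
begin

lemma is_X_deriv_X_deriv: "is_X_deriv a (\<lambda>q. R_op r q \<xi>) q (X_deriv a (\<lambda>q. R_op r q \<xi>) q)"
  using X_deriv_exists[OF q, of "d / 2"] radius_pos[OF \<xi>(1)] by simp

lemma loop_radius_X_deriv: "0 < \<rho> \<Longrightarrow> \<rho> < d \<Longrightarrow> loop_radius (X_deriv a (\<lambda>q. R_op r q \<xi>) q) \<rho>"
  using X_deriv_exists[OF q] by blast

text \<open>The circle may lie on either side of z, as the differentiated kernel has no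
  jump.\<close>

lemma loop_eval_X_deriv:
  assumes "0 < \<rho>" "\<rho> < d" "0 < norm z" "norm z < d" "norm z \<noteq> \<rho>"
  shows "loop_eval (X_deriv a (\<lambda>q. R_op r q \<xi>) q) z = D_kernel q \<xi> \<rho> a z"
proof -
  obtain \<sigma> where \<sigma>: "norm z < \<sigma>" "\<sigma> < d" using assms(4) dense by blast
  have eq: "loop_eval (X_deriv a (\<lambda>q. R_op r q \<xi>) q) z = D_kernel q \<xi> \<sigma> a z" if "norm z < \<sigma>" "\<sigma> < d" for \<sigma>
    using X_deriv_exists[OF q, of "norm z" a] that assms by blast
  show ?thesis
    using eq[OF \<sigma>] eq[of \<rho>] D_kernel_inner[OF q assms(3) \<sigma> assms(1), of a] assms by fastforce
qed

end

text \<open>The pairing is taken over |z| = \<sigma> inside the kernel circle \<rho>. This nesting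
  is that of the torus integral, so \<open>D\<close> reproduces its third derivative term.\<close>

lemma loop_pairing_has_derivative:
  assumes q: "q \<in> U" and \<eta>: "loop_radius \<eta> d" and \<rho>: "0 < \<sigma>" "\<sigma> < \<rho>" "\<rho> < d"
  defines "D \<equiv> \<lambda>a. circ_int \<sigma> (\<lambda>z. \<Sum>j\<in>UNIV. eval_fls (\<eta> $ j) z * D_kernel q \<xi> \<rho> a z $ j)"
  shows "((\<lambda>q. loop_pairing \<eta> (R_op r q \<xi>)) has_derivative D) (at q)"
    and "D (c *s a) = c * D a"
proof -
  have \<sigma>d: "\<sigma> < d" and \<rho>0: "0 < \<rho>" using \<rho> by linarith+
  have "((\<lambda>q. circ_int \<sigma> (\<lambda>z. \<Sum>j\<in>UNIV. eval_fls (\<eta> $ j) z * eval_fls (R_op r q \<xi> $ j) z)) has_derivative D) (at q)"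
    unfolding D_def
  proof (rule circ_int_has_derivative[OF open_U[OF U] q])
    show "((\<lambda>q. \<Sum>j\<in>UNIV. eval_fls (\<eta> $ j) z * eval_fls (R_op r q \<xi> $ j) z) has_derivative
        (\<lambda>a. \<Sum>j\<in>UNIV. eval_fls (\<eta> $ j) z * D_kernel q \<xi> \<rho> a z $ j)) (at q)" if "q \<in> U" "norm z = \<sigma>" for q z
      using that \<rho> by (intro has_derivative_sum has_derivative_mult_right R_op_has_derivative) auto
    show "continuous_on (sphere 0 \<sigma>) (\<lambda>z. \<Sum>j\<in>UNIV. eval_fls (\<eta> $ j) z * eval_fls (R_op r q \<xi> $ j) z)"
      if "q \<in> U" for q
      using \<rho>
      by (intro continuous_on_sum continuous_on_mult continuous_on_loop[OF \<eta>]
          continuous_on_loop[OF loop_radius_R_op[OF U that \<xi> \<rho>0 \<rho>(3)]] continuous_intros) auto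
    have c: "continuous_on (U \<times> sphere 0 \<sigma>) (\<lambda>x. D_kernel (fst x) \<xi> \<rho> a (snd x) $ j)" for a j
      using continuous_on_D_kernel[OF \<rho>0 \<rho>(3), of "sphere 0 \<sigma>" a j] \<rho> by (simp add: split_beta)
    show "continuous_on (U \<times> sphere 0 \<sigma>) (\<lambda>(q, z). \<Sum>j\<in>UNIV. eval_fls (\<eta> $ j) z * D_kernel q \<xi> \<rho> a z $ j)" for a
      unfolding split_beta using \<rho>
      by (intro continuous_on_sum continuous_on_mult continuous_on_loop[OF \<eta>] c continuous_on_snd continuous_on_id)
         auto
  qed (use \<rho> in auto)
  then show "((\<lambda>q. loop_pairing \<eta> (R_op r q \<xi>)) has_derivative D) (at q)"
  proof (rule has_derivative_transform_within_open[OF _ open_U[OF U] q])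
    fix q assume "q \<in> U"
    note R = loop_radius_R_op[OF U this \<xi> \<rho>0 \<rho>(3)]
    show "circ_int \<sigma> (\<lambda>z. \<Sum>j\<in>UNIV. eval_fls (\<eta> $ j) z * eval_fls (R_op r q \<xi> $ j) z) = loop_pairing \<eta> (R_op r q \<xi>)"
      by (rule loop_pairing_circ_int[OF loop_radius_mono[OF \<eta> \<rho>0] R \<rho>(1,2), symmetric]) (use \<rho> in simp)
  qed
  show "D (c *s a) = c * D a"
    unfolding D_def circ_int_mult_left[symmetric] using \<rho> q
    by (intro circ_int_cong) (auto simp: D_kernel_scale sum_distrib_left mult_ac)
qed

end
end

section \<open>Equivariance\<close>

abbreviation matrix_pow :: "complex^'n^'n \<Rightarrow> nat \<Rightarrow> complex^'n^'n" where
  "matrix_pow A m \<equiv> ((**) A ^^ m) (mat 1)"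

lemma matrix_pow_commute: "A ** B = B ** A' \<Longrightarrow> matrix_pow A m ** B = B ** matrix_pow A' m"
  by (induction m) (simp_all, metis matrix_mul_assoc)

lemma matrix_pow_add: "matrix_pow A (m + k) = matrix_pow A m ** matrix_pow A k"
  by (induction m) (simp_all add: matrix_mul_assoc)

lemma matrix_pow_transpose: "matrix_pow (transpose A) m = transpose (matrix_pow A m)"
proof (induction m)
  case (Suc m)
  then show ?case
    using matrix_pow_commute[of A A A m] by (simp add: matrix_transpose_mul[symmetric])
qed (simp add: transpose_mat)

lemma matrix_pow_minus: "matrix_pow (- A) m $ i $ j = (- 1) ^ m * matrix_pow A m $ i $ j"
proof (induction m arbitrary: i j)
  case (Suc m)
  then show ?case by (simp add: matrix_matrix_mult_def sum_distrib_left mult_ac sum_negf)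
qed simp

text \<open>If C bounds the entries of \<open>A\<close>, those of its m-th power are at most (n C)^m
  with n the dimension; compare with the exponential series.\<close>

lemma summable_matrix_pow: "summable (\<lambda>m. norm (matrix_pow A m $ i $ j / fact m))"
  for A :: "complex^'n^'n"
proof -
  define C where "C = Max (range (\<lambda>(i, j). norm (A $ i $ j)))"
  have C: "norm (A $ i $ j) \<le> C" for i j
    unfolding C_def by (rule Max_ge) auto
  then have "0 \<le> C" using norm_ge_zero order_trans by blast
  have bound: "norm (matrix_pow A m $ i $ j) \<le> (CARD('n) * C) ^ m" for m i j
  proof (induction m arbitrary: i j)
    case (Suc m)
    have "norm (matrix_pow A (Suc m) $ i $ j) \<le> (\<Sum>k\<in>UNIV. norm (A $ i $ k * matrix_pow A m $ k $ j))"
      by (simp add: matrix_matrix_mult_def norm_sum)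
    also have "\<dots> \<le> (\<Sum>k\<in>(UNIV :: 'n set). C * (CARD('n) * C) ^ m)"
      unfolding norm_mult using C Suc \<open>0 \<le> C\<close> by (intro sum_mono mult_mono) auto
    finally show ?case by (simp add: mult_ac)
  qed (simp add: mat_def)
  show ?thesis
  proof (rule summable_comparison_test)
    show "summable (\<lambda>m. inverse (fact m) * (CARD('n) * C) ^ m)" by (rule summable_exp)
    show "\<exists>N. \<forall>m\<ge>N. norm (norm (matrix_pow A m $ i $ j / fact m)) \<le> inverse (fact m) * (CARD('n) * C) ^ m"
    proof (intro exI[of _ 0] allI impI)
      fix m
      have "norm (norm (matrix_pow A m $ i $ j / fact m)) = inverse (fact m) * norm (matrix_pow A m $ i $ j)"
        by (simp add: norm_mult norm_inverse divide_inverse mult.commute)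
      also have "\<dots> \<le> inverse (fact m) * (CARD('n) * C) ^ m"
        by (intro mult_left_mono bound) simp
      finally show "norm (norm (matrix_pow A m $ i $ j / fact m)) \<le> inverse (fact m) * (CARD('n) * C) ^ m" .
    qed
  qed
qed

lemma matrix_exp_nth: "matrix_exp A $ i $ j = (\<Sum>m. matrix_pow A m $ i $ j / fact m)"
proof -
  have scale: "(1 / fact m :: real) *\<^sub>R x = x / fact m" for x :: complex and m
    by (simp add: scaleR_conv_of_real)
  have "(\<lambda>m. (1 / fact m) *\<^sub>R matrix_pow A m) sums (\<chi> i j. \<Sum>m. matrix_pow A m $ i $ j / fact m)"
    unfolding sums_def
  proof (intro vec_tendstoI)
    fix i j
    have "(\<lambda>m. matrix_pow A m $ i $ j / fact m) sums (\<Sum>m. matrix_pow A m $ i $ j / fact m)"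
      by (rule summable_sums[OF summable_norm_cancel[OF summable_matrix_pow]])
    then show "(\<lambda>n. (\<Sum>m<n. (1 / fact m) *\<^sub>R matrix_pow A m) $ i $ j)
        \<longlonglongrightarrow> (\<chi> i j. \<Sum>m. matrix_pow A m $ i $ j / fact m) $ i $ j"
      by (simp only: sums_def sum_component vector_scaleR_component scale vec_lambda_beta)
  qed
  then show ?thesis
    unfolding matrix_exp_def by (simp add: sums_unique[symmetric])
qed

lemma matrix_exp_transpose: "matrix_exp (transpose A) = transpose (matrix_exp A)"
  unfolding vec_eq_iff matrix_exp_nth matrix_pow_transpose by (simp add: transpose_def matrix_exp_nth)

lemma matrix_mult_nth: "(A ** B) $ i $ j = (\<Sum>k\<in>UNIV. A $ i $ k * B $ k $ j)"
  by (simp add: matrix_matrix_mult_def)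

text \<open>An intertwining relation passes to powers and then termwise to the series. The zero
  weight condition is such a relation, between ad x and minus its transpose, with \<open>r\<close>
  as intertwiner.\<close>

lemma matrix_exp_commute:
  assumes "A ** B = B ** A'" shows "matrix_exp A ** B = B ** matrix_exp A'"
proof -
  note s = summable_norm_cancel[OF summable_matrix_pow]
  have "(matrix_exp A ** B) $ i $ j = (\<Sum>m. \<Sum>k\<in>UNIV. matrix_pow A m $ i $ k / fact m * B $ k $ j)" for i j
    unfolding matrix_mult_nth matrix_exp_nth suminf_mult2[OF s]
    by (rule suminf_sum[symmetric]) (intro summable_mult2 s)
  moreover have "(B ** matrix_exp A') $ i $ j = (\<Sum>m. \<Sum>k\<in>UNIV. B $ i $ k * (matrix_pow A' m $ k $ j / fact m))" for i j
    unfolding matrix_mult_nth matrix_exp_nth suminf_mult[OF s, symmetric]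
    by (rule suminf_sum[symmetric]) (intro summable_mult s)
  moreover have "(\<Sum>k\<in>UNIV. matrix_pow A m $ i $ k / fact m * B $ k $ j)
      = (\<Sum>k\<in>UNIV. B $ i $ k * (matrix_pow A' m $ k $ j / fact m))" for m i j
  proof -
    have "(matrix_pow A m ** B) $ i $ j / fact m = (B ** matrix_pow A' m) $ i $ j / fact m"
      using matrix_pow_commute[OF assms, of m] by simp
    then show ?thesis by (simp add: matrix_matrix_mult_def sum_divide_distrib)
  qed
  ultimately show ?thesis by (simp add: vec_eq_iff)
qed

text \<open>In the entrywise Cauchy product the coefficient of degree n is a multiple of (1 +
  (-1))^n, so only n = 0 survives.\<close>

lemma matrix_exp_minus: "matrix_exp A ** matrix_exp (- A) = mat 1"
  for A :: "complex^'n^'n"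
proof -
  have "(matrix_exp A ** matrix_exp (- A)) $ i $ j = mat 1 $ i $ j" for i j
  proof -
    let ?a = "\<lambda>k m. matrix_pow A m $ i $ k / fact m" and ?b = "\<lambda>k m. matrix_pow (- A) m $ k $ j / fact m"
    have cp: "(\<lambda>n. \<Sum>p\<le>n. ?a k p * ?b k (n - p)) sums (matrix_exp A $ i $ k * matrix_exp (- A) $ k $ j)" for k
      unfolding matrix_exp_nth by (intro Cauchy_product_sums summable_matrix_pow)
    have "(\<lambda>n. \<Sum>k\<in>UNIV. \<Sum>p\<le>n. ?a k p * ?b k (n - p)) sums ((matrix_exp A ** matrix_exp (- A)) $ i $ j)"
      unfolding matrix_mult_nth by (intro sums_sum cp)
    moreover have "(\<Sum>k\<in>UNIV. \<Sum>p\<le>n. ?a k p * ?b k (n - p)) = (if n = 0 then mat 1 $ i $ j else 0)" for n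
    proof -
      have "(\<Sum>k\<in>UNIV. \<Sum>p\<le>n. ?a k p * ?b k (n - p)) = (\<Sum>p\<le>n. \<Sum>k\<in>UNIV. ?a k p * ?b k (n - p))"
        by (rule sum.swap)
      also have "\<dots> = (\<Sum>p\<le>n. (- 1) ^ (n - p) * of_nat (n choose p) * (matrix_pow A n $ i $ j / fact n))"
      proof (rule sum.cong[OF refl])
        fix p assume "p \<in> {..n}"
        then have p: "p \<le> n" by simp
        have "(\<Sum>k\<in>UNIV. ?a k p * ?b k (n - p))
            = (- 1) ^ (n - p) / (fact p * fact (n - p)) * (matrix_pow A p ** matrix_pow A (n - p)) $ i $ j"
          by (simp add: matrix_pow_minus matrix_matrix_mult_def sum_distrib_left mult_ac)
        also have "matrix_pow A p ** matrix_pow A (n - p) = matrix_pow A n"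
          using p matrix_pow_add[where A = A and m = p and k = "n - p"] by simp
        finally show "(\<Sum>k\<in>UNIV. ?a k p * ?b k (n - p))
            = (- 1) ^ (n - p) * of_nat (n choose p) * (matrix_pow A n $ i $ j / fact n)"
          using p by (simp add: binomial_fact)
      qed
      also have "\<dots> = (\<Sum>p\<le>n. (- 1) ^ (n - p) * of_nat (n choose p)) * (matrix_pow A n $ i $ j / fact n)"
        by (simp only: sum_distrib_right)
      also have "(\<Sum>p\<le>n. (- 1) ^ (n - p) * (of_nat (n choose p) :: complex)) = (1 + (- 1)) ^ n"
        unfolding binomial_ring[of 1 "- 1" n] by (simp add: mult.commute)
      finally show ?thesis by (simp add: power_0_left)
    qed
    ultimately have "(\<lambda>n. if n = 0 then mat 1 $ i $ j else 0) sums ((matrix_exp A ** matrix_exp (- A)) $ i $ j)"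
      by simp
    moreover have "(\<lambda>n. if n = 0 then mat 1 $ i $ j else 0) sums (mat 1 :: complex^'n^'n) $ i $ j"
      using sums_If_finite_set[of "{0::nat}" "\<lambda>_. (mat 1 :: complex^'n^'n) $ i $ j"] by simp
    ultimately show ?thesis by (rule sums_unique2)
  qed
  then show ?thesis by (simp add: vec_eq_iff)
qed

context dynamical_setup
begin

text \<open>The zero weight condition integrated to the group. Invertibility is part of the
  induction because cancelling \<open>matrix_inv\<close> requires it.\<close>

lemma cartan_group_invariant:
  assumes "A \<in> cartan_group br h"
  shows "invertible A \<and> (\<forall>q z. regular_at r q z \<longrightarrow> A ** r q z ** transpose A = r q z)"
  using assms
proof induction
  case (exp_in x)
  let ?E = "matrix_exp (ad br x)"
  have "matrix_exp (- ad br x) ** ?E = mat 1"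
    using matrix_exp_minus[of "- ad br x"] by simp
  then have "invertible ?E" using matrix_exp_minus[of "ad br x"] by (auto simp: invertible_def)
  moreover have "?E ** r q z ** transpose ?E = r q z" if reg: "regular_at r q z" for q z
  proof -
    have "ad br x ** r q z + r q z ** transpose (ad br x) = 0"
      using rmat exp_in reg unfolding dynamical_r_matrix_def by blast
    then have "ad br x ** r q z = r q z ** (- transpose (ad br x))"
      by (simp add: eq_neg_iff_add_eq_0 vec_eq_iff matrix_matrix_mult_def sum_negf)
    then have "?E ** r q z = r q z ** matrix_exp (- transpose (ad br x))"
      by (rule matrix_exp_commute)
    then have "?E ** r q z ** transpose ?E
        = r q z ** (matrix_exp (- transpose (ad br x)) ** matrix_exp (transpose (ad br x)))"
      by (simp add: matrix_exp_transpose matrix_mul_assoc)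
    then show ?thesis using matrix_exp_minus[of "- transpose (ad br x)"] by simp
  qed
  ultimately show ?case by blast
next
  case (mult_in A B)
  have "A ** B ** r q z ** transpose (A ** B) = A ** (B ** r q z ** transpose B) ** transpose A" for q z
    by (simp add: matrix_transpose_mul matrix_mul_assoc)
  then show ?case using mult_in by (simp add: invertible_mult)
next
  case (inv_in A)
  let ?B = "matrix_inv A"
  note inv = matrix_inv_cancel[OF conjunct1[OF inv_in.IH]]
  have "?B ** r q z ** transpose ?B = r q z" if "regular_at r q z" for q z
  proof -
    have "r q z = A ** r q z ** transpose A" using inv_in.IH that by simp
    then have "?B ** r q z ** transpose ?B = ?B ** (A ** r q z ** transpose A) ** transpose ?B" by simp
    also have "\<dots> = (?B ** A) ** r q z ** transpose (?B ** A)"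
      by (simp add: matrix_transpose_mul matrix_mul_assoc)
    finally show ?thesis by (simp add: inv transpose_mat)
  qed
  moreover have "invertible ?B" using inv by (auto simp: invertible_def)
  ultimately show ?case by blast
qed

section \<open>Linearity and equivariance of \<open>R\<close>\<close>

context
  fixes U R assumes U: "regular_on U R"
begin

text \<open>No term in \<Omega> appears here, so a property shared by the kernels on both sides of z
  passes to \<open>R\<close> without a separate treatment of \<open>I\<close>.\<close>

lemma R_op_average:
  assumes "q \<in> U" "loop_radius \<xi> d" "d \<le> R / 4"
    and "0 < \<rho>'" "\<rho>' < norm z" "norm z < \<rho>" "\<rho> < d"
  shows "loop_eval (R_op r q \<xi>) z = (1 / 2) *s (R_kernel q \<xi> \<rho>' z + R_kernel q \<xi> \<rho> z)"
proof -
  have "0 < norm z" "norm z < d" using assms by linarith+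
  then show ?thesis
    using R_kernel_outside[OF U assms(1-3) _ assms(6,7)] R_kernel_inside[OF U assms(1-5)]
    by (simp add: vec_eq_iff field_simps)
qed

lemma R_op_eqI:
  assumes q: "q \<in> U" and \<xi>: "loop_radius \<xi> d" "d \<le> R / 4" and Y: "loop_radius Y d"
    and eq: "\<And>z \<rho>' \<rho>. 0 < \<rho>' \<Longrightarrow> \<rho>' < norm z \<Longrightarrow> norm z < \<rho> \<Longrightarrow> \<rho> < d \<Longrightarrow>
      loop_eval Y z = (1 / 2) *s (R_kernel q \<xi> \<rho>' z + R_kernel q \<xi> \<rho> z)"
  shows "R_op r q \<xi> = Y"
proof (rule loop_eqI')
  have d: "0 < d / 2" "d / 2 < d" using radius_pos[OF \<xi>(1)] by auto
  show "loop_radius (R_op r q \<xi>) (d / 2)" by (rule loop_radius_R_op[OF U q \<xi> d])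
  show "loop_radius Y (d / 2)" using loop_radius_mono[OF Y d(1)] d by simp
  fix z :: complex assume z: "0 < norm z" "norm z < d / 2"
  then have "0 < norm z / 2" "norm z / 2 < norm z" by auto
  then show "loop_eval (R_op r q \<xi>) z = loop_eval Y z"
    using R_op_average[OF q \<xi> _ _ z(2) d(2)] eq[OF _ _ z(2) d(2)] by metis
qed

text \<open>The second part transports any intertwining relation of the kernel to \<open>R\<close>.
  The transpose of \<open>r\<close> occurs because the pairing contracts the first leg. Scalar
  homogeneity and equivariance under \<open>H\<close> are both instances.\<close>

lemma R_op_linear:
  assumes q: "q \<in> U" and \<xi>: "\<xi> \<in> loop_space" "\<eta> \<in> loop_space"
  shows R_op_add: "R_op r q (\<xi> + \<eta>) = R_op r q \<xi> + R_op r q \<eta>"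
    and R_op_map: "(\<And>z. 0 < norm z \<Longrightarrow> norm z < R \<Longrightarrow> transpose (r q z) ** B = A ** transpose (r q z)) \<Longrightarrow>
      R_op r q (loop_map B \<xi>) = loop_map A (R_op r q \<xi>)"
proof -
  have R: "0 < R / 4" using R_pos[OF U] by simp
  obtain d1 where d1: "loop_radius \<xi> d1" "d1 \<le> R / 4" using loop_spaceE[OF \<xi>(1) R] by blast
  obtain e where e0: "loop_radius \<eta> e" "e \<le> d1"
    using loop_spaceE[OF \<xi>(2) radius_pos[OF d1(1)]] by blast
  have e: "loop_radius \<xi> e" "loop_radius \<eta> e" "e \<le> R / 4" "0 < e"
    using loop_radius_mono[OF d1(1) radius_pos[OF e0(1)] e0(2)] e0 d1 radius_pos[OF e0(1)] by auto
  define d where "d = e / 2"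
  have d: "0 < d" "d < e" "d \<le> R / 4" using e by (auto simp: d_def)
  note rad = loop_radius_mono[OF e(1) d(1) less_imp_le[OF d(2)]] loop_radius_mono[OF e(2) d(1) less_imp_le[OF d(2)]]
  note R_rad = loop_radius_R_op[OF U q e(1,3) d(1,2)] loop_radius_R_op[OF U q e(2,3) d(1,2)]
  have av: "loop_eval (R_op r q \<xi>) z = (1 / 2) *s (R_kernel q \<xi> \<rho>' z + R_kernel q \<xi> \<rho> z)"
    "loop_eval (R_op r q \<eta>) z = (1 / 2) *s (R_kernel q \<eta> \<rho>' z + R_kernel q \<eta> \<rho> z)"
    if "0 < \<rho>'" "\<rho>' < norm z" "norm z < \<rho>" "\<rho> < d" for z \<rho>' \<rho>
    using R_op_average[OF q rad(1) d(3) that] R_op_average[OF q rad(2) d(3) that] by auto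
  have val: "loop_eval (\<xi> + \<eta>) w = loop_eval \<xi> w + loop_eval \<eta> w"
    "loop_eval (loop_map B \<xi>) w = B *v loop_eval \<xi> w"
    if "0 < norm w" "norm w < d" for w B
    using that loop_eval_add[OF rad, of w] loop_eval_map[OF rad(1), of w B] by auto
  have ker_cont: "continuous_on (sphere 0 \<rho>) (\<lambda>w. \<Sum>i\<in>UNIV. r q (w - z) $ i $ j * eval_fls (X $ i) w)"
    if "0 < \<rho>" "\<rho> < d" "norm z < d" "norm z \<noteq> \<rho>" "loop_radius X d" for \<rho> z j X
    using that by (intro continuous_on_sum R_kernel_summand_continuous[OF U q _ d(3)]) auto
  show "R_op r q (\<xi> + \<eta>) = R_op r q \<xi> + R_op r q \<eta>"
  proof (rule R_op_eqI[OF q loop_radius_add[OF rad] d(3) loop_radius_add[OF R_rad]])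
    have K: "R_kernel q (\<xi> + \<eta>) \<rho> z = R_kernel q \<xi> \<rho> z + R_kernel q \<eta> \<rho> z"
      if "0 < \<rho>" "\<rho> < d" "norm z < d" "norm z \<noteq> \<rho>" for \<rho> z
    proof -
      have "circ_int \<rho> (\<lambda>w. \<Sum>i\<in>UNIV. r q (w - z) $ i $ j * eval_fls ((\<xi> + \<eta>) $ i) w)
          = circ_int \<rho> (\<lambda>w. (\<Sum>i\<in>UNIV. r q (w - z) $ i $ j * eval_fls (\<xi> $ i) w)
              + (\<Sum>i\<in>UNIV. r q (w - z) $ i $ j * eval_fls (\<eta> $ i) w))" for j
        using that arg_cong[OF val(1), of _ "\<lambda>v. v $ _"]
        by (intro circ_int_cong) (auto simp: distrib_left sum.distrib)
      then show ?thesis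
        unfolding R_kernel_def using that rad
        by (simp add: vec_eq_iff circ_int_add[OF less_imp_le[OF that(1)] ker_cont ker_cont])
    qed
    fix z :: complex and \<rho>' \<rho> assume z: "0 < \<rho>'" "\<rho>' < norm z" "norm z < \<rho>" "\<rho> < d"
    have nz: "z \<noteq> 0" "norm z \<le> d" using z by auto
    have "\<rho>' < d" "norm z < d" "norm z \<noteq> \<rho>'" "0 < \<rho>" "norm z \<noteq> \<rho>" using z by linarith+
    note K' = K[OF z(1) this(1-3)] K[OF this(4) z(4) this(2,5)]
    show "loop_eval (R_op r q \<xi> + R_op r q \<eta>) z = (1 / 2) *s (R_kernel q (\<xi> + \<eta>) \<rho>' z + R_kernel q (\<xi> + \<eta>) \<rho> z)"
      unfolding loop_eval_add[OF R_rad nz] av[OF z] K' by (simp add: vec_eq_iff field_simps)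
  qed
  assume AB: "\<And>z. 0 < norm z \<Longrightarrow> norm z < R \<Longrightarrow> transpose (r q z) ** B = A ** transpose (r q z)"
  show "R_op r q (loop_map B \<xi>) = loop_map A (R_op r q \<xi>)"
  proof (rule R_op_eqI[OF q loop_radius_map[OF rad(1)] d(3) loop_radius_map[OF R_rad(1)]])
    have K: "R_kernel q (loop_map B \<xi>) \<rho> z = A *v R_kernel q \<xi> \<rho> z"
      if "0 < \<rho>" "\<rho> < d" "norm z < d" "norm z \<noteq> \<rho>" for \<rho> z
    proof -
      have "circ_int \<rho> (\<lambda>w. \<Sum>i\<in>UNIV. r q (w - z) $ i $ j * eval_fls (loop_map B \<xi> $ i) w)
          = circ_int \<rho> (\<lambda>w. \<Sum>k\<in>UNIV. A $ j $ k * (\<Sum>i\<in>UNIV. r q (w - z) $ i $ k * eval_fls (\<xi> $ i) w))" for j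
      proof (rule circ_int_cong)
        fix w :: complex assume w: "norm w = \<rho>"
        have v: "loop_eval (loop_map B \<xi>) w = B *v loop_eval \<xi> w" by (rule val(2)) (use w that in auto)
        have "0 < norm (w - z)" "norm (w - z) < R"
          using norm_triangle_ineq4[of w z] that w d(3) R by auto
        then have "transpose (r q (w - z)) *v (B *v loop_eval \<xi> w) = A *v (transpose (r q (w - z)) *v loop_eval \<xi> w)"
          by (simp only: matrix_vector_mul_assoc AB)
        from arg_cong[OF this[folded v], of "\<lambda>v. v $ j"]
        show "(\<Sum>i\<in>UNIV. r q (w - z) $ i $ j * eval_fls (loop_map B \<xi> $ i) w)
            = (\<Sum>k\<in>UNIV. A $ j $ k * (\<Sum>i\<in>UNIV. r q (w - z) $ i $ k * eval_fls (\<xi> $ i) w))"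
          by (simp add: matrix_vector_mult_def transpose_def)
      qed (use that in auto)
      moreover have "circ_int \<rho> (\<lambda>w. \<Sum>k\<in>UNIV. A $ j $ k * (\<Sum>i\<in>UNIV. r q (w - z) $ i $ k * eval_fls (\<xi> $ i) w))
          = (\<Sum>k\<in>UNIV. circ_int \<rho> (\<lambda>w. A $ j $ k * (\<Sum>i\<in>UNIV. r q (w - z) $ i $ k * eval_fls (\<xi> $ i) w)))" for j
        by (intro circ_int_sum continuous_on_mult_left ker_cont rad(1)) (use that in auto)
      ultimately show ?thesis
        by (simp add: vec_eq_iff R_kernel_def matrix_vector_mult_def circ_int_mult_left)
    qed
    fix z :: complex and \<rho>' \<rho> assume z: "0 < \<rho>'" "\<rho>' < norm z" "norm z < \<rho>" "\<rho> < d"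
    have nz: "z \<noteq> 0" "norm z \<le> d" using z by auto
    have "\<rho>' < d" "norm z < d" "norm z \<noteq> \<rho>'" "0 < \<rho>" "norm z \<noteq> \<rho>" using z by linarith+
    note K' = K[OF z(1) this(1-3)] K[OF this(4) z(4) this(2,5)]
    show "loop_eval (loop_map A (R_op r q \<xi>)) z
        = (1 / 2) *s (R_kernel q (loop_map B \<xi>) \<rho>' z + R_kernel q (loop_map B \<xi>) \<rho> z)"
      unfolding loop_eval_map[OF R_rad(1) nz] av[OF z] K'
      by (simp add: vector_scalar_commute matrix_vector_right_distrib)
  qed
qed

lemma R_op_scale:
  assumes "q \<in> U" "\<xi> \<in> loop_space"
  shows "R_op r q (fls_const c *s \<xi>) = fls_const c *s R_op r q \<xi>"
proof -
  have "fls_const c *s X = loop_map (mat c) X" for X :: "complex fls^'n"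
    by (simp add: vec_eq_iff loop_map_def map_matrix_def matrix_vector_mult_def mat_def
        if_distrib[of "\<lambda>x. _ * x"] if_distrib[of fls_const] if_distrib[of "\<lambda>x. x * _"] cong: if_cong)
  moreover have "A ** (mat c) = (mat c) ** A" for A :: "complex^'n^'n"
    by (simp add: vec_eq_iff matrix_matrix_mult_def mat_def
        if_distrib[of "\<lambda>x. _ * x"] if_distrib[of "\<lambda>x. x * _"] cong: if_cong)
  ultimately show ?thesis
    using R_op_map[OF assms(1,2,2)] by metis
qed

lemma R_op_equivariant:
  assumes q: "q \<in> U"
  shows "R_op r q \<in> equivariant_maps br h"
  unfolding equivariant_maps_def mem_Collect_eq
proof (intro conjI ballI allI)
  fix \<xi> :: "complex fls^'n" assume \<xi>: "\<xi> \<in> loop_space"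
  obtain d where d: "loop_radius \<xi> d" "d \<le> R / 4" using loop_spaceE[OF \<xi>, of "R / 4"] R_pos[OF U] by auto
  have "loop_radius (R_op r q \<xi>) (d / 2)"
    using radius_pos[OF d(1)] by (intro loop_radius_R_op[OF U q d]) auto
  then show "R_op r q \<xi> \<in> loop_space" by (rule loop_radius_imp_loop_space)
  show "R_op r q (\<xi> + \<eta>) = R_op r q \<xi> + R_op r q \<eta>" if "\<eta> \<in> loop_space" for \<eta>
    by (rule R_op_add[OF q \<xi> that])
  show "R_op r q (fls_const c *s \<xi>) = fls_const c *s R_op r q \<xi>" for c
    by (rule R_op_scale[OF q \<xi>])
  fix A assume A: "A \<in> cartan_group br h"
  note inv = matrix_inv_cancel[OF conjunct1[OF cartan_group_invariant[OF A]]]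
  show "R_op r q (loop_map (transpose (matrix_inv A)) \<xi>) = loop_map A (R_op r q \<xi>)"
  proof (rule R_op_map[OF q \<xi> \<xi>])
    fix z :: complex assume z: "0 < norm z" "norm z < R"
    have "A ** r q z ** transpose A = r q z"
      using cartan_group_invariant[OF A] regular[OF U q z] by blast
    then have "transpose (r q z) = A ** transpose (r q z) ** transpose A"
      using matrix_transpose_mul[of "A ** r q z" "transpose A"] by (simp add: matrix_transpose_mul matrix_mul_assoc)
    then have "transpose (r q z) ** transpose (matrix_inv A)
        = A ** transpose (r q z) ** transpose A ** transpose (matrix_inv A)" by simp
    also have "\<dots> = A ** transpose (r q z) ** transpose (matrix_inv A ** A)"
      by (simp add: matrix_transpose_mul matrix_mul_assoc)
    finally show "transpose (r q z) ** transpose (matrix_inv A) = A ** transpose (r q z)"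
      by (simp add: inv transpose_mat)
  qed
qed

end
end

section \<open>The modified dynamical Yang-Baxter equation\<close>

lemma matrix_vector_mult_nth: "(A *v x) $ i = (\<Sum>j\<in>UNIV. A $ i $ j * x $ j)"
  by (simp add: matrix_vector_mult_def)

lemma sum_swap3:
  "(\<Sum>i\<in>A. \<Sum>j\<in>B. \<Sum>m\<in>C. F i j m) = (\<Sum>m\<in>C. \<Sum>i\<in>A. \<Sum>j\<in>B. F i j m)"
proof -
  have "(\<Sum>i\<in>A. \<Sum>j\<in>B. \<Sum>m\<in>C. F i j m) = (\<Sum>i\<in>A. \<Sum>m\<in>C. \<Sum>j\<in>B. F i j m)"
    by (rule sum.cong[OF refl]) (rule sum.swap)
  also have "\<dots> = (\<Sum>m\<in>C. \<Sum>i\<in>A. \<Sum>j\<in>B. F i j m)" by (rule sum.swap)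
  finally show ?thesis .
qed

lemma sum_swap4:
  "(\<Sum>i\<in>A. \<Sum>j\<in>B. \<Sum>a\<in>C. \<Sum>b\<in>D. F i j a b) = (\<Sum>a\<in>C. \<Sum>b\<in>D. \<Sum>i\<in>A. \<Sum>j\<in>B. F i j a b)"
  unfolding sum_swap3[of "\<lambda>i j a. \<Sum>b\<in>D. F i j a b"] by (rule sum.cong[OF refl]) (rule sum_swap3)

context torus
begin

lemma torus_int_sum4:
  fixes F :: "'a::finite \<Rightarrow> 'b::finite \<Rightarrow> 'c::finite \<Rightarrow> 'd::finite \<Rightarrow> complex \<Rightarrow> complex \<Rightarrow> complex"
  assumes F: "\<And>i j a b. cont_torus (F i j a b)"
  shows "torus_int \<rho> \<sigma> (\<lambda>u v. \<Sum>i\<in>UNIV. \<Sum>j\<in>UNIV. \<Sum>a\<in>UNIV. \<Sum>b\<in>UNIV. c i j a b * F i j a b u v)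
    = (\<Sum>i\<in>UNIV. \<Sum>j\<in>UNIV. \<Sum>a\<in>UNIV. \<Sum>b\<in>UNIV. c i j a b * torus_int \<rho> \<sigma> (F i j a b))"
proof -
  have sum: "cont_torus (\<lambda>u v. \<Sum>i\<in>UNIV. G i u v)" if "\<And>i. cont_torus (G i)"
    for G :: "'i::finite \<Rightarrow> complex \<Rightarrow> complex \<Rightarrow> complex"
    using continuous_on_sum[of "UNIV :: 'i set", OF that[unfolded split_beta]] by (simp add: split_beta)
  have c: "cont_torus (\<lambda>u v. c i j a b * F i j a b u v)" for i j a b
    using continuous_on_mult_left[OF F[unfolded split_beta]] by (simp add: split_beta)
  note 1 = sum[OF c] note 2 = sum[OF 1] note 3 = sum[OF 2]
  show ?thesis
    by (simp only: torus_int_sum 1 2 3 c torus_int_mult_left)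
qed

end

context dynamical_setup
begin

lemma coadjoint_minus: "transpose (ad br (- x)) *v y = - (transpose (ad br x) *v y)"
  by (simp add: vec_eq_iff matrix_vector_mult_nth transpose_def ad_component sum_negf del: transpose_matrix_vector)

text \<open>The structure constants are linear in the contraction of \<open>p\<close> with
  \<open>y\<close>, so the integral acts only on that vector; contracting the bracket with
  \<open>x\<close> is the transpose of its adjoint matrix. This evaluates the inner integral in the
  bracket terms that contain the 12 component.\<close>

lemma circ_int_coadjoint:
  assumes "\<rho> \<ge> 0" and cont: "\<And>a. continuous_on (sphere 0 \<rho>) (\<lambda>v. \<Sum>j\<in>UNIV. p a j v * y j v)"
  shows "circ_int \<rho> (\<lambda>v. \<Sum>i\<in>UNIV. \<Sum>j\<in>UNIV. \<Sum>a\<in>UNIV. \<Sum>b\<in>UNIV. sc a b i * (x $ i * y j v * (p a j v * s b)))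
    = (\<Sum>b\<in>UNIV. s b * (transpose (ad br (\<chi> a. circ_int \<rho> (\<lambda>v. \<Sum>j\<in>UNIV. p a j v * y j v))) *v x) $ b)"
proof -
  define C where "C a = (\<Sum>b\<in>UNIV. \<Sum>i\<in>UNIV. s b * sc a b i * x $ i)" for a
  define V where "V = (\<chi> a. circ_int \<rho> (\<lambda>v. \<Sum>j\<in>UNIV. p a j v * y j v))"
  have "(\<Sum>i\<in>UNIV. \<Sum>j\<in>UNIV. \<Sum>a\<in>UNIV. \<Sum>b\<in>UNIV. sc a b i * (x $ i * y j v * (p a j v * s b)))
      = (\<Sum>a\<in>UNIV. C a * (\<Sum>j\<in>UNIV. p a j v * y j v))" for v
  proof -
    have "(\<Sum>a\<in>UNIV. C a * (\<Sum>j\<in>UNIV. p a j v * y j v))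
        = (\<Sum>a\<in>UNIV. \<Sum>b\<in>UNIV. \<Sum>i\<in>UNIV. \<Sum>j\<in>UNIV. s b * sc a b i * x $ i * (p a j v * y j v))"
      unfolding C_def by (simp only: sum_distrib_right) (simp only: sum_distrib_left)
    then show ?thesis by (subst sum_swap4) (simp add: mult_ac)
  qed
  then have "circ_int \<rho> (\<lambda>v. \<Sum>i\<in>UNIV. \<Sum>j\<in>UNIV. \<Sum>a\<in>UNIV. \<Sum>b\<in>UNIV. sc a b i * (x $ i * y j v * (p a j v * s b)))
      = circ_int \<rho> (\<lambda>v. \<Sum>a\<in>UNIV. C a * (\<Sum>j\<in>UNIV. p a j v * y j v))" by simp
  also have "\<dots> = (\<Sum>a\<in>UNIV. C a * V $ a)"
    by (simp add: circ_int_sum[OF assms(1)] continuous_on_mult_left cont circ_int_mult_left V_def)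
  also have "\<dots> = (\<Sum>a\<in>UNIV. \<Sum>b\<in>UNIV. \<Sum>i\<in>UNIV. s b * sc a b i * x $ i * V $ a)"
    unfolding C_def by (simp only: sum_distrib_right)
  also have "\<dots> = (\<Sum>b\<in>UNIV. \<Sum>i\<in>UNIV. \<Sum>a\<in>UNIV. s b * sc a b i * x $ i * V $ a)"
    by (rule sum_swap3[symmetric])
  also have "\<dots> = (\<Sum>b\<in>UNIV. s b * (transpose (ad br V) *v x) $ b)"
    by (simp add: matrix_vector_mult_nth transpose_def ad_component sum_distrib_right sum_distrib_left mult_ac
        del: transpose_matrix_vector)
  finally show ?thesis unfolding V_def .
qed

lemma i_star_eq:
  assumes X: "loop_radius X \<delta>" and \<rho>: "0 < \<rho>" "\<rho> < \<delta>"
  shows "i_star hb X $ m = (\<Sum>i\<in>UNIV. circ_int \<rho> (eval_fls (X $ i)) * hb m $ i)"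
proof -
  have "i_star hb X $ m = circ_int \<rho> (\<lambda>w. \<Sum>i\<in>UNIV. eval_fls (X $ i) w * hb m $ i)"
    unfolding i_star_def
    using loop_pairing_circ_int[OF X loop_radius_const[OF radius_pos[OF X]] \<rho>, of "hb m"]
    by (simp add: const_loop_def)
  also have "\<dots> = (\<Sum>i\<in>UNIV. circ_int \<rho> (\<lambda>w. eval_fls (X $ i) w * hb m $ i))"
    using \<rho> by (intro circ_int_sum continuous_on_mult_right continuous_on_loop[OF X] continuous_intros) auto
  finally show ?thesis by (simp add: circ_int_mult_right)
qed

lemma I_map_eq: "I_map br = loop_map \<Omega>" and I_inv_eq: "I_inv br = loop_map KM"
  by (simp_all add: fun_eq_iff I_map_def I_inv_def casimir_def)

section \<open>The six terms of the integrated equation\<close>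

context
  fixes U R and q :: "complex^'l" and \<xi> \<eta> :: "complex fls^'n" and d0 d :: real
  assumes U: "regular_on U R" and q: "q \<in> U"
    and \<xi>: "loop_radius \<xi> d0" and \<eta>: "loop_radius \<eta> d0" and d0: "d0 \<le> R / 4" and d: "0 < d" "d < d0"
begin

abbreviation "R\<xi> \<equiv> R_op r q \<xi>"
abbreviation "R\<eta> \<equiv> R_op r q \<eta>"
abbreviation "half \<equiv> (1 / 2 :: complex)"

text \<open>\<open>B1 + B2\<close> is the argument of \<open>R\<close> in the equation.  The shifts by \<open>\<minusplus> I / 2\<close> cancel in the
  sum; they come from the nesting of the two circles of integration.\<close>

definition "B1 = loop_map KM (loop_bracket br (loop_map \<Omega> \<xi>) (R\<eta> - fls_const half *s loop_map \<Omega> \<eta>))"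
definition "B2 = loop_map KM (loop_bracket br (R\<xi> + fls_const half *s loop_map \<Omega> \<xi>) (loop_map \<Omega> \<eta>))"

lemma loop_radius_R:
  "loop_radius \<xi> d" "loop_radius \<eta> d" "loop_radius R\<xi> d" "loop_radius R\<eta> d" "d \<le> R / 4"
  using loop_radius_mono[OF \<xi> d(1)] loop_radius_mono[OF \<eta> d(1)] d d0
    loop_radius_R_op[OF U q \<xi> d0 d] loop_radius_R_op[OF U q \<eta> d0 d] by auto

lemma loop_radius_B: "loop_radius B1 d" "loop_radius B2 d"
  unfolding B1_def B2_def
  by (intro loop_radius_map loop_radius_bracket loop_radius_add loop_radius_diff loop_radius_scale loop_radius_R)+

lemma loop_eval_B:
  assumes "0 < norm w" "norm w \<le> d"
  shows "loop_eval B1 w = transpose (ad br (loop_eval R\<eta> w - half *s (\<Omega> *v loop_eval \<eta> w))) *v loop_eval \<xi> w"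
    and "loop_eval B2 w = - (transpose (ad br (loop_eval R\<xi> w + half *s (\<Omega> *v loop_eval \<xi> w))) *v loop_eval \<eta> w)"
    and "\<Omega> *v loop_eval B1 w = br (\<Omega> *v loop_eval \<xi> w) (loop_eval R\<eta> w - half *s (\<Omega> *v loop_eval \<eta> w))"
    and "\<Omega> *v loop_eval B2 w = br (loop_eval R\<xi> w + half *s (\<Omega> *v loop_eval \<xi> w)) (\<Omega> *v loop_eval \<eta> w)"
proof -
  have w: "w \<noteq> 0" "norm w \<le> d" using assms by auto
  note maps = loop_radius_map[OF loop_radius_R(1), of \<Omega>] loop_radius_map[OF loop_radius_R(2), of \<Omega>]
  note sc = loop_radius_scale[OF maps(1), of half] loop_radius_scale[OF maps(2), of half]
  have e1: "loop_eval B1 w = KM *v br (\<Omega> *v loop_eval \<xi> w) (loop_eval R\<eta> w - half *s (\<Omega> *v loop_eval \<eta> w))"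
    unfolding B1_def
    loop_eval_map[OF loop_radius_bracket[OF maps(1) loop_radius_diff[OF loop_radius_R(4) sc(2)]] w]
    loop_eval_bracket[OF maps(1) loop_radius_diff[OF loop_radius_R(4) sc(2)] w]
    loop_eval_diff[OF loop_radius_R(4) sc(2) w] loop_eval_scale[OF maps(2) w] loop_eval_map[OF loop_radius_R(1) w] loop_eval_map[OF loop_radius_R(2) w] ..
  have e2: "loop_eval B2 w = KM *v br (loop_eval R\<xi> w + half *s (\<Omega> *v loop_eval \<xi> w)) (\<Omega> *v loop_eval \<eta> w)"
    unfolding B2_def
    loop_eval_map[OF loop_radius_bracket[OF loop_radius_add[OF loop_radius_R(3) sc(1)] maps(2)] w]
    loop_eval_bracket[OF loop_radius_add[OF loop_radius_R(3) sc(1)] maps(2) w]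
    loop_eval_add[OF loop_radius_R(3) sc(1) w] loop_eval_scale[OF maps(1) w] loop_eval_map[OF loop_radius_R(1) w] loop_eval_map[OF loop_radius_R(2) w] ..
  show "loop_eval B2 w = - (transpose (ad br (loop_eval R\<xi> w + half *s (\<Omega> *v loop_eval \<xi> w))) *v loop_eval \<eta> w)"
    unfolding e2 by (rule KM_bracket)
  have neg: "A *v (- x) = - (A *v x)" for A :: "complex^'n^'n" and x
    by (simp add: vec_eq_iff matrix_vector_mult_def sum_negf)
  show "loop_eval B1 w = transpose (ad br (loop_eval R\<eta> w - half *s (\<Omega> *v loop_eval \<eta> w))) *v loop_eval \<xi> w"
    unfolding e1 bracket_antisym[of "\<Omega> *v loop_eval \<xi> w"] neg KM_bracket by (rule minus_minus)
  show "\<Omega> *v loop_eval B1 w = br (\<Omega> *v loop_eval \<xi> w) (loop_eval R\<eta> w - half *s (\<Omega> *v loop_eval \<eta> w))"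
    "\<Omega> *v loop_eval B2 w = br (loop_eval R\<xi> w + half *s (\<Omega> *v loop_eval \<xi> w)) (\<Omega> *v loop_eval \<eta> w)"
    unfolding e1 e2 by (simp_all only: matrix_vector_mul_assoc KM_casimir matrix_vector_mul_lid)
qed

text \<open>The Yang-Baxter equation at \<open>(z\<^sub>1, z\<^sub>2, z\<^sub>3) = (u, v, z)\<close> is paired with
  \<open>\<xi>(u) \<otimes> \<eta>(v)\<close> in the first two legs and integrated over \<open>|v| < |u| < |z|\<close>.  Every
  inner integral is a value of \<open>R \<plusminus> I / 2\<close>, the sign depending on whether the
  evaluation point is inside or outside the circle of integration.\<close>

lemma integrated_yang_baxter:
  assumes z: "0 < norm z" "norm z < d"
  shows "loop_eval (X_deriv (i_star hb \<xi>) (\<lambda>q. R_op r q \<eta>) q) z - loop_eval (X_deriv (i_star hb \<eta>) (\<lambda>q. R_op r q \<xi>) q) z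
    + h_differential hb (\<lambda>q. loop_pairing \<eta> (R_op r q \<xi>)) q
    - (loop_eval (R_op r q B1) z - half *s (\<Omega> *v loop_eval B1 z))
    - (loop_eval (R_op r q B2) z - half *s (\<Omega> *v loop_eval B2 z))
    + br (loop_eval R\<xi> z - half *s (\<Omega> *v loop_eval \<xi> z)) (loop_eval R\<eta> z - half *s (\<Omega> *v loop_eval \<eta> z)) = 0"
proof -
  \<comment> \<open>Any radii with 0 < \<sigma> < \<rho> < |z| would serve; their ordering decides
    each sign of I / 2 below.\<close>
  define \<rho> \<sigma> where "\<rho> = norm z / 2" and "\<sigma> = norm z / 4"
  have rs: "0 < \<sigma>" "\<sigma> < \<rho>" "\<rho> < norm z" "0 < \<rho>" "\<sigma> < norm z" "\<rho> < d" "\<sigma> < d" "d \<le> R / 4"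
    using z loop_radius_R(5) unfolding \<rho>_def \<sigma>_def by linarith+
  interpret torus \<rho> \<sigma> by unfold_locales (use rs in auto)
  let ?x = "\<lambda>i. eval_fls (\<xi> $ i)" and ?y = "\<lambda>i. eval_fls (\<eta> $ i)"
  have range: "0 < norm (u - v) \<and> norm (u - v) < R" "0 < norm (u - z) \<and> norm (u - z) < R"
    "0 < norm (v - z) \<and> norm (v - z) < R"
    if "norm u = \<rho>" "norm v = \<sigma>" for u v
    using norm_triangle_ineq4[of u v] norm_triangle_ineq4[of u z] norm_triangle_ineq4[of v z] that rs z by auto
  note cr = continuous_on_r[OF U] and cq = continuous_on_q_deriv[OF U]
  have cx: "cont_torus (\<lambda>u v. ?x i u)" and cy: "cont_torus (\<lambda>u v. ?y j v)" for i j
    unfolding split_beta using rs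
    by (intro continuous_on_loop[OF loop_radius_R(1)] continuous_on_loop[OF loop_radius_R(2)] continuous_intros; force)+
  define f12 f13 f23 where "f12 i j u v = r q (u - v) $ i $ j" and "f13 i j u v = r q (u - z) $ i $ j"
    and "f23 i j u v = r q (v - z) $ i $ j" for i j u v
  define d1 d2 d3 where "d1 m i j u v = dr m i j q (v - z)" and "d2 m i j u v = - dr m i j q (u - z)"
    and "d3 m i j u v = dr m i j q (u - v)" for m i j u v
  have c: "cont_torus (f12 i j)" "cont_torus (f13 i j)" "cont_torus (f23 i j)"
    "cont_torus (d1 m i j)" "cont_torus (d2 m i j)" "cont_torus (d3 m i j)" for i j m
    unfolding f12_def f13_def f23_def d1_def d2_def d3_def split_beta using range
    by (intro cr cq continuous_intros; force simp: q)+
  have mult: "cont_torus (\<lambda>u v. F u v * G u v)" if "cont_torus F" "cont_torus G" for F G :: "complex \<Rightarrow> complex \<Rightarrow> complex"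
    using continuous_on_mult[OF that[unfolded split_beta]] by (simp add: split_beta)
  define J where "J i j F = torus_int \<rho> \<sigma> (\<lambda>u v. ?x i u * ?y j v * F u v)" for i j F
  define T where "T i j k =
      (\<Sum>m\<in>UNIV. hb m $ i * J i j (d1 m j k) + hb m $ j * J i j (d2 m i k) + hb m $ k * J i j (d3 m i j))
      + (\<Sum>a\<in>UNIV. \<Sum>b\<in>UNIV. sc a b i * J i j (\<lambda>u v. f12 a j u v * f13 b k u v))
      + (\<Sum>a\<in>UNIV. \<Sum>b\<in>UNIV. sc a b j * J i j (\<lambda>u v. f12 i a u v * f23 b k u v))
      + (\<Sum>a\<in>UNIV. \<Sum>b\<in>UNIV. sc a b k * J i j (\<lambda>u v. f13 i a u v * f23 j b u v))" for i j k
  have yb: "T i j k = 0" for i j k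
    unfolding T_def J_def
    apply (rule torus_int_yang_baxter[OF _ _ c(4-6) c(1-3)])
    subgoal using rs by (intro continuous_on_loop[OF loop_radius_R(1)] continuous_intros) force
    subgoal using rs by (intro continuous_on_loop[OF loop_radius_R(2)] continuous_intros) force
    subgoal premises uv for u v
      unfolding f12_def f13_def f23_def d1_def d2_def d3_def
      using range[OF uv] by (intro yang_baxter[OF U q]) auto
    done
  note in\<xi> = R_kernel_inside[OF U q loop_radius_R(1) loop_radius_R(5)] and out\<xi> = R_kernel_outside[OF U q loop_radius_R(1) loop_radius_R(5)]
  note in\<eta> = R_kernel_inside[OF U q loop_radius_R(2) loop_radius_R(5)]
  \<comment> \<open>The u-integral decouples and yields the coordinates of
    \<open>i_star hb \<xi>\<close>; the v-integral is the differentiated kernel at z.\<close>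
  have t1: "(\<Sum>i\<in>UNIV. \<Sum>j\<in>UNIV. \<Sum>m\<in>UNIV. hb m $ i * J i j (d1 m j k))
      = loop_eval (X_deriv (i_star hb \<xi>) (\<lambda>q. R_op r q \<eta>) q) z $ k" for k
  proof -
    have J: "J i j (d1 m j k) = circ_int \<rho> (?x i) * circ_int \<sigma> (\<lambda>v. dr m j k q (v - z) * ?y j v)" for i j m
      unfolding J_def d1_def torus_int_product[symmetric] by (simp add: mult_ac)
    note star = i_star_eq[OF loop_radius_R(1) rs(4,6)]
    have "(\<Sum>i\<in>UNIV. \<Sum>j\<in>UNIV. \<Sum>m\<in>UNIV. hb m $ i * J i j (d1 m j k))
        = (\<Sum>m\<in>UNIV. i_star hb \<xi> $ m * D_kernel q \<eta> \<sigma> (axis m 1) z $ k)"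
    proof (subst sum_swap3, rule sum.cong[OF refl])
      fix m
      have "D_kernel q \<eta> \<sigma> (axis m 1) z $ k = (\<Sum>j\<in>UNIV. circ_int \<sigma> (\<lambda>v. dr m j k q (v - z) * ?y j v))"
        using z rs by (intro D_kernel_component[OF U loop_radius_R(2,5) q]) auto
      then show "(\<Sum>i\<in>UNIV. \<Sum>j\<in>UNIV. hb m $ i * J i j (d1 m j k)) = i_star hb \<xi> $ m * D_kernel q \<eta> \<sigma> (axis m 1) z $ k"
        by (simp add: J star sum_product mult_ac)
    qed
    also have "\<dots> = D_kernel q \<eta> \<sigma> (i_star hb \<xi>) z $ k"
      using z rs by (intro D_kernel_eq_sum[OF U loop_radius_R(2,5) q, symmetric]) auto
    finally show ?thesis
      using loop_eval_X_deriv[OF U loop_radius_R(2,5) q, of \<sigma> z] z rs by simp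
  qed
  have t2: "(\<Sum>i\<in>UNIV. \<Sum>j\<in>UNIV. \<Sum>m\<in>UNIV. hb m $ j * J i j (d2 m i k))
      = - loop_eval (X_deriv (i_star hb \<eta>) (\<lambda>q. R_op r q \<xi>) q) z $ k" for k
  proof -
    have J: "J i j (d2 m i k) = - (circ_int \<rho> (\<lambda>u. dr m i k q (u - z) * ?x i u) * circ_int \<sigma> (?y j))" for i j m
      unfolding J_def d2_def torus_int_product[symmetric] using torus_int_mult_left[of "-1"] by (simp add: mult_ac)
    note star = i_star_eq[OF loop_radius_R(2) rs(1,7)]
    have "(\<Sum>i\<in>UNIV. \<Sum>j\<in>UNIV. \<Sum>m\<in>UNIV. hb m $ j * J i j (d2 m i k))
        = (\<Sum>m\<in>UNIV. - (D_kernel q \<xi> \<rho> (axis m 1) z $ k * i_star hb \<eta> $ m))"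
    proof (subst sum_swap3, rule sum.cong[OF refl])
      fix m
      have D: "D_kernel q \<xi> \<rho> (axis m 1) z $ k = (\<Sum>i\<in>UNIV. circ_int \<rho> (\<lambda>u. dr m i k q (u - z) * ?x i u))"
        using z rs by (intro D_kernel_component[OF U loop_radius_R(1,5) q]) auto
      show "(\<Sum>i\<in>UNIV. \<Sum>j\<in>UNIV. hb m $ j * J i j (d2 m i k)) = - (D_kernel q \<xi> \<rho> (axis m 1) z $ k * i_star hb \<eta> $ m)"
        unfolding D star sum_product J by (simp add: sum_negf mult_ac)
    qed
    also have "\<dots> = - D_kernel q \<xi> \<rho> (i_star hb \<eta>) z $ k"
      using z rs by (subst D_kernel_eq_sum[OF U loop_radius_R(1,5) q]) (auto simp: sum_negf mult_ac)
    finally show ?thesis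
      using loop_eval_X_deriv[OF U loop_radius_R(1,5) q, of \<rho> z] z rs by simp
  qed
  \<comment> \<open>The variable z drops out, so this term is constant in z. Integrating over u
    first differentiates R \<xi> at v; the v-integral then pairs the result with \<eta>.\<close>
  have t3: "(\<Sum>i\<in>UNIV. \<Sum>j\<in>UNIV. \<Sum>m\<in>UNIV. hb m $ k * J i j (d3 m i j))
      = h_differential hb (\<lambda>q. loop_pairing \<eta> (R_op r q \<xi>)) q $ k" for k
  proof -
    have "(\<Sum>i\<in>UNIV. \<Sum>j\<in>UNIV. J i j (d3 m i j)) = partial_q m (\<lambda>q. loop_pairing \<eta> (R_op r q \<xi>)) q" for m
    proof -
      have cF: "cont_torus (\<lambda>u v. ?x i u * ?y j v * d3 m i j u v)" for i j
        by (intro mult cx cy c)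
      have cF': "cont_torus (\<lambda>u v. \<Sum>i\<in>UNIV. ?x i u * ?y j v * d3 m i j u v)" for j
        using continuous_on_sum[of "UNIV :: 'n set", OF cF[unfolded split_beta]] by (simp add: split_beta)
      have cF'': "cont_torus (\<lambda>u v. \<Sum>j\<in>UNIV. \<Sum>i\<in>UNIV. ?x i u * ?y j v * d3 m i j u v)"
        using continuous_on_sum[of "UNIV :: 'n set", OF cF'[unfolded split_beta]] by (simp add: split_beta)
      have "(\<Sum>i\<in>UNIV. \<Sum>j\<in>UNIV. J i j (d3 m i j)) = (\<Sum>j\<in>UNIV. \<Sum>i\<in>UNIV. J i j (d3 m i j))"
        by (rule sum.swap)
      also have "\<dots> = torus_int \<rho> \<sigma> (\<lambda>u v. \<Sum>j\<in>UNIV. \<Sum>i\<in>UNIV. ?x i u * ?y j v * d3 m i j u v)"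
        by (simp only: J_def torus_int_sum cF cF')
      also have "\<dots> = circ_int \<sigma> (\<lambda>v. circ_int \<rho> (\<lambda>u. \<Sum>j\<in>UNIV. \<Sum>i\<in>UNIV. ?x i u * ?y j v * d3 m i j u v))"
        by (rule torus_int_swap[OF cF''])
      also have "\<dots> = circ_int \<sigma> (\<lambda>v. \<Sum>j\<in>UNIV. ?y j v * D_kernel q \<xi> \<rho> (axis m 1) v $ j)"
      proof (rule circ_int_cong)
        fix v :: complex assume v: "norm v = \<sigma>"
        have cd: "continuous_on (sphere 0 \<rho>) (\<lambda>u. \<Sum>i\<in>UNIV. dr m i j q (u - v) * ?x i u)" for j
          using rs range(1)[OF _ v]
          by (intro continuous_on_sum continuous_on_mult cq continuous_on_loop[OF loop_radius_R(1)] continuous_intros) (auto simp: q)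
        have "circ_int \<rho> (\<lambda>u. \<Sum>j\<in>UNIV. \<Sum>i\<in>UNIV. ?x i u * ?y j v * d3 m i j u v)
            = circ_int \<rho> (\<lambda>u. \<Sum>j\<in>UNIV. ?y j v * (\<Sum>i\<in>UNIV. dr m i j q (u - v) * ?x i u))"
          unfolding d3_def by (simp add: sum_distrib_left mult_ac)
        also have "\<dots> = (\<Sum>j\<in>UNIV. circ_int \<rho> (\<lambda>u. ?y j v * (\<Sum>i\<in>UNIV. dr m i j q (u - v) * ?x i u)))"
          using rs by (intro circ_int_sum continuous_on_mult_left cd) auto
        finally show "circ_int \<rho> (\<lambda>u. \<Sum>j\<in>UNIV. \<Sum>i\<in>UNIV. ?x i u * ?y j v * d3 m i j u v)
            = (\<Sum>j\<in>UNIV. ?y j v * D_kernel q \<xi> \<rho> (axis m 1) v $ j)"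
          by (simp add: circ_int_mult_left D_kernel_def)
      qed (use rs in auto)
      also have "\<dots> = partial_q m (\<lambda>q. loop_pairing \<eta> (R_op r q \<xi>)) q"
        by (rule partial_q_eq[OF loop_pairing_has_derivative[OF U loop_radius_R(1,5) q loop_radius_R(2) rs(1,2,6)], symmetric])
      finally show ?thesis .
    qed
    then show ?thesis
      unfolding h_differential_def by (subst sum_swap3) (simp add: mult.commute flip: sum_distrib_left)
  qed
  have t4: "(\<Sum>i\<in>UNIV. \<Sum>j\<in>UNIV. \<Sum>a\<in>UNIV. \<Sum>b\<in>UNIV. sc a b i * J i j (\<lambda>u v. f12 a j u v * f13 b k u v))
      = - (loop_eval (R_op r q B1) z - half *s (\<Omega> *v loop_eval B1 z)) $ k" (is "?L = _") for k
  proof -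
    have "?L = torus_int \<rho> \<sigma> (\<lambda>u v. \<Sum>i\<in>UNIV. \<Sum>j\<in>UNIV. \<Sum>a\<in>UNIV. \<Sum>b\<in>UNIV.
        sc a b i * (?x i u * ?y j v * (f12 a j u v * f13 b k u v)))" (is "_ = torus_int _ _ ?F")
      unfolding J_def by (rule torus_int_sum4[symmetric]) (intro mult cx cy c)
    also have "\<dots> = circ_int \<rho> (\<lambda>u. - (\<Sum>b\<in>UNIV. r q (u - z) $ b $ k * eval_fls (B1 $ b) u))"
      unfolding torus_int_def
    proof (rule circ_int_cong)
      fix u :: complex assume u: "norm u = \<rho>"
      let ?V = "loop_eval R\<eta> u - half *s (\<Omega> *v loop_eval \<eta> u)"
      \<comment> \<open>\<open>R\<close> pairs the first leg, but \<eta> sits in the second leg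
        here. Unitarity exchanges the legs and reverses u - v, at the price of a sign.\<close>
      have un: "f12 a j u v = - r q (v - u) $ j $ a" if "norm v = \<sigma>" for a j v
        unfolding f12_def using unitarity[OF U q, of "u - v" a j] range(1)[OF u that] by simp
      have cd: "continuous_on (sphere 0 \<sigma>) (\<lambda>v. \<Sum>j\<in>UNIV. f12 a j u v * ?y j v)" for a
        by (intro continuous_on_sum continuous_on_mult cont_torus_slice[OF c(1) u] cont_torus_slice[OF cy u])
      have V: "(\<chi> a. circ_int \<sigma> (\<lambda>v. \<Sum>j\<in>UNIV. f12 a j u v * ?y j v)) = - ?V"
      proof -
        have "circ_int \<sigma> (\<lambda>v. \<Sum>j\<in>UNIV. f12 a j u v * ?y j v)
            = circ_int \<sigma> (\<lambda>v. - (\<Sum>j\<in>UNIV. r q (v - u) $ j $ a * ?y j v))" for a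
          using rs by (intro circ_int_cong) (auto simp: un sum_negf)
        then have "(\<chi> a. circ_int \<sigma> (\<lambda>v. \<Sum>j\<in>UNIV. f12 a j u v * ?y j v)) = - R_kernel q \<eta> \<sigma> u"
          by (simp add: vec_eq_iff R_kernel_def circ_int_minus)
        \<comment> \<open>The evaluation point u lies outside the circle |v| = \<sigma>, whence the
          minus sign of I / 2.\<close>
        also have "R_kernel q \<eta> \<sigma> u = ?V" using rs u by (intro in\<eta>) auto
        finally show ?thesis .
      qed
      have "loop_eval B1 u = transpose (ad br ?V) *v loop_eval \<xi> u"
        by (rule loop_eval_B) (use rs u in auto)
      then have "transpose (ad br (- ?V)) *v loop_eval \<xi> u = - loop_eval B1 u"
        by (simp only: coadjoint_minus)
      \<comment> \<open>\<open>f13\<close> does not depend on its second spectral argument; the 0 is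
        a placeholder.\<close>
      with circ_int_coadjoint[where p = "\<lambda>a j v. f12 a j u v" and x = "loop_eval \<xi> u" and s = "\<lambda>b. f13 b k u 0", OF less_imp_le[OF rs(1)] cd]
      show "circ_int \<sigma> (?F u) = - (\<Sum>b\<in>UNIV. r q (u - z) $ b $ k * eval_fls (B1 $ b) u)"
        unfolding V by (simp add: f13_def sum_negf del: transpose_matrix_vector)
    qed (use rs in auto)
    also have "\<dots> = - R_kernel q B1 \<rho> z $ k"
      by (simp add: circ_int_minus R_kernel_def)
    also have "R_kernel q B1 \<rho> z = loop_eval (R_op r q B1) z - half *s (\<Omega> *v loop_eval B1 z)"
      using rs z by (intro R_kernel_inside[OF U q loop_radius_B(1) loop_radius_R(5)]) auto
    finally show ?thesis .
  qed
  have t5: "(\<Sum>i\<in>UNIV. \<Sum>j\<in>UNIV. \<Sum>a\<in>UNIV. \<Sum>b\<in>UNIV. sc a b j * J i j (\<lambda>u v. f12 i a u v * f23 b k u v))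
      = - (loop_eval (R_op r q B2) z - half *s (\<Omega> *v loop_eval B2 z)) $ k" (is "?L = _") for k
  proof -
    \<comment> \<open>Sums and factors are reordered so that, after exchanging the circles, u is the
      inner variable and \<eta>(v) the fixed covector.\<close>
    define F where "F u v = (\<Sum>j\<in>UNIV. \<Sum>i\<in>UNIV. \<Sum>a\<in>UNIV. \<Sum>b\<in>UNIV.
        sc a b j * (?y j v * ?x i u * (f12 i a u v * f23 b k u v)))" for u v
    have t: "cont_torus (\<lambda>u v. ?y j v * ?x i u * (f12 i a u v * f23 b k u v))" for i j a b
      by (intro mult cx cy c)
    have cF: "cont_torus F"
      unfolding F_def split_beta
      by (intro continuous_on_sum continuous_on_mult_left t[unfolded split_beta])
    have "?L = (\<Sum>j\<in>UNIV. \<Sum>i\<in>UNIV. \<Sum>a\<in>UNIV. \<Sum>b\<in>UNIV. sc a b j * J i j (\<lambda>u v. f12 i a u v * f23 b k u v))"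
      by (rule sum.swap)
    also have "\<dots> = torus_int \<rho> \<sigma> F"
      unfolding J_def F_def mult.commute[of "eval_fls (\<xi> $ _) _" "eval_fls (\<eta> $ _) _"]
      by (rule torus_int_sum4[symmetric]) (rule t)
    also have "\<dots> = circ_int \<sigma> (\<lambda>v. circ_int \<rho> (\<lambda>u. F u v))"
      by (rule torus_int_swap[OF cF])
    also have "\<dots> = circ_int \<sigma> (\<lambda>v. - (\<Sum>b\<in>UNIV. r q (v - z) $ b $ k * eval_fls (B2 $ b) v))"
    proof (rule circ_int_cong)
      fix v :: complex assume v: "norm v = \<sigma>"
      let ?W = "loop_eval R\<xi> v + half *s (\<Omega> *v loop_eval \<xi> v)"
      have cd: "continuous_on (sphere 0 \<rho>) (\<lambda>u. \<Sum>i\<in>UNIV. f12 i a u v * ?x i u)" for a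
        unfolding f12_def using rs v by (intro continuous_on_sum R_kernel_summand_continuous[OF U q loop_radius_R(1,5)]) auto
      \<comment> \<open>Now the evaluation point v is inside the circle |u| = \<rho>, so I / 2
        enters with a plus sign.\<close>
      have W: "(\<chi> a. circ_int \<rho> (\<lambda>u. \<Sum>i\<in>UNIV. f12 i a u v * ?x i u)) = ?W"
        unfolding f12_def R_kernel_def[symmetric] using rs v by (intro out\<xi>) auto
      have "loop_eval B2 v = - (transpose (ad br ?W) *v loop_eval \<eta> v)"
        by (rule loop_eval_B) (use rs v in auto)
      then have "transpose (ad br ?W) *v loop_eval \<eta> v = - loop_eval B2 v" by simp
      with circ_int_coadjoint[where p = "\<lambda>a i u. f12 i a u v" and x = "loop_eval \<eta> v" and s = "\<lambda>b. f23 b k 0 v", OF less_imp_le[OF rs(4)] cd]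
      show "circ_int \<rho> (\<lambda>u. F u v) = - (\<Sum>b\<in>UNIV. r q (v - z) $ b $ k * eval_fls (B2 $ b) v)"
        unfolding W by (simp add: F_def f23_def sum_negf del: transpose_matrix_vector)
    qed (use rs in auto)
    also have "\<dots> = - R_kernel q B2 \<sigma> z $ k"
      by (simp add: circ_int_minus R_kernel_def)
    also have "R_kernel q B2 \<sigma> z = loop_eval (R_op r q B2) z - half *s (\<Omega> *v loop_eval B2 z)"
      using rs z by (intro R_kernel_inside[OF U q loop_radius_B(2) loop_radius_R(5)]) auto
    finally show ?thesis .
  qed
  \<comment> \<open>The variables separate, and z is outside both circles, so each factor is a value
    of R - I / 2.\<close>
  have t6: "(\<Sum>i\<in>UNIV. \<Sum>j\<in>UNIV. \<Sum>a\<in>UNIV. \<Sum>b\<in>UNIV. sc a b k * J i j (\<lambda>u v. f13 i a u v * f23 j b u v))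
      = br (loop_eval R\<xi> z - half *s (\<Omega> *v loop_eval \<xi> z)) (loop_eval R\<eta> z - half *s (\<Omega> *v loop_eval \<eta> z)) $ k" for k
  proof -
    have J: "J i j (\<lambda>u v. f13 i a u v * f23 j b u v)
        = circ_int \<rho> (\<lambda>u. r q (u - z) $ i $ a * ?x i u) * circ_int \<sigma> (\<lambda>v. r q (v - z) $ j $ b * ?y j v)" for i j a b
      unfolding J_def f13_def f23_def torus_int_product[symmetric] by (simp add: mult_ac)
    have X: "loop_eval R\<xi> z - half *s (\<Omega> *v loop_eval \<xi> z) = R_kernel q \<xi> \<rho> z"
      using rs z by (intro in\<xi>[symmetric]) auto
    have Y: "loop_eval R\<eta> z - half *s (\<Omega> *v loop_eval \<eta> z) = R_kernel q \<eta> \<sigma> z"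
      using rs z by (intro in\<eta>[symmetric]) auto
    have KX: "R_kernel q \<xi> \<rho> z $ a = (\<Sum>i\<in>UNIV. circ_int \<rho> (\<lambda>u. r q (u - z) $ i $ a * ?x i u))" for a
      using rs z by (intro R_kernel_component[OF U q loop_radius_R(1,5)]) auto
    have KY: "R_kernel q \<eta> \<sigma> z $ b = (\<Sum>j\<in>UNIV. circ_int \<sigma> (\<lambda>v. r q (v - z) $ j $ b * ?y j v))" for b
      using rs z by (intro R_kernel_component[OF U q loop_radius_R(2,5)]) auto
    show ?thesis
      unfolding X Y bracket_component[of "R_kernel _ _ _ _"] J KX KY mult.assoc sum_product
      by (subst sum_swap4) (simp only: sum_distrib_left)
  qed
  have "(\<Sum>i\<in>UNIV. \<Sum>j\<in>UNIV. T i j k) = 0" for k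
    by (simp only: yb sum.neutral_const)
  then have sum0: "loop_eval (X_deriv (i_star hb \<xi>) (\<lambda>q. R_op r q \<eta>) q) z $ k
    + (- loop_eval (X_deriv (i_star hb \<eta>) (\<lambda>q. R_op r q \<xi>) q) z $ k)
    + h_differential hb (\<lambda>q. loop_pairing \<eta> (R_op r q \<xi>)) q $ k
    + (- (loop_eval (R_op r q B1) z - half *s (\<Omega> *v loop_eval B1 z)) $ k)
    + (- (loop_eval (R_op r q B2) z - half *s (\<Omega> *v loop_eval B2 z)) $ k)
    + br (loop_eval R\<xi> z - half *s (\<Omega> *v loop_eval \<xi> z)) (loop_eval R\<eta> z - half *s (\<Omega> *v loop_eval \<eta> z)) $ k = 0" for k
    by (simp only: T_def sum.distrib t1 t2 t3 t4 t5 t6)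
  show ?thesis
    unfolding vec_eq_iff using sum0 by (simp add: algebra_simps)
qed

end

lemma modified_dynamical_yang_baxter:
  assumes q: "q \<in> regular_points r" and \<xi>: "\<xi> \<in> loop_space" and \<eta>: "\<eta> \<in> loop_space"
  shows "loop_bracket br (R_op r q \<xi>) (R_op r q \<eta>)
          - R_op r q (I_inv br (loop_bracket br (R_op r q \<xi>) (I_map br \<eta>))
                      + I_inv br (loop_bracket br (I_map br \<xi>) (R_op r q \<eta>)))
          + X_deriv (i_star hb \<xi>) (\<lambda>q. R_op r q \<eta>) q
          - X_deriv (i_star hb \<eta>) (\<lambda>q. R_op r q \<xi>) q
          + const_loop (h_differential hb (\<lambda>q. loop_pairing \<eta> (R_op r q \<xi>)) q)
          = fls_const (- 1 / 4) *s loop_bracket br (I_map br \<xi>) (I_map br \<eta>)"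
proof -
  obtain U R where U: "regular_on U R" and qU: "q \<in> U"
    by (rule regular_pointsE[OF q])
  have R: "0 < R / 4" using R_pos[OF U] by simp
  obtain d1 where d1: "loop_radius \<xi> d1" "d1 \<le> R / 4" using loop_spaceE[OF \<xi> R] by blast
  obtain d0 where d0: "loop_radius \<eta> d0" "d0 \<le> d1" using loop_spaceE[OF \<eta> radius_pos[OF d1(1)]] by blast
  note \<xi>0 = loop_radius_mono[OF d1(1) radius_pos[OF d0(1)] d0(2)]
  have d0R: "d0 \<le> R / 4" using d0 d1 by simp
  define d where "d = d0 / 2"
  have d: "0 < d" "d < d0" using radius_pos[OF d0(1)] by (auto simp: d_def)
  note ctx = U qU \<xi>0 d0(1) d0R d
  let ?R\<xi> = "R_op r q \<xi>" and ?R\<eta> = "R_op r q \<eta>" and ?B1 = "B1 q \<xi> \<eta>" and ?B2 = "B2 q \<xi> \<eta>"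
  let ?L = "loop_bracket br ?R\<xi> ?R\<eta>" and ?X\<xi> = "X_deriv (i_star hb \<xi>) (\<lambda>q. R_op r q \<eta>) q"
    and ?X\<eta> = "X_deriv (i_star hb \<eta>) (\<lambda>q. R_op r q \<xi>) q"
    and ?D = "const_loop (h_differential hb (\<lambda>q. loop_pairing \<eta> (R_op r q \<xi>)) q)"
    and ?Q = "fls_const (- 1 / 4) *s loop_bracket br (loop_map \<Omega> \<xi>) (loop_map \<Omega> \<eta>)"
  let ?B = "loop_map KM (loop_bracket br ?R\<xi> (loop_map \<Omega> \<eta>)) + loop_map KM (loop_bracket br (loop_map \<Omega> \<xi>) ?R\<eta>)"
  note rad = loop_radius_R[OF ctx]
  note maps = loop_radius_map[OF rad(1), of \<Omega>] loop_radius_map[OF rad(2), of \<Omega>]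
  note brs = loop_radius_bracket[OF rad(3) maps(2)] loop_radius_bracket[OF maps(1) rad(4)]
  \<comment> \<open>The shifts contribute -1/2 and +1/2 times [I \<xi>, I \<eta>] and
    cancel.\<close>
  have B: "?B = ?B2 + ?B1"
  proof (rule loop_eqI'[OF loop_radius_add[OF loop_radius_map[OF brs(1)] loop_radius_map[OF brs(2)]] 
        loop_radius_add[OF loop_radius_B(2)[OF ctx] loop_radius_B(1)[OF ctx]]])
    fix z :: complex assume "0 < norm z" "norm z < d"
    then have z: "z \<noteq> 0" "norm z \<le> d" and z': "0 < norm z" by auto
    have "loop_eval ?B z = KM *v (br (loop_eval ?R\<xi> z) (\<Omega> *v loop_eval \<eta> z) + br (\<Omega> *v loop_eval \<xi> z) (loop_eval ?R\<eta> z))"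
      unfolding loop_eval_add[OF loop_radius_map[OF brs(1)] loop_radius_map[OF brs(2)] z]
        loop_eval_map[OF brs(1) z] loop_eval_map[OF brs(2) z] loop_eval_bracket[OF rad(3) maps(2) z]
        loop_eval_bracket[OF maps(1) rad(4) z] loop_eval_map[OF rad(1) z] loop_eval_map[OF rad(2) z]
      by (rule matrix_vector_right_distrib[symmetric])
    also have "br (loop_eval ?R\<xi> z) (\<Omega> *v loop_eval \<eta> z) + br (\<Omega> *v loop_eval \<xi> z) (loop_eval ?R\<eta> z)
        = \<Omega> *v loop_eval ?B2 z + \<Omega> *v loop_eval ?B1 z"
      unfolding loop_eval_B(3,4)[OF ctx z' z(2)] by (simp add: bracket_left bracket_right)
    also have "KM *v \<dots> = loop_eval ?B2 z + loop_eval ?B1 z"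
      unfolding matrix_vector_right_distrib matrix_vector_mul_assoc KM_casimir matrix_vector_mul_lid ..
    finally show "loop_eval ?B z = loop_eval (?B2 + ?B1) z"
      unfolding loop_eval_add[OF loop_radius_B(2)[OF ctx] loop_radius_B(1)[OF ctx] z] .
  qed
  have RB: "R_op r q ?B = R_op r q ?B2 + R_op r q ?B1"
    unfolding B using loop_radius_B[OF ctx] by (intro R_op_add[OF U qU] loop_radius_imp_loop_space)
  define e where "e = d / 2"
  have e: "0 < e" "e < d" "e \<le> d" using d by (auto simp: e_def)
  note mono = loop_radius_mono[OF _ e(1,3)]
  note rB = loop_radius_R_op[OF U qU loop_radius_B(2)[OF ctx] rad(5) e(1,2)] loop_radius_R_op[OF U qU loop_radius_B(1)[OF ctx] rad(5) e(1,2)]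
  note rX = loop_radius_X_deriv[OF U rad(2,5) qU e(1,2), of "i_star hb \<xi>"]
    loop_radius_X_deriv[OF U rad(1,5) qU e(1,2), of "i_star hb \<eta>"]
  note rc = loop_radius_const[OF e(1), of "h_differential hb (\<lambda>q. loop_pairing \<eta> (R_op r q \<xi>)) q"]
  note r0 = mono[OF loop_radius_bracket[OF rad(3) rad(4)]]
  note r1 = loop_radius_diff[OF r0 loop_radius_add[OF rB]]
  note r2 = loop_radius_add[OF r1 rX(1)]
  note r3 = loop_radius_diff[OF r2 rX(2)]
  note r4 = loop_radius_add[OF r3 rc]
  note r5 = mono[OF loop_radius_bracket[OF maps]]
  show ?thesis
    unfolding I_map_eq I_inv_eq RB
  proof (rule loop_eqI'[OF r4 loop_radius_scale[OF r5]])
    fix z :: complex assume z0: "0 < norm z" "norm z < e"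
    then have z: "z \<noteq> 0" "norm z \<le> e" and zd: "norm z \<le> d" "norm z < d" and z': "0 < norm z" using e by auto
    let ?x = "\<Omega> *v loop_eval \<xi> z" and ?y = "\<Omega> *v loop_eval \<eta> z"
      and ?X = "loop_eval ?R\<xi> z" and ?Y = "loop_eval ?R\<eta> z"
    have "loop_eval (?L - (R_op r q ?B2 + R_op r q ?B1) + ?X\<xi> - ?X\<eta> + ?D) z
        = br ?X ?Y - (loop_eval (R_op r q ?B2) z + loop_eval (R_op r q ?B1) z)
          + loop_eval ?X\<xi> z - loop_eval ?X\<eta> z + h_differential hb (\<lambda>q. loop_pairing \<eta> (R_op r q \<xi>)) q"
      unfolding loop_eval_add[OF r3 rc z] loop_eval_diff[OF r2 rX(2) z] loop_eval_add[OF r1 rX(1) z]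
        loop_eval_diff[OF r0 loop_radius_add[OF rB] z] loop_eval_add[OF rB z]
        loop_eval_bracket[OF rad(3,4) z(1) zd(1)] loop_eval_const ..
    also have "\<dots> = br ?X ?Y - (1 / 2) *s (\<Omega> *v loop_eval ?B1 z) - (1 / 2) *s (\<Omega> *v loop_eval ?B2 z)
        - br (?X - (1 / 2) *s ?x) (?Y - (1 / 2) *s ?y)"
      using integrated_yang_baxter[OF ctx z' zd(2)] by (simp add: algebra_simps)
    \<comment> \<open>The mixed brackets cancel, and so do the quarters arising from
      \<open>B1\<close> and \<open>B2\<close>. What survives is the product of the two halves in the
      last bracket, with its minus sign.\<close>
    also have "\<dots> = (- 1 / 4) *s br ?x ?y"
      unfolding loop_eval_B(3,4)[OF ctx z' zd(1)] 
      by (simp add: bracket_left bracket_right vec_eq_iff field_simps)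
    also have "\<dots> = loop_eval ?Q z"
      unfolding loop_eval_scale[OF r5 z] loop_eval_bracket[OF maps z(1) zd(1)]
        loop_eval_map[OF rad(1) z(1) zd(1)] loop_eval_map[OF rad(2) z(1) zd(1)] ..
    finally show "loop_eval (?L - (R_op r q ?B2 + R_op r q ?B1) + ?X\<xi> - ?X\<eta> + ?D) z = loop_eval ?Q z" .
  qed
qed

text \<open>\<open>partial_q\<close> rests on the total function \<open>deriv\<close>; this
  certifies that the numbers entering \<open>h_differential\<close> are the coordinates of a genuine
  differential.\<close>

lemma loop_pairing_total_derivative:
  assumes q: "q \<in> regular_points r" and \<xi>: "\<xi> \<in> loop_space" and \<eta>: "\<eta> \<in> loop_space"
  shows "((\<lambda>q. loop_pairing \<eta> (R_op r q \<xi>)) has_derivative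
      (\<lambda>a. \<Sum>k\<in>UNIV. a $ k * partial_q k (\<lambda>q. loop_pairing \<eta> (R_op r q \<xi>)) q)) (at q)"
proof -
  obtain U R where U: "regular_on U R" and qU: "q \<in> U"
    by (rule regular_pointsE[OF q])
  have R: "0 < R / 4" using R_pos[OF U] by simp
  obtain d1 where d1: "loop_radius \<xi> d1" "d1 \<le> R / 4" using loop_spaceE[OF \<xi> R] by blast
  obtain d where d: "loop_radius \<eta> d" "d \<le> d1" using loop_spaceE[OF \<eta> radius_pos[OF d1(1)]] by blast
  have dR: "d \<le> R / 4" using d d1 by simp
  have rs: "0 < d / 4" "d / 4 < d / 2" "d / 2 < d" using radius_pos[OF d(1)] by auto
  note D = loop_pairing_has_derivative[OF U loop_radius_mono[OF d1(1) radius_pos[OF d(1)] d(2)] dR qU d(1) rs]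
  show ?thesis
    using D(1) by (rule has_derivative_eq_rhs) (rule ext, rule derivative_eq_partials[OF D])
qed

text \<open>\<open>R_op\<close> and \<open>X_deriv\<close> are definite descriptions; these facts
  give them their intended meaning at every regular point.\<close>

lemma R_op_well_defined:
  assumes q: "q \<in> regular_points r" and \<xi>: "\<xi> \<in> loop_space"
  shows "is_R r q \<xi> (R_op r q \<xi>)"
    and "is_X_deriv a (\<lambda>q. R_op r q \<xi>) q (X_deriv a (\<lambda>q. R_op r q \<xi>) q)"
proof -
  obtain U R where U: "regular_on U R" and qU: "q \<in> U"
    by (rule regular_pointsE[OF q])
  obtain d where d: "loop_radius \<xi> d" "d \<le> R / 4" using loop_spaceE[OF \<xi>, of "R / 4"] R_pos[OF U] by auto
  show "is_R r q \<xi> (R_op r q \<xi>)" by (rule is_R_R_op[OF U qU d])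
  show "is_X_deriv a (\<lambda>q. R_op r q \<xi>) q (X_deriv a (\<lambda>q. R_op r q \<xi>) q)"
    by (rule is_X_deriv_X_deriv[OF U d qU])
qed

end

theorem proposition3p1:
  fixes br :: "complex^'n \<Rightarrow> complex^'n \<Rightarrow> complex^'n"
    and h :: "(complex^'n) set"
    and hb :: "'l::finite \<Rightarrow> complex^'n"
    and r :: "complex^'l \<Rightarrow> complex \<Rightarrow> complex^'n^'n"
  assumes "simple_lie_algebra br"
    and "cartan_subalgebra br h"
    and "orthonormal_basis br h hb"
    and "dynamical_r_matrix br h hb r"
  shows
    "\<forall>q\<in>regular_points r.
       (\<forall>\<xi>\<in>loop_space. is_R r q \<xi> (R_op r q \<xi>)) \<and>
       R_op r q \<in> equivariant_maps br h \<and>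
       (\<forall>\<xi>\<in>loop_space. \<forall>a. is_X_deriv a (\<lambda>q. R_op r q \<xi>) q (X_deriv a (\<lambda>q. R_op r q \<xi>) q)) \<and>
       (\<forall>\<xi>\<in>loop_space. \<forall>\<eta>\<in>loop_space.
          ((\<lambda>q. loop_pairing \<eta> (R_op r q \<xi>)) has_derivative
             (\<lambda>a. \<Sum>k\<in>UNIV. a $ k * partial_q k (\<lambda>q. loop_pairing \<eta> (R_op r q \<xi>)) q)) (at q)) \<and>
       (\<forall>\<xi>\<in>loop_space. \<forall>\<eta>\<in>loop_space.
          loop_bracket br (R_op r q \<xi>) (R_op r q \<eta>)
          - R_op r q (I_inv br (loop_bracket br (R_op r q \<xi>) (I_map br \<eta>))
                      + I_inv br (loop_bracket br (I_map br \<xi>) (R_op r q \<eta>)))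
          + X_deriv (i_star hb \<xi>) (\<lambda>q. R_op r q \<eta>) q
          - X_deriv (i_star hb \<eta>) (\<lambda>q. R_op r q \<xi>) q
          + const_loop (h_differential hb (\<lambda>q. loop_pairing \<eta> (R_op r q \<xi>)) q)
          = fls_const (- 1 / 4) *s loop_bracket br (I_map br \<xi>) (I_map br \<eta>))"
proof -
  interpret dynamical_setup br h hb r
    using assms by unfold_locales (simp_all add: simple_lie_algebra_def)
  have "R_op r q \<in> equivariant_maps br h" if "q \<in> regular_points r" for q
    using that by (rule regular_pointsE) (rule R_op_equivariant)
  then show ?thesis
    using R_op_well_defined loop_pairing_total_derivative modified_dynamical_yang_baxter by blast
qed

end
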